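(* Let $Q(\zeta)=|\zeta|^2$ if $|\zeta|\le\sqrt2$ and $Q(\zeta)=+\infty$ otherwise. Let $\sigma\in\{+1,-1\}$ and $p=\sigma\sqrt2$. Let $\boldsymbol\zeta=\{\zeta_j\}_{j=1}^N$ be the planar symplectic ensemble with potential $Q$, and let $R_{N,k}$ be the $k$-point correlation function of the rescaled process $z_j=\sigma\gamma_N^{-1}(\zeta_j-p)$, where $\gamma_N=\sqrt{2/N}$. Then for every $k\ge1$, as $N\to\infty$, $R_{N,k}$ converges locally uniformly on $\mathbb{H}_-^k$, where $\mathbb{H}_-=\{z\in\mathbb{C}:\operatorname{Re}z<0\}$, to $$R_k(z_1,\dots,z_k)=\prod_{j=1}^k(\bar z_j-z_j)\,\mathrm{Pf}\Bigl[e^{-|z_j|^2-|z_l|^2}\begin{pmatrix}\kappa(z_j,z_l)&\kappa(z_j,\bar z_l)\\ \kappa(\bar z_j,z_l)&\kappa(\bar z_j,\bar z_l)\end{pmatrix}\Bigr]_{j,l=1}^k,$$ where $$\kappa(z,w)=\sqrt\pi\,e^{z^2+w^2}\int_{-\infty}^0W(f_w,f_z)(u)\,du,\qquad f_z(u)=\frac{2}{\sqrt\pi}\int_{-\infty}^u\frac{e^{-2(z-t)^2}}{\sqrt{\operatorname{erfc}(2t)}}\,dt.$$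
   Context: Planar symplectic ensemble with potential $Q$ (satisfying $Q(\zeta)=Q(\bar\zeta)$): the random configuration $\boldsymbol\zeta=(\zeta_1,\dots,\zeta_N)\in\mathbb{C}^N$ with law $$d\mathbf{P}_N(\boldsymbol\zeta)=\frac1{Z_N}\prod_{j>k=1}^N|\zeta_j-\zeta_k|^2|\zeta_j-\bar\zeta_k|^2\prod_{j=1}^N|\zeta_j-\bar\zeta_j|^2e^{-NQ(\zeta_j)}\,dA(\zeta_j),\qquad dA(\zeta)=\tfrac1\pi d^2\zeta,$$ where $Z_N$ is the normalising constant, $d^2\zeta$ is Lebesgue measure on $\mathbb{C}$ and $e^{-\infty}=0$. Writing $\mathbf{P}_N(\zeta_1,\dots,\zeta_N)$ for the density of this law with respect to $\prod_j dA(\zeta_j)$, the $k$-point correlation function is $$\mathbf{R}_{N,k}(\zeta_1,\dots,\zeta_k)=\frac{N!}{(N-k)!}\int_{\mathbb{C}^{N-k}}\mathbf{P}_N(\zeta_1,\dots,\zeta_N)\prod_{j=k+1}^N dA(\zeta_j).$$ For the rescaled process, $R_{N,k}(z_1,\dots,z_k)=\gamma_N^{2k}\mathbf{R}_{N,k}(\zeta_1,\dots,\zeta_k)$ with $\zeta_j=p+\sigma\gamma_Nz_j$. The factor $\sigma=e^{i\theta}$ is the outward normal direction at $p$ of the disk of radius $\sqrt2$. $\operatorname{erfc}$ is the complementary error function. $W(f,g)=fg'-gf'$ is the Wronskian (derivatives in $u$). For a skew-symmetric $2n\times2n$ matrix $A=(a_{j,k})$, $\mathrm{Pf}(A)=\frac{1}{2^nn!}\sum_{\pi\in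 S_{2n}}\mathrm{sgn}(\pi)\prod_{j=1}^na_{\pi(2j-1),\pi(2j)}$, with $S_{2n}$ the symmetric group on $2n$ letters; it is applied to the $2k\times2k$ matrix made of the indicated $2\times2$ blocks. *)

theory Defs
  imports "HOL-Analysis.Analysis" "HOL-Combinatorics.Permutations"
begin

text \<open>
  A configuration of \<open>n\<close> points of the plane is a function \<open>nat \<Rightarrow> complex\<close> on the index set
  \<open>{..<n}\<close>, extensional as in \<^const>\<open>PiM\<close> and \<^const>\<open>product_topology\<close>.
  Indices start at 0 throughout, so the points called 1 to \<open>n\<close> on paper are 0 to \<open>n - 1\<close> here.
\<close>

definition area_measure :: "complex measure" where
  "area_measure = density lborel (\<lambda>_. ennreal (1 / pi))"


subsection \<open>The planar symplectic ensemble\<close>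

text \<open>The factor \<open>exp (- N Q)\<close>, with \<open>exp (-\<infinity>) = 0\<close>.\<close>

definition boltzmann_factor :: "nat \<Rightarrow> (complex \<Rightarrow> ereal) \<Rightarrow> complex \<Rightarrow> real" where
  "boltzmann_factor N Q \<zeta> = (if Q \<zeta> = \<infinity> then 0 else exp (- (real N * real_of_ereal (Q \<zeta>))))"

definition symplectic_weight :: "nat \<Rightarrow> (complex \<Rightarrow> ereal) \<Rightarrow> (nat \<Rightarrow> complex) \<Rightarrow> real" where
  "symplectic_weight N Q \<zeta> =
     (\<Prod>j<N. \<Prod>k<j. (cmod (\<zeta> j - \<zeta> k))\<^sup>2 * (cmod (\<zeta> j - cnj (\<zeta> k)))\<^sup>2) *
     (\<Prod>j<N. (cmod (\<zeta> j - cnj (\<zeta> j)))\<^sup>2 * boltzmann_factor N Q (\<zeta> j))"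

definition partition_function :: "nat \<Rightarrow> (complex \<Rightarrow> ereal) \<Rightarrow> real" where
  "partition_function N Q =
     (\<integral>\<zeta>. symplectic_weight N Q \<zeta> \<partial>(PiM {..<N} (\<lambda>_. area_measure)))"

definition symplectic_density :: "nat \<Rightarrow> (complex \<Rightarrow> ereal) \<Rightarrow> (nat \<Rightarrow> complex) \<Rightarrow> real" where
  "symplectic_density N Q \<zeta> = symplectic_weight N Q \<zeta> / partition_function N Q"

text \<open>Only meaningful for \<open>k \<le> N\<close>.\<close>

definition correlation ::
    "nat \<Rightarrow> (complex \<Rightarrow> ereal) \<Rightarrow> nat \<Rightarrow> (nat \<Rightarrow> complex) \<Rightarrow> real" where
  "correlation N Q k \<zeta> = fact N / fact (N - k) *
     (\<integral>\<eta>. symplectic_density N Q (merge {..<k} {k..<N} (\<zeta>, \<eta>))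
        \<partial>(PiM {k..<N} (\<lambda>_. area_measure)))"


subsection \<open>Rescaling at a boundary point\<close>

definition scale :: "nat \<Rightarrow> real" where
  "scale N = sqrt (2 / real N)"

text \<open>The correlation function of the points \<open>z j = (\<zeta> j - p) / (\<sigma> * scale N)\<close>, for \<open>cmod \<sigma> = 1\<close>.\<close>

definition rescaled_correlation ::
    "complex \<Rightarrow> complex \<Rightarrow> nat \<Rightarrow> (complex \<Rightarrow> ereal) \<Rightarrow> nat \<Rightarrow> (nat \<Rightarrow> complex) \<Rightarrow> real" where
  "rescaled_correlation p \<sigma> N Q k z =
     scale N ^ (2 * k) *
     correlation N Q k (\<lambda>j\<in>{..<k}. p + \<sigma> * complex_of_real (scale N) * z j)"

definition hard_edge_potential :: "complex \<Rightarrow> ereal" where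
  "hard_edge_potential \<zeta> = (if cmod \<zeta> \<le> sqrt 2 then ereal ((cmod \<zeta>)\<^sup>2) else \<infinity>)"


subsection \<open>The limiting correlation functions\<close>

definition erfc :: "real \<Rightarrow> real" where
  "erfc x = 2 / sqrt pi * (LINT t:{x..}|lborel. exp (- t\<^sup>2))"

definition wronskian :: "(real \<Rightarrow> complex) \<Rightarrow> (real \<Rightarrow> complex) \<Rightarrow> real \<Rightarrow> complex" where
  "wronskian f g u = f u * vector_derivative g (at u) - vector_derivative f (at u) * g u"

definition edge_fun :: "complex \<Rightarrow> real \<Rightarrow> complex" where
  "edge_fun z u = 2 / complex_of_real (sqrt pi) *
     (LINT t:{..u}|lborel.
        exp (- 2 * (z - complex_of_real t)\<^sup>2) / complex_of_real (sqrt (erfc (2 * t))))"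

definition edge_kernel :: "complex \<Rightarrow> complex \<Rightarrow> complex" where
  "edge_kernel z w = complex_of_real (sqrt pi) * exp (z\<^sup>2 + w\<^sup>2) *
     (LINT u:{..0}|lborel. wronskian (edge_fun w) (edge_fun z) u)"

text \<open>The Pfaffian of the \<open>2n \<times> 2n\<close> matrix with entries \<open>A i j\<close>, \<open>i, j < 2n\<close>.\<close>

definition pfaffian :: "nat \<Rightarrow> (nat \<Rightarrow> nat \<Rightarrow> complex) \<Rightarrow> complex" where
  "pfaffian n A = 1 / (2 ^ n * fact n) *
     (\<Sum>\<pi> | \<pi> permutes {..<2 * n}. of_int (sign \<pi>) * (\<Prod>j<n. A (\<pi> (2 * j)) (\<pi> (2 * j + 1))))"

text \<open>
  The \<open>2k \<times> 2k\<close> matrix made of the \<open>2 \<times> 2\<close> blocks: row \<open>a\<close> lies in block row \<open>a div 2\<close>, and its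
  kernel argument is \<open>z (a div 2)\<close> or its conjugate according to the parity of \<open>a\<close>; likewise for
  columns.
\<close>

definition edge_matrix :: "(nat \<Rightarrow> complex) \<Rightarrow> nat \<Rightarrow> nat \<Rightarrow> complex" where
  "edge_matrix z a b =
     (let j = a div 2; l = b div 2 in
      complex_of_real (exp (- (cmod (z j))\<^sup>2 - (cmod (z l))\<^sup>2)) *
      edge_kernel (if even a then z j else cnj (z j)) (if even b then z l else cnj (z l)))"

definition limit_correlation :: "nat \<Rightarrow> (nat \<Rightarrow> complex) \<Rightarrow> complex" where
  "limit_correlation k z = (\<Prod>j<k. cnj (z j) - z j) * pfaffian k (edge_matrix z)"


subsection \<open>Locally uniform convergence\<close>

definition left_half_plane :: "complex set" where
  "left_half_plane = {z. Re z < 0}"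

definition left_half_plane_power :: "nat \<Rightarrow> (nat \<Rightarrow> complex) topology" where
  "left_half_plane_power k = product_topology (\<lambda>_. top_of_set left_half_plane) {..<k}"

definition locally_uniform_limit ::
    "'a topology \<Rightarrow> ('i \<Rightarrow> 'a \<Rightarrow> 'b::metric_space) \<Rightarrow> ('a \<Rightarrow> 'b) \<Rightarrow> 'i filter \<Rightarrow> bool" where
  "locally_uniform_limit X f l F \<longleftrightarrow>
     (\<forall>x\<in>topspace X. \<exists>U. openin X U \<and> x \<in> U \<and> uniform_limit U f l F)"

end

theory Submission
  imports
    Defs
    "HOL-Probability.Distributions"
    "HOL-Real_Asymp.Real_Asymp"
    "Jordan_Normal_Form.Determinant"
begin

text \<open>
  The weight is a product of one-point factors and the Vandermonde determinant of the \<open>2 * N\<close> numbers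
  \<open>\<zeta> j\<close>, \<open>cnj (\<zeta> j)\<close>. Written in polynomials that are skew-orthogonal for the radial weight, it is a sum over
  permutations in which integrating out a point leaves only the terms that send its two variables to a
  pair of consecutive polynomials; this gives the correlation functions as Pfaffians of a double sum of
  monomials. The coefficients of that sum are ratios of incomplete gamma integrals, that is, of tail
  probabilities of the Poisson distribution with mean \<open>2 * N\<close>. At the edge the double sum is a Riemann sum of
  mesh \<open>1 / sqrt N\<close>: the Poisson weights become Gaussian, and the product over every second ratio of
  consecutive tails is, by log-concavity, pinched between square roots of tails, which become the factors
  \<open>1 / sqrt (erfc (2 * t))\<close>. Dominated convergence applies along every convergent sequence of arguments, and
  this already forces locally uniform convergence.
\<close>


subsection \<open>Alternating sums over permutations\<close>

text \<open>The half-plane keeps the hard wall out of sight: for large \<open>N\<close> the points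
  of a compact part of it lie inside the disk, where the weight is a plain Gaussian, while the
  rescaled kernel converges for all complex arguments. As the weight is radial, multiplication by
  \<open>\<zeta> - cnj \<zeta>\<close> couples only neighbouring degrees; hence the odd polynomials
  are monomials and only the even ones carry coefficients. Each coefficient is a quotient of a
  function of the upper degree by the same function of the lower degree, so the double sum is
  separated up to the constraint on its two indices, and two nested one-dimensional Riemann sums
  suffice. Indices are counted down from the top degree: the index \<open>x * sqrt N\<close>
  corresponds to \<open>u = - x / 2\<close> in the limiting integrals. The obstacle is the product
  over every second ratio of tails: the product over all ratios telescopes, this one does not.
  Log-concavity makes it asymptotically the square root of the telescoping one.\<close>

definition block_lift :: "(nat \<Rightarrow> nat) \<Rightarrow> nat \<Rightarrow> nat" where
  "block_lift \<mu> a = 2 * \<mu> (a div 2) + a mod 2"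

lemma block_lift_even [simp]: "block_lift \<mu> (2 * j) = 2 * \<mu> j"
  and block_lift_odd [simp]: "block_lift \<mu> (Suc (2 * j)) = Suc (2 * \<mu> j)"
  by (simp_all add: block_lift_def)

lemma block_lift_id: "block_lift id = id"
  by (auto simp: block_lift_def fun_eq_iff)

lemma block_lift_comp: "block_lift (\<mu> \<circ> \<nu>) = block_lift \<mu> \<circ> block_lift \<nu>"
  by (auto simp: block_lift_def fun_eq_iff)

lemma nat_parity_cases:
  fixes a :: nat
  obtains j where "a = 2 * j" | j where "a = Suc (2 * j)"
  by (metis evenE oddE Suc_eq_plus1)

lemma block_lift_transpose:
  "block_lift (Transposition.transpose i j) = Transposition.transpose (2 * i) (2 * j) \<circ> Transposition.transpose (Suc (2 * i)) (Suc (2 * j))"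
proof
  fix a show "block_lift (Transposition.transpose i j) a = (Transposition.transpose (2 * i) (2 * j) \<circ> Transposition.transpose (Suc (2 * i)) (Suc (2 * j))) a"
  proof (cases a rule: nat_parity_cases)
    case (1 m)
    then show ?thesis by (auto simp: Transposition.transpose_def)
  next
    case (2 m)
    then show ?thesis by (auto simp: Transposition.transpose_def)
  qed
qed

lemma sign_block_lift_transpose: "sign (block_lift (Transposition.transpose i j)) = 1"
  by (simp add: block_lift_transpose sign_compose sign_swap_id permutation_swap_id)

lemma permutation_block_lift_transpose: "permutation (block_lift (Transposition.transpose i j))"
  unfolding block_lift_transpose by (intro permutation_compose permutation_swap_id)

text \<open>Exchanging two pairs takes two transpositions of letters, and such exchanges generate
  all permutations of pairs. Hence relabelling pairs never costs a sign in the sums below.\<close>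

lemma block_lift_permutes_sign:
  assumes "\<mu> permutes {..<n}"
  shows "block_lift \<mu> permutes {..<2 * n} \<and> sign (block_lift \<mu>) = 1"
  using assms finite_lessThan
proof (induction rule: permutes_induct)
  case id
  show ?case unfolding block_lift_id using permutes_id sign_id by blast
next
  case (swap a b \<mu>)
  have P: "block_lift (Transposition.transpose a b) permutes {..<2 * n}"
    unfolding block_lift_transpose using swap
    by (intro permutes_compose permutes_swap_id) auto
  show ?case
  proof
    show "block_lift (Transposition.transpose a b \<circ> \<mu>) permutes {..<2 * n}"
      unfolding block_lift_comp using P swap by (intro permutes_compose) auto
    have "permutation (block_lift \<mu>)"
      using swap permutation_permutes by blast
    then show "sign (block_lift (Transposition.transpose a b \<circ> \<mu>)) = 1"
      unfolding block_lift_comp using swap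
      by (simp add: sign_compose permutation_block_lift_transpose sign_block_lift_transpose)
  qed
qed

text \<open>A Pfaffian sum without its normalisation and with two freedoms: the factor
  \<open>H j\<close> may depend on the pair, so that some pairs still carry a free point while
  others are integrated out, and the labelling \<open>c\<close> selects the polynomials that take
  part.\<close>

definition alternating_sum ::
    "nat \<Rightarrow> (nat \<Rightarrow> nat \<Rightarrow> nat \<Rightarrow> complex) \<Rightarrow> (nat \<Rightarrow> nat) \<Rightarrow> complex" where
  "alternating_sum n H c =
     (\<Sum>\<pi> | \<pi> permutes {..<2 * n}.
        of_int (sign \<pi>) * (\<Prod>j<n. H j (c (\<pi> (2 * j))) (c (\<pi> (Suc (2 * j))))))"

lemma alternating_sum_comp:
  assumes \<rho>: "\<rho> permutes {..<2 * n}"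
  shows "alternating_sum n H (c \<circ> \<rho>) = of_int (sign \<rho>) * alternating_sum n H c"
proof -
  have P: "permutation \<rho>" using \<rho> permutation_permutes by blast
  have "alternating_sum n H c =
     (\<Sum>\<pi> | \<pi> permutes {..<2 * n}.
        of_int (sign (\<rho> \<circ> \<pi>)) * (\<Prod>j<n. H j (c ((\<rho> \<circ> \<pi>) (2 * j))) (c ((\<rho> \<circ> \<pi>) (Suc (2 * j))))))"
    unfolding alternating_sum_def by (rule setum_permutations_compose_left[OF \<rho>])
  also have "\<dots> = (\<Sum>\<pi> | \<pi> permutes {..<2 * n}.
        of_int (sign \<rho>) * (of_int (sign \<pi>) *
         (\<Prod>j<n. H j ((c \<circ> \<rho>) (\<pi> (2 * j))) ((c \<circ> \<rho>) (\<pi> (Suc (2 * j)))))))"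
  proof (rule sum.cong[OF refl], safe)
    fix \<pi> assume "\<pi> permutes {..<2 * n}"
    then have "permutation \<pi>" using permutation_permutes by blast
    then show "of_int (sign (\<rho> \<circ> \<pi>)) * (\<Prod>j<n. H j (c ((\<rho> \<circ> \<pi>) (2 * j))) (c ((\<rho> \<circ> \<pi>) (Suc (2 * j))))) =
       of_int (sign \<rho>) * (of_int (sign \<pi>) *
         (\<Prod>j<n. H j ((c \<circ> \<rho>) (\<pi> (2 * j))) ((c \<circ> \<rho>) (\<pi> (Suc (2 * j))))) :: complex)"
      using P by (simp add: sign_compose)
  qed
  finally have "alternating_sum n H c = of_int (sign \<rho>) * alternating_sum n H (c \<circ> \<rho>)"
    by (simp add: alternating_sum_def sum_distrib_left)
  then show ?thesis
    by (metis mult.assoc mult_1 of_int_1 of_int_mult sign_idempotent)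
qed

lemma alternating_sum_cong:
  assumes "\<And>j a b. j < n \<Longrightarrow> a < 2 * n \<Longrightarrow> b < 2 * n \<Longrightarrow> H j (c a) (c b) = H' j (c' a) (c' b)"
  shows "alternating_sum n H c = alternating_sum n H' c'"
proof -
  have "\<pi> x < 2 * n" if "\<pi> permutes {..<2 * n}" "x < 2 * n" for \<pi> x
    using that permutes_in_image by fastforce
  then show ?thesis
    unfolding alternating_sum_def
    by (intro sum.cong refl arg_cong2[where f = "(*)"] prod.cong) (auto intro!: assms)
qed

lemma alternating_sum_eq_0:
  assumes "a < 2 * n" "b < 2 * n" "a \<noteq> b" "c a = c b"
  shows "alternating_sum n H c = 0"
proof -
  have "c \<circ> Transposition.transpose a b = c" using assms by (auto simp: fun_eq_iff Transposition.transpose_def)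
  moreover have "Transposition.transpose a b permutes {..<2 * n}"
    using assms by (intro permutes_swap_id) auto
  ultimately have "alternating_sum n H c = - alternating_sum n H c"
    using alternating_sum_comp[of "Transposition.transpose a b" n H c] assms by (simp add: sign_swap_id)
  then show ?thesis by simp
qed

lemma permutes_lessThan_Suc_iff:
  "\<pi> permutes {..<2 * n} \<longleftrightarrow>
     \<pi> permutes {..<2 * Suc n} \<and> \<pi> (2 * n) = 2 * n \<and> \<pi> (Suc (2 * n)) = Suc (2 * n)"
proof safe
  assume P: "\<pi> permutes {..<2 * n}"
  show "\<pi> permutes {..<2 * Suc n}" using P by (rule permutes_subset) auto
  show "\<pi> (2 * n) = 2 * n" "\<pi> (Suc (2 * n)) = Suc (2 * n)"
    using P by (auto simp: permutes_def)
next
  assume P: "\<pi> permutes {..<2 * Suc n}" and f: "\<pi> (2 * n) = 2 * n" "\<pi> (Suc (2 * n)) = Suc (2 * n)"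
  show "\<pi> permutes {..<2 * n}"
  proof (rule permutes_superset[OF P])
    fix x assume "x \<in> {..<2 * Suc n} - {..<2 * n}"
    then have "x = 2 * n \<or> x = Suc (2 * n)" by auto
    then show "\<pi> x = x" using f by auto
  qed
qed

text \<open>\<open>J\<close> is the Gram matrix of a skew-orthogonal family: block diagonal, with 2
  by 2 blocks that have \<open>h m\<close> and \<open>- h m\<close> off the diagonal. The vanishing
  of \<open>J a a\<close> is contained in \<open>J_skew\<close>.\<close>

locale skew_blocks =
  fixes J :: "nat \<Rightarrow> nat \<Rightarrow> complex" and h :: "nat \<Rightarrow> complex"
  assumes J_even_odd: "J (2 * m) (Suc (2 * m)) = h m"
    and J_skew: "J b a = - J a b"
    and J_eq_0: "a div 2 \<noteq> b div 2 \<Longrightarrow> J a b = 0"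
begin

text \<open>Integrating out one point: the factor \<open>J\<close> of the last pair survives only if
  the two letters placed there form one block \<open>i\<close>. Both orders of these letters
  contribute equally, as the sign of the transposition cancels against skewness, whence the factor
  2. Exchanging block \<open>i\<close> with the last one leaves a sum over \<open>2 * n\<close>
  letters.\<close>

lemma alternating_sum_Suc:
  assumes inj: "inj_on \<mu> {..n}" and Hn: "H n = J"
  shows "alternating_sum (Suc n) H (block_lift \<mu>) =
    (\<Sum>i\<le>n. 2 * h (\<mu> i) * alternating_sum n H (block_lift (\<mu> \<circ> Transposition.transpose i n)))"
proof -
  let ?c = "block_lift \<mu>" and ?P = "{\<pi>. \<pi> permutes {..<2 * Suc n}}"
  define f where "f \<pi> = of_int (sign \<pi>) * (\<Prod>j<Suc n. H j (?c (\<pi> (2 * j))) (?c (\<pi> (Suc (2 * j)))))" for \<pi>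
  \<comment> \<open>\<open>A i\<close> collects the permutations that put block \<open>i\<close>
    into the last pair in its natural order, \<open>A' i\<close> those that put it there
    reversed.\<close>
  define A where "A i = {\<pi> \<in> ?P. \<pi> (2 * n) = 2 * i \<and> \<pi> (Suc (2 * n)) = Suc (2 * i)}" for i
  define A' where "A' i = {\<pi> \<in> ?P. \<pi> (2 * n) = Suc (2 * i) \<and> \<pi> (Suc (2 * n)) = 2 * i}" for i
  have finP: "finite ?P" by (simp add: finite_permutations)
  let ?t = "Transposition.transpose (2 * n) (Suc (2 * n))"
  have tP: "?t permutes {..<2 * Suc n}" by (intro permutes_swap_id) auto
  have swap: "sum f (A' i) = sum f (A i)" for i
  proof (rule sum.reindex_bij_witness[where i = "\<lambda>\<pi>. \<pi> \<circ> ?t" and j = "\<lambda>\<pi>. \<pi> \<circ> ?t"])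
    fix \<pi> assume \<pi>: "\<pi> \<in> A' i"
    show "\<pi> \<circ> ?t \<circ> ?t = \<pi>" by (simp add: comp_assoc)
    show "\<pi> \<circ> ?t \<in> A i"
      using \<pi> permutes_compose[OF tP] by (auto simp: A_def A'_def)
    have "sign (\<pi> \<circ> ?t) = - sign \<pi>"
      using \<pi> permutation_permutes[of \<pi>]
      by (subst sign_compose) (auto simp: A'_def sign_swap_id permutation_swap_id)
    moreover have "(\<Prod>j<n. H j (?c ((\<pi> \<circ> ?t) (2 * j))) (?c ((\<pi> \<circ> ?t) (Suc (2 * j))))) =
        (\<Prod>j<n. H j (?c (\<pi> (2 * j))) (?c (\<pi> (Suc (2 * j)))))"
      by (intro prod.cong refl) (auto simp: Transposition.transpose_def)
    ultimately show "f (\<pi> \<circ> ?t) = f \<pi>"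
      using J_skew[of "?c (\<pi> (2 * n))" "?c (\<pi> (Suc (2 * n)))"]
      by (simp add: f_def Hn)
  next
    fix \<pi> assume \<pi>: "\<pi> \<in> A i"
    show "\<pi> \<circ> ?t \<circ> ?t = \<pi>" by (simp add: comp_assoc)
    show "\<pi> \<circ> ?t \<in> A' i"
      using \<pi> permutes_compose[OF tP] by (auto simp: A_def A'_def)
  qed
  have main: "sum f (A i) = h (\<mu> i) * alternating_sum n H (block_lift (\<mu> \<circ> Transposition.transpose i n))"
    if "i \<le> n" for i
  proof -
    let ?s = "block_lift (Transposition.transpose i n)"
    have sP: "?s permutes {..<2 * Suc n}"
      using block_lift_permutes_sign[OF permutes_swap_id, of i "Suc n" n] that by simp
    have ss: "?s \<circ> ?s = id"
      by (simp add: block_lift_comp[symmetric] block_lift_id)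
    have sn: "?s (2 * n) = 2 * i" "?s (Suc (2 * n)) = Suc (2 * i)" 
       "?s (2 * i) = 2 * n" "?s (Suc (2 * i)) = Suc (2 * n)" by simp_all
    have sgn: "sign (?s \<circ> \<pi>) = sign \<pi>" if "\<pi> permutes {..<2 * Suc n}" for \<pi>
      using that permutation_permutes[of \<pi>]
      by (subst sign_compose) (auto simp: permutation_block_lift_transpose sign_block_lift_transpose)
    \<comment> \<open>Composing on the left with the block exchange maps \<open>A i\<close>
      bijectively onto the permutations that fix the last two letters, and it preserves the
      sign.\<close>
    have "sum f (A i) = (\<Sum>\<pi> | \<pi> permutes {..<2 * n}. h (\<mu> i) *
        (of_int (sign \<pi>) * (\<Prod>j<n. H j (block_lift (\<mu> \<circ> Transposition.transpose i n) (\<pi> (2 * j)))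
           (block_lift (\<mu> \<circ> Transposition.transpose i n) (\<pi> (Suc (2 * j)))))))"
    proof (rule sum.reindex_bij_witness[where i = "\<lambda>\<pi>. ?s \<circ> \<pi>" and j = "\<lambda>\<pi>. ?s \<circ> \<pi>"])
      fix \<pi> assume \<pi>: "\<pi> \<in> A i"
      show e: "?s \<circ> (?s \<circ> \<pi>) = \<pi>" by (simp add: comp_assoc[symmetric] ss)
      show "?s \<circ> \<pi> \<in> {\<pi>. \<pi> permutes {..<2 * n}}"
        using \<pi> permutes_compose[OF _ sP, of \<pi>] unfolding permutes_lessThan_Suc_iff[of _ n] 
        by (simp add: A_def sn)
      have e': "?s (?s x) = x" for x using ss by (metis comp_apply id_apply)
      show "h (\<mu> i) * (of_int (sign (?s \<circ> \<pi>)) * (\<Prod>j<n. H j (block_lift (\<mu> \<circ> Transposition.transpose i n) ((?s \<circ> \<pi>) (2 * j)))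
           (block_lift (\<mu> \<circ> Transposition.transpose i n) ((?s \<circ> \<pi>) (Suc (2 * j)))))) = f \<pi>"
        using \<pi> by (simp add: A_def f_def sgn Hn block_lift_comp J_even_odd e')
    next
      fix \<pi> assume \<pi>: "\<pi> \<in> {\<pi>. \<pi> permutes {..<2 * n}}"
      show "?s \<circ> (?s \<circ> \<pi>) = \<pi>" by (simp add: comp_assoc[symmetric] ss)
      show "?s \<circ> \<pi> \<in> A i"
        using \<pi> permutes_compose[OF _ sP, of \<pi>] unfolding permutes_lessThan_Suc_iff[of _ n] 
        by (simp add: A_def sn)
    qed
    then show ?thesis by (simp add: alternating_sum_def sum_distrib_left)
  qed
  have zero: "f \<pi> = 0" if \<pi>: "\<pi> \<in> ?P - (\<Union>i\<le>n. A i \<union> A' i)" for \<pi>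
  proof -
    have pi: "\<pi> permutes {..<2 * Suc n}" using \<pi> by simp
    have lt: "\<pi> (2 * n) < 2 * Suc n" "\<pi> (Suc (2 * n)) < 2 * Suc n"
      using permutes_in_image[OF pi] by auto
    have ne: "\<pi> (2 * n) \<noteq> \<pi> (Suc (2 * n))"
      using permutes_inj[OF pi] by (metis inj_eq n_not_Suc_n)
    have "\<pi> (2 * n) div 2 \<noteq> \<pi> (Suc (2 * n)) div 2"
    proof
      assume eq: "\<pi> (2 * n) div 2 = \<pi> (Suc (2 * n)) div 2"
      define i where "i = \<pi> (2 * n) div 2"
      have i: "i \<le> n" using lt by (auto simp: i_def)
      have "(\<pi> (2 * n) = 2 * i \<and> \<pi> (Suc (2 * n)) = Suc (2 * i)) \<or>
            (\<pi> (2 * n) = Suc (2 * i) \<and> \<pi> (Suc (2 * n)) = 2 * i)"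
        using ne eq unfolding i_def by presburger
      then have "\<pi> \<in> A i \<union> A' i" using pi by (auto simp: A_def A'_def)
      with \<pi> i show False by blast
    qed
    moreover have "\<pi> (2 * n) div 2 \<in> {..n}" "\<pi> (Suc (2 * n)) div 2 \<in> {..n}" using lt by auto
    ultimately have "?c (\<pi> (2 * n)) div 2 \<noteq> ?c (\<pi> (Suc (2 * n))) div 2"
      using inj by (auto simp: block_lift_def inj_on_def)
    then show ?thesis by (simp add: f_def Hn J_eq_0)
  qed
  have "alternating_sum (Suc n) H (block_lift \<mu>) = sum f ?P"
    by (simp add: alternating_sum_def f_def)
  also have "\<dots> = sum f (\<Union>i\<le>n. A i \<union> A' i)"
    by (rule sum.mono_neutral_right) (use finP zero in \<open>auto simp: A_def A'_def\<close>)
  also have "\<dots> = (\<Sum>i\<le>n. sum f (A i \<union> A' i))"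
  proof (rule sum.UNION_disjoint)
    have "i = j" if "\<pi> \<in> A i \<union> A' i" "\<pi> \<in> A j \<union> A' j" for i j \<pi>
    proof -
      have "\<pi> (2 * n) div 2 = i" "\<pi> (2 * n) div 2 = j" using that by (auto simp: A_def A'_def)
      then show ?thesis by simp
    qed
    then show "\<forall>i\<in>{..n}. \<forall>j\<in>{..n}. i \<noteq> j \<longrightarrow> (A i \<union> A' i) \<inter> (A j \<union> A' j) = {}" by blast
  qed (use finP in \<open>auto simp: A_def A'_def\<close>)
  also have "\<dots> = (\<Sum>i\<le>n. sum f (A i) + sum f (A' i))"
    by (intro sum.cong refl sum.union_disjoint) (use finP in \<open>auto simp: A_def A'_def\<close>)
  also have "\<dots> = (\<Sum>i\<le>n. 2 * h (\<mu> i) * alternating_sum n H (block_lift (\<mu> \<circ> Transposition.transpose i n)))"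
    by (intro sum.cong refl) (simp add: swap main)
  finally show ?thesis .
qed

text \<open>Only the values of \<open>\<mu>\<close> below \<open>n\<close> enter a summand, so for
  \<open>n \<le> N\<close> every injective choice of \<open>n\<close> blocks is counted
  \<open>(N - n)!\<close> times. Summing over full permutations makes the exchange of
  \<open>i\<close> and \<open>n\<close> a bijection of the index set, and the weights
  \<open>1 / (2 * h)\<close> cancel the factor produced by
  \<open>alternating_sum_Suc\<close>.\<close>

definition averaged_sum :: "nat \<Rightarrow> (nat \<Rightarrow> nat \<Rightarrow> nat \<Rightarrow> complex) \<Rightarrow> nat \<Rightarrow> complex" where
  "averaged_sum N H n = (\<Sum>\<mu> | \<mu> permutes {..<N}.
     (\<Prod>j<n. 1 / (2 * h (\<mu> j))) * alternating_sum n H (block_lift \<mu>))"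

lemma averaged_sum_Suc:
  assumes n: "n < N" and Hn: "H n = J" and nz: "\<And>m. m < N \<Longrightarrow> h m \<noteq> 0"
  shows "averaged_sum N H (Suc n) = of_nat (Suc n) * averaged_sum N H n"
proof -
  define F where "F \<mu> = (\<Prod>j<n. 1 / (2 * h (\<mu> j))) * alternating_sum n H (block_lift \<mu>)" for \<mu>
  have "averaged_sum N H (Suc n) = (\<Sum>\<mu> | \<mu> permutes {..<N}. \<Sum>i\<le>n. F (\<mu> \<circ> Transposition.transpose i n))"
    unfolding averaged_sum_def
  proof (rule sum.cong[OF refl], safe)
    fix \<mu> assume \<mu>: "\<mu> permutes {..<N}"
    then have inj: "inj_on \<mu> {..n}" by (meson inj_on_subset permutes_inj_on)
    have "(\<Prod>j<Suc n. 1 / (2 * h (\<mu> j))) * (2 * h (\<mu> i) * alternating_sum n H (block_lift (\<mu> \<circ> Transposition.transpose i n)))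
       = F (\<mu> \<circ> Transposition.transpose i n)" if i: "i \<le> n" for i
    proof -
      let ?t = "Transposition.transpose i n"
      \<comment> \<open>Reordering the product by the exchange puts the factor with
        \<open>\<mu> i\<close> last, where it meets \<open>2 * h (\<mu> i)\<close>.\<close>
      have "(\<Prod>j<Suc n. 1 / (2 * h (\<mu> j))) = (\<Prod>j<Suc n. 1 / (2 * h (\<mu> (?t j))))"
        by (rule prod.permute[unfolded comp_def]) (use i in \<open>auto intro!: permutes_swap_id\<close>)
      also have "\<dots> = (\<Prod>j<n. 1 / (2 * h (\<mu> (?t j)))) * (1 / (2 * h (\<mu> i)))" by simp
      moreover have "\<mu> i < N" using permutes_in_image[OF \<mu>, of i] i n by simp
      ultimately show ?thesis using nz[of "\<mu> i"] by (simp add: F_def)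
    qed
    then show "(\<Prod>j<Suc n. 1 / (2 * h (\<mu> j))) * alternating_sum (Suc n) H (block_lift \<mu>) =
       (\<Sum>i\<le>n. F (\<mu> \<circ> Transposition.transpose i n))"
      unfolding alternating_sum_Suc[OF inj, of H, OF Hn] sum_distrib_left by (intro sum.cong) auto
  qed
  also have "\<dots> = (\<Sum>i\<le>n. \<Sum>\<mu> | \<mu> permutes {..<N}. F (\<mu> \<circ> Transposition.transpose i n))"
    by (rule sum.swap)
  also have "\<dots> = (\<Sum>i\<le>n. \<Sum>\<mu> | \<mu> permutes {..<N}. F \<mu>)"
    by (intro sum.cong refl sum_permutations_compose_right[symmetric] permutes_swap_id) (use n in auto)
  finally show ?thesis by (simp add: averaged_sum_def F_def)
qed

lemma averaged_sum_integrated_out: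
  assumes "n \<le> N" and "\<And>j. n \<le> j \<Longrightarrow> j < N \<Longrightarrow> H j = J" and nz: "\<And>m. m < N \<Longrightarrow> h m \<noteq> 0"
  shows "fact n * averaged_sum N H N = fact N * averaged_sum N H n"
  using assms(1,2)
proof (induction n rule: inc_induct)
  case base
  then show ?case by simp
next
  case (step n)
  have "averaged_sum N H (Suc n) = of_nat (Suc n) * averaged_sum N H n"
    by (rule averaged_sum_Suc) (use step nz in auto)
  moreover have "fact (Suc n) * averaged_sum N H N = fact N * averaged_sum N H (Suc n)"
    using step by auto
  ultimately have "of_nat (Suc n) * (fact n * averaged_sum N H N) = of_nat (Suc n) * (fact N * averaged_sum N H n)"
    by (simp add: algebra_simps)
  then show ?case by (simp del: of_nat_Suc)
qed

text \<open>When all blocks are used, the \<open>N!\<close> summands agree: the product of the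
  weights is symmetric and block permutations are even.\<close>

lemma averaged_sum_full:
  "averaged_sum N H N = fact N * (\<Prod>j<N. 1 / (2 * h j)) * alternating_sum N H id"
proof -
  have "(\<Prod>j<N. 1 / (2 * h (\<mu> j))) * alternating_sum N H (block_lift \<mu>) =
      (\<Prod>j<N. 1 / (2 * h j)) * alternating_sum N H id" if \<mu>: "\<mu> permutes {..<N}" for \<mu>
    using prod.permute[OF \<mu>, of "\<lambda>j. 1 / (2 * h j)"] block_lift_permutes_sign[OF \<mu>]
      alternating_sum_comp[of "block_lift \<mu>" N H id] by (simp add: comp_def)
  then show ?thesis
    unfolding averaged_sum_def by (simp add: card_permutations[OF refl])
qed

lemma alternating_sum_eq_averaged:
  assumes "n \<le> N" and "\<And>j. n \<le> j \<Longrightarrow> j < N \<Longrightarrow> H j = J" and nz: "\<And>m. m < N \<Longrightarrow> h m \<noteq> 0"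
  shows "alternating_sum N H id = (\<Prod>j<N. 2 * h j) * averaged_sum N H n / fact n"
proof -
  have "(\<Prod>j<N. 1 / (2 * h j)) = 1 / (\<Prod>j<N. 2 * h j)" by (simp add: prod_dividef)
  moreover have "(\<Prod>j<N. 2 * h j) \<noteq> 0" using nz by simp
  ultimately show ?thesis
    using averaged_sum_integrated_out[OF assms(1), of H, OF assms(2) nz] averaged_sum_full[of N H]
    by (simp add: field_simps)
qed

end

section \<open>Counting injections and antisymmetrising factors\<close>

text \<open>The fibre of the restriction map over an injection is a coset of the group of
  permutations of \<open>{k..<N}\<close>, which has \<open>(N - k)!\<close> elements.\<close>

lemma sum_permutations_restrict:
  fixes f :: "(nat \<Rightarrow> nat) \<Rightarrow> complex"
  assumes k: "k \<le> N"
  shows "(\<Sum>\<mu> | \<mu> permutes {..<N}. f (restrict \<mu> {..<k})) =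
    fact (N - k) * (\<Sum>m \<in> {m \<in> {..<k} \<rightarrow>\<^sub>E {..<N}. inj_on m {..<k}}. f m)"
proof -
  let ?I = "{m \<in> {..<k} \<rightarrow>\<^sub>E {..<N}. inj_on m {..<k}}" and ?P = "{\<mu>. \<mu> permutes {..<N}}"
  have sub: "(\<lambda>\<mu>. restrict \<mu> {..<k}) ` ?P \<subseteq> ?I"
  proof (rule image_subsetI)
    fix \<mu> assume "\<mu> \<in> ?P"
    then have \<mu>: "\<mu> permutes {..<N}" by simp
    have "restrict \<mu> {..<k} \<in> {..<k} \<rightarrow>\<^sub>E {..<N}"
      using permutes_in_image[OF \<mu>] k by (auto simp: PiE_def)
    moreover have "inj_on (restrict \<mu> {..<k}) {..<k}"
      using permutes_inj_on[OF \<mu>] by (metis inj_on_restrict_eq)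
    ultimately show "restrict \<mu> {..<k} \<in> ?I" by simp
  qed
  have card: "card {\<mu> \<in> ?P. restrict \<mu> {..<k} = m} = fact (N - k)" if m: "m \<in> ?I" for m
  proof -
    have img: "m ` {..<k} \<subseteq> {..<N}" and inj: "inj_on m {..<k}" using m by auto
    have "card ({..<N} - {..<k}) = card ({..<N} - m ` {..<k})"
      using img inj k by (simp add: card_Diff_subset card_image)
    then obtain g where g: "bij_betw g ({..<N} - {..<k}) ({..<N} - m ` {..<k})"
      using finite_same_card_bij by (metis finite_Diff finite_lessThan)
    \<comment> \<open>One extension of \<open>m\<close> to a permutation, the remaining points being
      matched by \<open>g\<close>; composing it with the permutations of \<open>{k..<N}\<close>
      yields all the others.\<close>
    define \<mu>0 where "\<mu>0 x = (if x < k then m x else if x < N then g x else x)" for x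
    have "bij_betw \<mu>0 {..<k} (m ` {..<k})"
      using inj by (auto simp: bij_betw_def \<mu>0_def inj_on_def)
    moreover have "bij_betw \<mu>0 ({..<N} - {..<k}) ({..<N} - m ` {..<k})"
      using g by (rule bij_betw_cong[THEN iffD1, rotated]) (auto simp: \<mu>0_def)
    ultimately have "bij_betw \<mu>0 ({..<k} \<union> ({..<N} - {..<k})) (m ` {..<k} \<union> ({..<N} - m ` {..<k}))"
      by (rule bij_betw_combine) auto
    moreover have "{..<k} \<union> ({..<N} - {..<k}) = {..<N}" "m ` {..<k} \<union> ({..<N} - m ` {..<k}) = {..<N}"
      using k img by auto
    ultimately have "bij_betw \<mu>0 {..<N} {..<N}" by simp
    then have \<mu>0: "\<mu>0 permutes {..<N}"
      by (rule bij_imp_permutes) (use k in \<open>auto simp: \<mu>0_def\<close>)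
    have r0: "\<mu>0 x = m x" if "x < k" for x using that by (simp add: \<mu>0_def)
    have "bij_betw (\<lambda>\<nu>. \<mu>0 \<circ> \<nu>) {\<nu>. \<nu> permutes {k..<N}} {\<mu> \<in> ?P. restrict \<mu> {..<k} = m}"
    proof (rule bij_betw_byWitness[where f' = "\<lambda>\<mu>. inv_into UNIV \<mu>0 \<circ> \<mu>"])
      show "\<forall>\<nu>\<in>{\<nu>. \<nu> permutes {k..<N}}. inv_into UNIV \<mu>0 \<circ> (\<mu>0 \<circ> \<nu>) = \<nu>"
        using permutes_inv_o[OF \<mu>0] by (simp add: comp_assoc[symmetric])
      show "\<forall>\<mu>\<in>{\<mu> \<in> ?P. restrict \<mu> {..<k} = m}. \<mu>0 \<circ> (inv_into UNIV \<mu>0 \<circ> \<mu>) = \<mu>"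
        using permutes_inv_o[OF \<mu>0] by (simp add: comp_assoc[symmetric])
      show "(\<lambda>\<nu>. \<mu>0 \<circ> \<nu>) ` {\<nu>. \<nu> permutes {k..<N}} \<subseteq> {\<mu> \<in> ?P. restrict \<mu> {..<k} = m}"
      proof safe
        fix \<nu> assume \<nu>: "\<nu> permutes {k..<N}"
        then have "\<nu> permutes {..<N}" by (rule permutes_subset) auto
        then show "\<mu>0 \<circ> \<nu> permutes {..<N}" using \<mu>0 permutes_compose by blast
        show "restrict (\<mu>0 \<circ> \<nu>) {..<k} = m"
        proof
          fix x show "restrict (\<mu>0 \<circ> \<nu>) {..<k} x = m x"
            using m r0[of x] permutes_not_in[OF \<nu>, of x] PiE_arb[of m "{..<k}" "\<lambda>_. {..<N}" x]
            by (cases "x < k") simp_all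
        qed
      qed
      show "(\<lambda>\<mu>. inv_into UNIV \<mu>0 \<circ> \<mu>) ` {\<mu> \<in> ?P. restrict \<mu> {..<k} = m} \<subseteq> {\<nu>. \<nu> permutes {k..<N}}"
      proof safe
        fix \<mu> assume \<mu>: "\<mu> permutes {..<N}" and m': "m = restrict \<mu> {..<k}"
        have P: "inv_into UNIV \<mu>0 \<circ> \<mu> permutes {..<N}"
          using \<mu> permutes_inv[OF \<mu>0] permutes_compose by blast
        show "inv_into UNIV \<mu>0 \<circ> \<mu> permutes {k..<N}"
        proof (rule permutes_superset[OF P])
          fix x assume "x \<in> {..<N} - {k..<N}"
          then have "x < k" by auto
          then have "\<mu> x = \<mu>0 x" using r0[of x] m' by simp
          then show "(inv_into UNIV \<mu>0 \<circ> \<mu>) x = x" using permutes_inverses(2)[OF \<mu>0] by simp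
        qed
      qed
    qed
    then show ?thesis
      using bij_betw_same_card card_permutations[of "{k..<N}" "N - k"] by fastforce
  qed
  have fin: "finite ?I"
    by (rule finite_subset[of _ "{..<k} \<rightarrow>\<^sub>E {..<N}"]) (blast, intro finite_PiE finite_lessThan)
  have finP: "finite ?P" by (rule finite_permutations) simp
  have "(\<Sum>\<mu>\<in>?P. f (restrict \<mu> {..<k})) =
      (\<Sum>m\<in>?I. \<Sum>\<mu> | \<mu> \<in> ?P \<and> restrict \<mu> {..<k} = m. f (restrict \<mu> {..<k}))"
    by (rule sum.group[symmetric, OF finP fin sub])
  also have "\<dots> = (\<Sum>m\<in>?I. fact (N - k) * f m)"
  proof (rule sum.cong[OF refl])
    fix m assume m: "m \<in> ?I"
    have "(\<Sum>\<mu> | \<mu> \<in> ?P \<and> restrict \<mu> {..<k} = m. f (restrict \<mu> {..<k})) = 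
        (\<Sum>\<mu> | \<mu> \<in> ?P \<and> restrict \<mu> {..<k} = m. f m)" by (intro sum.cong) auto
    then show "(\<Sum>\<mu> | \<mu> \<in> ?P \<and> restrict \<mu> {..<k} = m. f (restrict \<mu> {..<k})) = fact (N - k) * f m"
      using card[OF m] by simp
  qed
  finally show ?thesis by (simp add: sum_distrib_left)
qed

text \<open>Reversing the two letters of a pair flips the sign, so the subtracted term contributes
  as much as the direct one. The resulting power of 2 cancels the one in the normalisation of the
  Pfaffian.\<close>

lemma sum_sign_antisymmetrize:
  fixes A :: "nat \<Rightarrow> nat \<Rightarrow> complex"
  shows "(\<Sum>\<pi> | \<pi> permutes {..<2 * k}. of_int (sign \<pi>) *
      (\<Prod>j<k. A (\<pi> (2 * j)) (\<pi> (Suc (2 * j))) - A (\<pi> (Suc (2 * j))) (\<pi> (2 * j)))) =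
    2 ^ k * (\<Sum>\<pi> | \<pi> permutes {..<2 * k}. of_int (sign \<pi>) * (\<Prod>j<k. A (\<pi> (2 * j)) (\<pi> (Suc (2 * j)))))"
proof -
  define D where "D a b = A a b - A b a" for a b
  \<comment> \<open>In \<open>T i\<close> the first \<open>i\<close> pairs already carry
    \<open>A\<close>, the others still its antisymmetrisation; each replacement gains a factor
    2.\<close>
  define T where "T i = alternating_sum k (\<lambda>j. if j < i then A else D) id" for i
  have "T i = 2 * T (Suc i)" if i: "i < k" for i
  proof -
    define A' where "A' a b = A b a" for a b
    define H where "H B j = (if j < i then A else if j = i then B else D)" for B j
    let ?t = "Transposition.transpose (2 * i) (Suc (2 * i))"
    have t: "?t permutes {..<2 * k}" using i by (intro permutes_swap_id) auto
    let ?c = "\<lambda>B \<pi>. of_int (sign \<pi>) * (\<Prod>j<k. H B j (\<pi> (2 * j)) (\<pi> (Suc (2 * j)))) :: complex"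
    have split: "(\<Prod>j<k. H B j (\<pi> (2 * j)) (\<pi> (Suc (2 * j)))) =
        B (\<pi> (2 * i)) (\<pi> (Suc (2 * i))) * (\<Prod>j\<in>{..<k} - {i}. H D j (\<pi> (2 * j)) (\<pi> (Suc (2 * j))))" for B \<pi>
      using i by (subst prod.remove[of _ i]) (auto simp: H_def intro!: prod.cong arg_cong2[where f = "(*)"] split: if_splits)
    have "alternating_sum k (H A') id = - alternating_sum k (H A) id"
    proof -
      have "alternating_sum k (H A) id = (\<Sum>\<pi> | \<pi> permutes {..<2 * k}. ?c A (\<pi> \<circ> ?t))"
        unfolding alternating_sum_def id_apply by (rule sum_permutations_compose_right[OF t])
      also have "\<dots> = (\<Sum>\<pi> | \<pi> permutes {..<2 * k}. - ?c A' \<pi>)"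
      proof (rule sum.cong[OF refl], safe)
        fix \<pi> assume \<pi>: "\<pi> permutes {..<2 * k}"
        have "sign (\<pi> \<circ> ?t) = - sign \<pi>"
          using \<pi> permutation_permutes[of \<pi>]
          by (subst sign_compose) (auto simp: sign_swap_id permutation_swap_id)
        moreover have "(\<Prod>j\<in>{..<k} - {i}. H D j ((\<pi> \<circ> ?t) (2 * j)) ((\<pi> \<circ> ?t) (Suc (2 * j)))) =
           (\<Prod>j\<in>{..<k} - {i}. H D j (\<pi> (2 * j)) (\<pi> (Suc (2 * j))))"
          by (intro prod.cong refl) (auto simp: Transposition.transpose_def)
        ultimately show "?c A (\<pi> \<circ> ?t) = - ?c A' \<pi>"
          unfolding split by (simp add: A'_def)
      qed
      finally show ?thesis by (simp add: sum_negf alternating_sum_def)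
    qed
    moreover have "alternating_sum k (H D) id = alternating_sum k (H A) id - alternating_sum k (H A') id"
      unfolding alternating_sum_def id_apply split sum_subtractf[symmetric]
      by (intro sum.cong refl) (simp add: D_def A'_def algebra_simps)
    moreover have "H D = (\<lambda>j. if j < i then A else D)" "H A = (\<lambda>j. if j < Suc i then A else D)"
      by (auto simp: H_def fun_eq_iff)
    ultimately show ?thesis by (simp add: T_def)
  qed
  then have "T 0 = 2 ^ i * T i" if "i \<le> k" for i
    using that by (induction i) auto
  from this[of k] have "T 0 = 2 ^ k * T k" by simp
  moreover have "T k = alternating_sum k (\<lambda>_. A) id"
    unfolding T_def by (rule alternating_sum_cong) simp
  ultimately show ?thesis by (simp add: T_def alternating_sum_def D_def)
qed


subsection \<open>Moments of the weight on the disk\<close>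

lemma measurable_Complex [measurable]: "(\<lambda>(x, y). Complex x y) \<in> borel \<rightarrow>\<^sub>M borel"
  by (intro borel_measurable_continuous_onI) (auto intro!: continuous_intros simp: split_beta Complex_eq)

lemma lborel_complex_eq_distr: "(lborel :: complex measure) = distr lborel borel (\<lambda>(x, y). Complex x y)"
proof (rule lborel_eqI)
  fix l u :: complex assume lu: "\<And>b. b \<in> Basis \<Longrightarrow> l \<bullet> b \<le> u \<bullet> b"
  have "(\<lambda>(x, y). Complex x y) -` box l u = box (Re l) (Re u) \<times> box (Im l) (Im u)"
    by (auto simp: box_def Basis_complex_def)
  then have "emeasure (distr lborel borel (\<lambda>(x, y). Complex x y)) (box l u) =
      emeasure (lborel \<Otimes>\<^sub>M lborel) (box (Re l) (Re u) \<times> box (Im l) (Im u))"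
    by (simp add: emeasure_distr lborel_prod)
  also have "\<dots> = ennreal ((Re u - Re l) * (Im u - Im l))"
    using lu[of 1] lu[of \<i>]
    by (subst lborel.emeasure_pair_measure_Times) (auto simp: ennreal_mult)
  also have "(Re u - Re l) * (Im u - Im l) = (\<Prod>b\<in>Basis. (u - l) \<bullet> b)"
    by (simp add: Basis_complex_def)
  finally show "emeasure (distr lborel borel (\<lambda>(x, y). Complex x y)) (box l u) = ennreal (\<Prod>b\<in>Basis. (u - l) \<bullet> b)" .
qed simp

lemma nn_integral_complex_eq:
  assumes [measurable]: "f \<in> borel_measurable borel"
  shows "(\<integral>\<^sup>+z. f z \<partial>lborel) = (\<integral>\<^sup>+x. \<integral>\<^sup>+y. f (Complex x y) \<partial>lborel \<partial>lborel)"
    and "(\<integral>\<^sup>+z. f z \<partial>lborel) = (\<integral>\<^sup>+y. \<integral>\<^sup>+x. f (Complex x y) \<partial>lborel \<partial>lborel)"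
proof -
  have [measurable]: "(\<lambda>(x, y). Complex x y) \<in> lborel \<Otimes>\<^sub>M lborel \<rightarrow>\<^sub>M borel"
    by (simp add: lborel_prod)
  have [measurable]: "(\<lambda>p. Complex (fst p) (snd p)) \<in> borel \<rightarrow>\<^sub>M borel"
    using measurable_Complex by (simp add: case_prod_unfold)
  have *: "(\<integral>\<^sup>+z. f z \<partial>lborel) = (\<integral>\<^sup>+(x, y). f (Complex x y) \<partial>(lborel \<Otimes>\<^sub>M lborel))"
    by (subst lborel_complex_eq_distr, subst nn_integral_distr) (simp_all add: lborel_prod case_prod_unfold)
  show "(\<integral>\<^sup>+z. f z \<partial>lborel) = (\<integral>\<^sup>+x. \<integral>\<^sup>+y. f (Complex x y) \<partial>lborel \<partial>lborel)"
    unfolding * by (subst lborel.nn_integral_fst[symmetric]) (simp_all add: case_prod_unfold)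
  show "(\<integral>\<^sup>+z. f z \<partial>lborel) = (\<integral>\<^sup>+y. \<integral>\<^sup>+x. f (Complex x y) \<partial>lborel \<partial>lborel)"
    unfolding * by (subst lborel_pair.nn_integral_snd[symmetric]) (simp_all add: case_prod_unfold)
qed

lemma distr_lborel_eqI:
  fixes T :: "complex \<Rightarrow> complex"
  assumes [measurable]: "T \<in> borel \<rightarrow>\<^sub>M borel"
    and *: "\<And>f :: complex \<Rightarrow> ennreal. f \<in> borel_measurable borel \<Longrightarrow> (\<integral>\<^sup>+z. f (T z) \<partial>lborel) = (\<integral>\<^sup>+z. f z \<partial>lborel)"
  shows "distr lborel borel T = lborel"
proof (rule measure_eqI)
  fix A assume "A \<in> sets (distr lborel borel T)"
  then have [measurable]: "A \<in> sets borel" by simp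
  have "emeasure (distr lborel borel T) A = (\<integral>\<^sup>+z. indicator A z \<partial>distr lborel borel T)" by simp
  also have "\<dots> = (\<integral>\<^sup>+z. indicator A (T z) \<partial>lborel)" by (rule nn_integral_distr) simp_all
  also have "\<dots> = (\<integral>\<^sup>+z. indicator A z \<partial>lborel)" by (rule *) simp
  finally show "emeasure (distr lborel borel T) A = emeasure lborel A" by simp
qed simp

text \<open>With the imaginary part held fixed the shear is a translation of the real line, so
  invariance follows by integrating over the real part first. The other shear uses the other order
  of integration.\<close>

lemma distr_lborel_shear_Re: "distr lborel borel (\<lambda>z. Complex (Re z + s * Im z) (Im z)) = lborel"
proof (rule distr_lborel_eqI)
  show [measurable]: "(\<lambda>z. Complex (Re z + s * Im z) (Im z)) \<in> borel \<rightarrow>\<^sub>M borel"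
    unfolding Complex_eq by measurable
  fix f :: "complex \<Rightarrow> ennreal" assume f[measurable]: "f \<in> borel_measurable borel"
  have [measurable]: "(\<lambda>x. Complex x y) \<in> borel \<rightarrow>\<^sub>M borel" for y
    unfolding Complex_eq by measurable
  have "(\<integral>\<^sup>+z. f (Complex (Re z + s * Im z) (Im z)) \<partial>lborel) =
      (\<integral>\<^sup>+y. \<integral>\<^sup>+x. f (Complex (s * y + 1 * x) y) \<partial>lborel \<partial>lborel)"
    by (subst nn_integral_complex_eq(2)) (simp_all add: add.commute)
  also have "\<dots> = (\<integral>\<^sup>+y. \<integral>\<^sup>+x. f (Complex x y) \<partial>lborel \<partial>lborel)"
  proof (rule nn_integral_cong)
    fix y :: real
    show "(\<integral>\<^sup>+x. f (Complex (s * y + 1 * x) y) \<partial>lborel) = (\<integral>\<^sup>+x. f (Complex x y) \<partial>lborel)"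
      using nn_integral_real_affine[of "\<lambda>x. f (Complex x y)" 1 "s * y"] by simp
  qed
  finally show "(\<integral>\<^sup>+z. f (Complex (Re z + s * Im z) (Im z)) \<partial>lborel) = (\<integral>\<^sup>+z. f z \<partial>lborel)"
    by (simp add: nn_integral_complex_eq(2)[of f])
qed

lemma distr_lborel_shear_Im: "distr lborel borel (\<lambda>z. Complex (Re z) (Im z + s * Re z)) = lborel"
proof (rule distr_lborel_eqI)
  show [measurable]: "(\<lambda>z. Complex (Re z) (Im z + s * Re z)) \<in> borel \<rightarrow>\<^sub>M borel"
    unfolding Complex_eq by measurable
  fix f :: "complex \<Rightarrow> ennreal" assume f[measurable]: "f \<in> borel_measurable borel"
  have [measurable]: "(\<lambda>y. Complex x y) \<in> borel \<rightarrow>\<^sub>M borel" for x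
    unfolding Complex_eq by measurable
  have "(\<integral>\<^sup>+z. f (Complex (Re z) (Im z + s * Re z)) \<partial>lborel) =
      (\<integral>\<^sup>+x. \<integral>\<^sup>+y. f (Complex x (s * x + 1 * y)) \<partial>lborel \<partial>lborel)"
    by (subst nn_integral_complex_eq(1)) (simp_all add: add.commute)
  also have "\<dots> = (\<integral>\<^sup>+x. \<integral>\<^sup>+y. f (Complex x y) \<partial>lborel \<partial>lborel)"
  proof (rule nn_integral_cong)
    fix x :: real
    show "(\<integral>\<^sup>+y. f (Complex x (s * x + 1 * y)) \<partial>lborel) = (\<integral>\<^sup>+y. f (Complex x y) \<partial>lborel)"
      using nn_integral_real_affine[of "\<lambda>y. f (Complex x y)" 1 "s * x"] by simp
  qed
  finally show "(\<integral>\<^sup>+z. f (Complex (Re z) (Im z + s * Re z)) \<partial>lborel) = (\<integral>\<^sup>+z. f z \<partial>lborel)"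
    by (simp add: nn_integral_complex_eq(1)[of f])
qed

text \<open>A rotation by an angle other than \<open>\<pi>\<close> is a product of three shears.\<close>

lemma distr_lborel_rotation:
  assumes "cos (\<theta> / 2) \<noteq> 0"
  shows "distr lborel borel (\<lambda>z. cis \<theta> * z) = lborel"
proof -
  define t where "t = tan (\<theta> / 2)"
  define R where "R z = Complex (Re z + (- t) * Im z) (Im z)" for z
  define S where "S z = Complex (Re z) (Im z + sin \<theta> * Re z)" for z
  have [measurable]: "R \<in> borel \<rightarrow>\<^sub>M borel" "S \<in> borel \<rightarrow>\<^sub>M borel"
    unfolding R_def S_def Complex_eq by measurable
  have dR: "distr lborel borel R = lborel" and dS: "distr lborel borel S = lborel"
    unfolding R_def S_def by (rule distr_lborel_shear_Re distr_lborel_shear_Im)+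
  have s: "sin \<theta> = 2 * sin (\<theta> / 2) * cos (\<theta> / 2)" and c: "cos \<theta> = 1 - 2 * (sin (\<theta> / 2))\<^sup>2"
    using sin_double[of "\<theta> / 2"] cos_double_sin[of "\<theta> / 2"] by simp_all
  have ts: "t * sin \<theta> = 1 - cos \<theta>"
    using assms by (simp add: t_def tan_def s c power2_eq_square)
  have tc: "t * (1 + cos \<theta>) = sin \<theta>"
  proof -
    have "1 + cos \<theta> = 2 * (cos (\<theta> / 2))\<^sup>2" using cos_double_cos[of "\<theta> / 2"] by simp
    then show ?thesis using assms by (simp add: t_def tan_def s power2_eq_square)
  qed
  have "cis \<theta> * z = R (S (R z))" for z
  proof (rule complex_eqI)
    have "Re (R (S (R z))) = Re z * (1 - t * sin \<theta>) - Im z * (t * (2 - t * sin \<theta>))"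
      by (simp add: R_def S_def algebra_simps)
    also have "\<dots> = Re (cis \<theta> * z)" unfolding ts using tc by (simp add: algebra_simps)
    finally show "Re (cis \<theta> * z) = Re (R (S (R z)))" ..
    have "Im (R (S (R z))) = Im z * (1 - t * sin \<theta>) + Re z * sin \<theta>"
      by (simp add: R_def S_def algebra_simps)
    also have "\<dots> = Im (cis \<theta> * z)" unfolding ts by (simp add: algebra_simps)
    finally show "Im (cis \<theta> * z) = Im (R (S (R z)))" ..
  qed
  then have "distr lborel borel (\<lambda>z. cis \<theta> * z) = distr lborel borel (R \<circ> (S \<circ> R))"
    by (simp add: comp_def)
  also have "\<dots> = distr (distr (distr lborel borel R) borel S) borel R"
    by (simp add: distr_distr)
  also have "\<dots> = lborel" by (simp add: dR dS)
  finally show ?thesis .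
qed

text \<open>The area of a disk is linear in its squared radius, so the squared modulus sends area to
  a constant multiple of length. Comparing the two finite measures on half-lines takes the place of
  polar coordinates.\<close>

lemma distr_disk_norm_sq:
  assumes "R \<ge> 0"
  shows "distr (density lborel (indicator (cball 0 R))) borel (\<lambda>z::complex. (cmod z)\<^sup>2) =
     density lborel (\<lambda>s. ennreal pi * indicator {0..R\<^sup>2} s)" (is "?M = ?N")
proof (rule measure_eqI_lessThan)
  have cb: "emeasure lborel (cball (0::complex) r) = ennreal (pi * r\<^sup>2)" if "r \<ge> 0" for r
    using emeasure_cball[OF that, of "0::complex"] by (simp add: unit_ball_vol_2)
  have M: "emeasure ?M {x<..} = emeasure lborel (cball (0::complex) R \<inter> {z. x < (cmod z)\<^sup>2})" for x
  proof -
    have [measurable]: "{z::complex. x < (cmod z)\<^sup>2} \<in> sets borel" by measurable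
    have "emeasure ?M {x<..} = emeasure (density lborel (indicator (cball (0::complex) R))) {z. x < (cmod z)\<^sup>2}"
      by (subst emeasure_distr) (simp_all add: vimage_def)
    then show ?thesis by (simp add: emeasure_restricted)
  qed
  have N: "emeasure ?N {x<..} = ennreal pi * emeasure lborel ({0..R\<^sup>2} \<inter> {x<..})" for x
    by (simp add: emeasure_density mult.assoc nn_integral_cmult indicator_inter_arith[symmetric])
  fix x :: real
  have sq: "x < (cmod z)\<^sup>2 \<longleftrightarrow> \<not> cmod z \<le> sqrt x" for z :: complex
    using real_sqrt_less_iff[of x "(cmod z)\<^sup>2"] by auto
  show "emeasure ?M {x<..} = emeasure ?N {x<..}"
  proof (cases "x < 0")
    case True
    then have "cball (0::complex) R \<inter> {z. x < (cmod z)\<^sup>2} = cball 0 R" "{0..R\<^sup>2} \<inter> {x<..} = {0..R\<^sup>2}"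
      by (auto intro: less_le_trans)
    then show ?thesis unfolding M N using assms by (simp add: cb ennreal_mult)
  next
    case x: False
    show ?thesis
    proof (cases "x \<le> R\<^sup>2")
      case True
      have sx: "sqrt x \<le> R" using True assms x by (simp add: real_le_lsqrt)
      have "cball (0::complex) R \<inter> {z. x < (cmod z)\<^sup>2} = cball 0 R - cball 0 (sqrt x)"
        unfolding sq by auto
      moreover have "emeasure lborel (cball (0::complex) R - cball 0 (sqrt x)) = 
          emeasure lborel (cball (0::complex) R) - emeasure lborel (cball (0::complex) (sqrt x))"
        using sx x cb[of "sqrt x"] by (intro emeasure_Diff) auto
      moreover have "{0..R\<^sup>2} \<inter> {x<..} = {x<..R\<^sup>2}" using x by auto
      ultimately show ?thesis unfolding M N using x assms True
        by (simp add: cb ennreal_minus ennreal_mult[symmetric] algebra_simps)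
    next
      case False
      have "cball (0::complex) R \<inter> {z. x < (cmod z)\<^sup>2} = {}"
      proof -
        have "(cmod z)\<^sup>2 \<le> R\<^sup>2" if "cmod z \<le> R" for z :: complex
          using that by (intro power_mono) auto
        then show ?thesis using False by fastforce
      qed
      moreover have "{0..R\<^sup>2} \<inter> {x<..} = {}" using False by auto
      ultimately show ?thesis unfolding M N by simp
    qed
  qed
  have "emeasure ?M {x<..} \<le> emeasure lborel (cball (0::complex) R)"
    unfolding M by (intro emeasure_mono) auto
  also have "\<dots> < \<infinity>" using cb[OF assms] by simp
  finally show "emeasure ?M {x<..} < \<infinity>" .
qed simp_all

section \<open>The weight on the disk and its radial moments\<close>

text \<open>An incomplete gamma integral, in which \<open>s\<close> is the squared modulus and 2 the
  squared radius of the disk. The factor pi from the area has cancelled against the one in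
  \<open>area_measure\<close>.\<close>

definition radial_moment :: "nat \<Rightarrow> nat \<Rightarrow> real" where
  "radial_moment N a = (LINT s:{0..2}|lborel. s ^ a * exp (- (real N * s)))"

definition disk_weight :: "nat \<Rightarrow> complex \<Rightarrow> real" where
  "disk_weight N \<zeta> = boltzmann_factor N hard_edge_potential \<zeta>"

lemma disk_weight_eq: "disk_weight N \<zeta> = indicator (cball 0 (sqrt 2)) \<zeta> * exp (- (real N * (cmod \<zeta>)\<^sup>2))"
  by (auto simp: disk_weight_def boltzmann_factor_def hard_edge_potential_def)

lemma measurable_cnj [measurable]: "cnj \<in> borel_measurable borel"
  by (intro borel_measurable_continuous_onI continuous_intros)

lemma disk_weight_measurable [measurable]: "disk_weight N \<in> borel_measurable borel"
proof -
  have [measurable]: "cball (0::complex) (sqrt 2) \<in> sets borel" by simp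
  show ?thesis unfolding disk_weight_eq[abs_def] by measurable
qed

lemma sigma_finite_area_measure: "sigma_finite_measure area_measure"
  unfolding area_measure_def
  by (subst sigma_finite_measure.sigma_finite_iff_density_finite[OF sigma_finite_lborel]) auto

lemma sets_area_measure [measurable_cong, simp]: "sets area_measure = sets borel"
  and space_area_measure [simp]: "space area_measure = UNIV"
  by (simp_all add: area_measure_def)

lemma integrable_disk_weight:
  fixes f :: "complex \<Rightarrow> complex"
  assumes "continuous_on UNIV f"
  shows "integrable area_measure (\<lambda>\<zeta>. f \<zeta> * complex_of_real (disk_weight N \<zeta>))"
proof -
  have [measurable]: "f \<in> borel_measurable borel" by (rule borel_measurable_continuous_onI[OF assms])
  have "integrable lborel (\<lambda>\<zeta>. indicator (cball 0 (sqrt 2)) \<zeta> *\<^sub>R (f \<zeta> * complex_of_real (exp (- (real N * (cmod \<zeta>)\<^sup>2)))))"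
    by (rule borel_integrable_compact) (auto intro!: continuous_intros continuous_on_subset[OF assms])
  also have "(\<lambda>\<zeta>. indicator (cball 0 (sqrt 2)) \<zeta> *\<^sub>R (f \<zeta> * complex_of_real (exp (- (real N * (cmod \<zeta>)\<^sup>2))))) =
      (\<lambda>\<zeta>. f \<zeta> * complex_of_real (disk_weight N \<zeta>))"
    by (auto simp: disk_weight_eq indicator_def)
  finally have "integrable lborel (\<lambda>\<zeta>. (1 / pi) *\<^sub>R (f \<zeta> * complex_of_real (disk_weight N \<zeta>)))"
    by simp
  then show ?thesis
    unfolding area_measure_def by (subst integrable_density) auto
qed

lemma integral_area_measure:
  fixes f :: "complex \<Rightarrow> complex"
  assumes "f \<in> borel_measurable borel"
  shows "(\<integral>\<zeta>. f \<zeta> \<partial>area_measure) = (\<integral>\<zeta>. f \<zeta> \<partial>lborel) / pi"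
  unfolding area_measure_def using assms
  by (subst integral_density) (auto simp: scaleR_conv_of_real)

lemma moment_diag:
  "(\<integral>\<zeta>. (\<zeta> * cnj \<zeta>) ^ a * complex_of_real (disk_weight N \<zeta>) \<partial>area_measure) = radial_moment N a"
proof -
  define g where "g s = s ^ a * exp (- (real N * s))" for s
  have [measurable]: "g \<in> borel_measurable borel" unfolding g_def by measurable
  have "(\<zeta> * cnj \<zeta>) ^ a * complex_of_real (disk_weight N \<zeta>) =
      of_real (indicator (cball 0 (sqrt 2)) \<zeta> *\<^sub>R g ((cmod \<zeta>)\<^sup>2))" for \<zeta>
    unfolding complex_norm_square[symmetric] by (simp add: disk_weight_eq g_def)
  moreover have [measurable]: "cball (0::complex) (sqrt 2) \<in> sets borel" by simp
  ultimately have "(\<integral>\<zeta>. (\<zeta> * cnj \<zeta>) ^ a * complex_of_real (disk_weight N \<zeta>) \<partial>area_measure) =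
     of_real (\<integral>\<zeta>. indicator (cball 0 (sqrt 2)) \<zeta> *\<^sub>R g ((cmod \<zeta>)\<^sup>2) \<partial>lborel) / pi"
    by (subst integral_area_measure) (simp_all del: of_real_mult)
  also have "(\<integral>\<zeta>. indicator (cball 0 (sqrt 2)) \<zeta> *\<^sub>R g ((cmod \<zeta>)\<^sup>2) \<partial>lborel) =
      (\<integral>\<zeta>. g ((cmod \<zeta>)\<^sup>2) \<partial>density lborel (\<lambda>\<zeta>. ennreal (indicator (cball 0 (sqrt 2)) \<zeta>)))"
    by (rule integral_density[symmetric]) auto
  also have "\<dots> = (\<integral>s. g s \<partial>distr (density lborel (indicator (cball 0 (sqrt 2)))) borel (\<lambda>z::complex. (cmod z)\<^sup>2))"
    by (subst integral_distr) (simp_all add: ennreal_indicator)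
  also have "\<dots> = (\<integral>s. g s \<partial>density lborel (\<lambda>s. ennreal (pi * indicator {0..2} s)))"
    by (subst distr_disk_norm_sq) (simp_all add: ennreal_mult ennreal_indicator)
  also have "\<dots> = (\<integral>s. pi * (indicator {0..2} s * g s) \<partial>lborel)"
    by (subst integral_density) (auto simp: mult.assoc)
  also have "\<dots> = pi * radial_moment N a"
    by (simp add: radial_moment_def set_lebesgue_integral_def g_def)
  finally show ?thesis by simp
qed

text \<open>A rotation preserves measure and weight but multiplies the integrand by a phase, so the
  integral equals that phase times itself.\<close>

lemma moment_off_diag:
  assumes "a \<noteq> b"
  shows "(\<integral>\<zeta>. \<zeta> ^ a * cnj \<zeta> ^ b * complex_of_real (disk_weight N \<zeta>) \<partial>area_measure) = 0"
proof -
  define d where "d = real_of_int (int a - int b)"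
  have d: "\<bar>d\<bar> \<ge> 1" using assms by (auto simp: d_def)
  \<comment> \<open>This angle makes the phase \<open>cis (d * \<theta>)\<close> the imaginary unit.
    It is at most a quarter turn, so \<open>cos (\<theta> / 2)\<close> is positive, as the
    decomposition of the rotation into shears requires.\<close>
  define \<theta> where "\<theta> = pi / (2 * d)"
  have "\<bar>\<theta> / 2\<bar> \<le> pi / 4" using d by (simp add: \<theta>_def field_simps)
  then have "- (pi / 2) < \<theta> / 2" "\<theta> / 2 < pi / 2" using pi_gt_zero by linarith+
  then have "0 < cos (\<theta> / 2)" by (rule cos_gt_zero_pi)
  then have cos: "cos (\<theta> / 2) \<noteq> 0" by simp
  define F where "F \<zeta> = \<zeta> ^ a * cnj \<zeta> ^ b * complex_of_real (disk_weight N \<zeta>)" for \<zeta>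
  have [measurable]: "F \<in> borel_measurable borel" unfolding F_def by measurable
  have "cis \<theta> ^ a * cnj (cis \<theta>) ^ b = cis (d * \<theta>)"
  proof -
    have "real a * \<theta> + real b * (- \<theta>) = d * \<theta>" by (simp add: d_def algebra_simps)
    moreover have "cis \<theta> ^ a * cnj (cis \<theta>) ^ b = cis (real a * \<theta> + real b * (- \<theta>))"
      unfolding cis_cnj Complex.DeMoivre cis_mult ..
    ultimately show ?thesis by simp
  qed
  also have "d * \<theta> = pi / 2" using d by (auto simp: \<theta>_def)
  also have "cis (pi / 2) = \<i>" by simp
  finally have c: "cis \<theta> ^ a * cnj (cis \<theta>) ^ b = \<i>" .
  have rot: "disk_weight N (cis \<theta> * \<zeta>) = disk_weight N \<zeta>" for \<zeta>
    by (simp add: disk_weight_eq norm_mult indicator_def)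
  have "F (cis \<theta> * \<zeta>) = (cis \<theta> ^ a * cnj (cis \<theta>) ^ b) * F \<zeta>" for \<zeta>
    unfolding F_def rot complex_cnj_mult power_mult_distrib by (simp only: mult_ac)
  then have "F (cis \<theta> * \<zeta>) = \<i> * F \<zeta>" for \<zeta> unfolding c .
  note rotF = this
  have "(\<integral>\<zeta>. F \<zeta> \<partial>distr lborel borel (\<lambda>z. cis \<theta> * z)) = (\<integral>\<zeta>. F (cis \<theta> * \<zeta>) \<partial>lborel)"
    by (rule integral_distr) measurable
  then have "(\<integral>\<zeta>. F \<zeta> \<partial>lborel) = (\<integral>\<zeta>. F (cis \<theta> * \<zeta>) \<partial>lborel)"
    unfolding distr_lborel_rotation[OF cos] .
  also have "\<dots> = \<i> * (\<integral>\<zeta>. F \<zeta> \<partial>lborel)" unfolding rotF by simp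
  finally have "(\<integral>\<zeta>. F \<zeta> \<partial>lborel) = \<i> * (\<integral>\<zeta>. F \<zeta> \<partial>lborel)" .
  then have "(1 - \<i>) * (\<integral>\<zeta>. F \<zeta> \<partial>lborel) = 0" unfolding left_diff_distrib mult_1_left right_minus_eq .
  moreover have "1 - \<i> \<noteq> 0" by (simp add: complex_eq_iff)
  ultimately have "(\<integral>\<zeta>. F \<zeta> \<partial>lborel) = 0" by simp
  then show ?thesis unfolding F_def[symmetric] by (simp add: integral_area_measure)
qed


subsection \<open>Vandermonde determinant and skew-orthogonal polynomials\<close>

lemma prod_lessThan_double:
  fixes f :: "nat \<Rightarrow> 'a :: comm_monoid_mult"
  shows "(\<Prod>a<2 * n. f a) = (\<Prod>j<n. f (2 * j) * f (Suc (2 * j)))"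
  by (induction n) (simp_all add: mult.assoc)

definition eval_matrix :: "nat \<Rightarrow> (nat \<Rightarrow> complex poly) \<Rightarrow> (nat \<Rightarrow> complex) \<Rightarrow> complex Matrix.mat" where
  "eval_matrix n q x = Matrix.mat n n (\<lambda>(a, b). poly (q b) (x a))"

lemma eval_matrix_carrier [simp]: "eval_matrix n q x \<in> carrier_mat n n"
  by (simp add: eval_matrix_def)

text \<open>Expansion in monomials multiplies the matrix on the right by the coefficient matrix
  \<open>C\<close>, which is upper triangular with ones on the diagonal.\<close>

lemma det_eval_matrix_monic:
  assumes deg: "\<And>b. degree (q b) = b" and monic: "\<And>b. lead_coeff (q b) = 1"
  shows "Determinant.det (eval_matrix n q x) = Determinant.det (eval_matrix n (\<lambda>b. monom 1 b) x)"
proof -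
  define C where "C = Matrix.mat n n (\<lambda>(c, b). coeff (q b) c)"
  have C: "C \<in> carrier_mat n n" by (simp add: C_def)
  have "eval_matrix n q x = eval_matrix n (\<lambda>b. monom 1 b) x * C"
  proof (rule eq_matI)
    fix a b assume ab: "a < dim_row (eval_matrix n (\<lambda>b. monom 1 b) x * C)" "b < dim_col (eval_matrix n (\<lambda>b. monom 1 b) x * C)"
    then have a: "a < n" and b: "b < n" by (auto simp: C_def eval_matrix_def)
    have "poly (q b) (x a) = (\<Sum>c\<le>b. coeff (q b) c * x a ^ c)"
      by (simp add: poly_altdef deg)
    also have "\<dots> = (\<Sum>c<n. coeff (q b) c * x a ^ c)"
      using b deg[of b] by (intro sum.mono_neutral_left) (auto intro: coeff_eq_0)
    finally show "eval_matrix n q x $$ (a, b) = (eval_matrix n (\<lambda>b. monom 1 b) x * C) $$ (a, b)"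
      using a b by (simp add: eval_matrix_def C_def scalar_prod_def poly_monom mult.commute atLeast0LessThan)
  qed (auto simp: C_def eval_matrix_def)
  moreover have "Determinant.det C = 1"
  proof -
    have "Determinant.det C = prod_list (diag_mat C)"
      by (rule det_upper_triangular[OF _ C])
         (auto simp: C_def deg upper_triangular_def intro!: coeff_eq_0)
    also have "\<dots> = 1"
      using deg monic unfolding prod_list_diag_prod by (simp add: C_def)
    finally show ?thesis .
  qed
  ultimately show ?thesis using det_mult[OF eval_matrix_carrier C, of "\<lambda>b. monom 1 b" x] by simp
qed

text \<open>All monic families give the same determinant; for the Newton basis the matrix is triangular.\<close>

lemma det_eval_matrix:
  assumes "\<And>b. degree (q b) = b" and "\<And>b. lead_coeff (q b) = 1"
  shows "Determinant.det (eval_matrix n q x) = (\<Prod>i<n. \<Prod>j<i. x i - x j)"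
proof -
  define p where "p b = (\<Prod>j<b. [:- x j, 1:])" for b
  have deg: "degree (p b) = b" for b
    unfolding p_def by (subst degree_prod_eq_sum_degree) auto
  have monic: "lead_coeff (p b) = 1" for b
    unfolding p_def by (subst lead_coeff_prod) simp
  have "Determinant.det (eval_matrix n q x) = Determinant.det (eval_matrix n p x)"
    using det_eval_matrix_monic[of q n x] det_eval_matrix_monic[of p n x] assms deg monic by simp
  also have "\<dots> = prod_list (diag_mat (eval_matrix n p x))"
  proof (rule det_lower_triangular)
    fix i j assume "i < j" "j < n"
    then show "eval_matrix n p x $$ (i, j) = 0"
      by (auto simp: eval_matrix_def p_def poly_prod intro!: prod_zero)
  qed simp
  also have "\<dots> = (\<Prod>i<n. \<Prod>j<i. x i - x j)"
    unfolding prod_list_diag_prod by (simp add: eval_matrix_def p_def poly_prod atLeast0LessThan)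
  finally show ?thesis .
qed

lemma alternating_sum_monic:
  fixes q :: "nat \<Rightarrow> complex poly"
  assumes "\<And>b. degree (q b) = b" and "\<And>b. lead_coeff (q b) = 1"
  shows "(\<Sum>\<pi> | \<pi> permutes {..<n}. of_int (sign \<pi>) * (\<Prod>a<n. poly (q (\<pi> a)) (x a))) =
    (\<Prod>i<n. \<Prod>j<i. x i - x j)"
proof -
  have "(\<Sum>\<pi> | \<pi> permutes {..<n}. of_int (sign \<pi>) * (\<Prod>a<n. poly (q (\<pi> a)) (x a))) =
      Determinant.det (eval_matrix n q x)"
    unfolding det_def'[OF eval_matrix_carrier] atLeast0LessThan
  proof (rule sum.cong[OF refl], safe)
    fix \<pi> assume "\<pi> permutes {..<n}"
    then have "\<pi> a < n" if "a < n" for a using that permutes_in_image by fastforce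
    then show "of_int (sign \<pi>) * (\<Prod>a<n. poly (q (\<pi> a)) (x a)) =
        of_int (sign \<pi>) * (\<Prod>a<n. eval_matrix n q x $$ (a, \<pi> a))"
      by (intro arg_cong2[where f = "(*)"] refl prod.cong) (auto simp: eval_matrix_def)
  qed
  then show ?thesis using det_eval_matrix[OF assms] by simp
qed

definition interleave :: "(nat \<Rightarrow> complex) \<Rightarrow> nat \<Rightarrow> complex" where
  "interleave \<zeta> a = (if even a then \<zeta> (a div 2) else cnj (\<zeta> (a div 2)))"

lemma interleave_simps [simp]:
  "interleave \<zeta> (2 * j) = \<zeta> j" "interleave \<zeta> (Suc (2 * j)) = cnj (\<zeta> j)"
  by (simp_all add: interleave_def)

lemma Vandermonde_interleave:
  "(\<Prod>i<2 * n. \<Prod>j<i. interleave \<zeta> i - interleave \<zeta> j) =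
    (\<Prod>j<n. cnj (\<zeta> j) - \<zeta> j) *
    complex_of_real (\<Prod>j<n. \<Prod>k<j. (cmod (\<zeta> j - \<zeta> k))\<^sup>2 * (cmod (\<zeta> j - cnj (\<zeta> k)))\<^sup>2)"
proof (induction n)
  case (Suc n)
  \<comment> \<open>The new pair meets each old pair in four differences; each is matched with its
    conjugate, which makes two squared moduli.\<close>
  have "(\<Prod>j<2 * n. \<zeta> n - interleave \<zeta> j) * (\<Prod>j<2 * n. cnj (\<zeta> n) - interleave \<zeta> j) =
      (\<Prod>k<n. ((\<zeta> n - \<zeta> k) * cnj (\<zeta> n - \<zeta> k)) * ((\<zeta> n - cnj (\<zeta> k)) * cnj (\<zeta> n - cnj (\<zeta> k))))"
    unfolding prod_lessThan_double prod.distrib[symmetric] interleave_simps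
    by (intro prod.cong refl) (simp add: mult_ac)
  also have "\<dots> = complex_of_real (\<Prod>k<n. (cmod (\<zeta> n - \<zeta> k))\<^sup>2 * (cmod (\<zeta> n - cnj (\<zeta> k)))\<^sup>2)"
    unfolding complex_norm_square[symmetric] by simp
  finally have *: "(\<Prod>j<2 * n. \<zeta> n - interleave \<zeta> j) * (\<Prod>j<2 * n. cnj (\<zeta> n) - interleave \<zeta> j) =
      complex_of_real (\<Prod>k<n. (cmod (\<zeta> n - \<zeta> k))\<^sup>2 * (cmod (\<zeta> n - cnj (\<zeta> k)))\<^sup>2)" .
  have "(\<Prod>i<2 * Suc n. \<Prod>j<i. interleave \<zeta> i - interleave \<zeta> j) =
      (\<Prod>i<2 * n. \<Prod>j<i. interleave \<zeta> i - interleave \<zeta> j) * (cnj (\<zeta> n) - \<zeta> n) *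
      ((\<Prod>j<2 * n. \<zeta> n - interleave \<zeta> j) * (\<Prod>j<2 * n. cnj (\<zeta> n) - interleave \<zeta> j))"
  proof -
    have two: "2 * Suc n = Suc (Suc (2 * n))" by simp
    show ?thesis unfolding two prod.lessThan_Suc interleave_simps by (simp only: mult_ac)
  qed
  then show ?case unfolding Suc.IH * by (simp add: mult_ac)
qed simp

section \<open>Skew-orthogonal polynomials\<close>

text \<open>The Gram matrix of \<open>skew_form\<close> on monomials. Against a radial weight only
  equal powers of \<open>\<zeta>\<close> and its conjugate survive, so the factor
  \<open>\<zeta> - cnj \<zeta>\<close> couples a degree to its two neighbours alone.\<close>

definition monomial_moment :: "nat \<Rightarrow> nat \<Rightarrow> nat \<Rightarrow> complex" where
  "monomial_moment N a b = (if b = Suc a then complex_of_real (radial_moment N b)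
     else if a = Suc b then - complex_of_real (radial_moment N a) else 0)"

lemma monomial_moment_skew: "monomial_moment N b a = - monomial_moment N a b"
  by (auto simp: monomial_moment_def)

text \<open>The integrand is not antisymmetric in \<open>f\<close> and \<open>g\<close>; skewness
  holds for the integral and is read off from the moments.\<close>

definition skew_form :: "nat \<Rightarrow> complex poly \<Rightarrow> complex poly \<Rightarrow> complex" where
  "skew_form N f g =
     (\<integral>\<zeta>. (\<zeta> - cnj \<zeta>) * complex_of_real (disk_weight N \<zeta>) * (poly f \<zeta> * poly g (cnj \<zeta>)) \<partial>area_measure)"

lemma integrable_skew_form:
  "integrable area_measure
     (\<lambda>\<zeta>. (\<zeta> - cnj \<zeta>) * complex_of_real (disk_weight N \<zeta>) * (poly f \<zeta> * poly g (cnj \<zeta>)))"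
  using integrable_disk_weight[of "\<lambda>\<zeta>. (\<zeta> - cnj \<zeta>) * (poly f \<zeta> * poly g (cnj \<zeta>))" N]
  by (simp add: continuous_intros mult_ac)

lemma integral_monomials:
  "(\<integral>\<zeta>. (\<zeta> - cnj \<zeta>) * complex_of_real (disk_weight N \<zeta>) * (\<zeta> ^ a * cnj \<zeta> ^ b) \<partial>area_measure) = monomial_moment N a b"
proof -
  define F where "F a b \<zeta> = \<zeta> ^ a * cnj \<zeta> ^ b * complex_of_real (disk_weight N \<zeta>)" for a b \<zeta>
  have int: "integrable area_measure (F a b)" for a b
    unfolding F_def by (rule integrable_disk_weight) (intro continuous_intros)
  have F: "integral\<^sup>L area_measure (F a b) = (if a = b then radial_moment N a else 0)" for a b
    using moment_off_diag[of a b N] moment_diag[of a N]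
    unfolding F_def[abs_def] by (auto simp: power_mult_distrib)
  have "(\<integral>\<zeta>. (\<zeta> - cnj \<zeta>) * complex_of_real (disk_weight N \<zeta>) * (\<zeta> ^ a * cnj \<zeta> ^ b) \<partial>area_measure) =
      (\<integral>\<zeta>. F (Suc a) b \<zeta> - F a (Suc b) \<zeta> \<partial>area_measure)"
    by (intro Bochner_Integration.integral_cong refl) (simp add: F_def algebra_simps)
  also have "\<dots> = integral\<^sup>L area_measure (F (Suc a) b) - integral\<^sup>L area_measure (F a (Suc b))"
    by (rule Bochner_Integration.integral_diff[OF int int])
  finally show ?thesis by (auto simp: F monomial_moment_def)
qed

lemma skew_form_eq:
  "skew_form N f g = (\<Sum>i\<le>degree f. \<Sum>j\<le>degree g. coeff f i * coeff g j * monomial_moment N i j)"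
proof -
  define G where "G i j \<zeta> = (\<zeta> - cnj \<zeta>) * complex_of_real (disk_weight N \<zeta>) * (\<zeta> ^ i * cnj \<zeta> ^ j)" for i j \<zeta>
  have int: "integrable area_measure (G i j)" for i j
    unfolding G_def using integrable_skew_form[of N "monom 1 i" "monom 1 j"] by (simp add: poly_monom)
  have "(\<zeta> - cnj \<zeta>) * complex_of_real (disk_weight N \<zeta>) * (poly f \<zeta> * poly g (cnj \<zeta>)) =
      (\<Sum>i\<le>degree f. \<Sum>j\<le>degree g. coeff f i * coeff g j * G i j \<zeta>)" for \<zeta>
    unfolding poly_altdef sum_product unfolding sum_distrib_left G_def
    by (intro sum.cong refl) (simp add: mult_ac)
  then have "skew_form N f g = (\<integral>\<zeta>. (\<Sum>i\<le>degree f. \<Sum>j\<le>degree g. coeff f i * coeff g j * G i j \<zeta>) \<partial>area_measure)"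
    by (simp add: skew_form_def)
  also have "\<dots> = (\<Sum>i\<le>degree f. \<Sum>j\<le>degree g. coeff f i * coeff g j * (\<integral>\<zeta>. G i j \<zeta> \<partial>area_measure))"
    using int by (simp add: Bochner_Integration.integral_sum)
  finally show ?thesis by (simp add: G_def integral_monomials)
qed

lemma skew_form_skew: "skew_form N g f = - skew_form N f g"
proof -
  have "skew_form N g f = (\<Sum>j\<le>degree f. \<Sum>i\<le>degree g. coeff g i * coeff f j * monomial_moment N i j)"
    unfolding skew_form_eq by (rule sum.swap)
  also have "\<dots> = (\<Sum>j\<le>degree f. \<Sum>i\<le>degree g. - (coeff f j * coeff g i * monomial_moment N j i))"
  proof (intro sum.cong refl)
    fix i j
    show "coeff g i * coeff f j * monomial_moment N i j = - (coeff f j * coeff g i * monomial_moment N j i)"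
      by (subst monomial_moment_skew) simp
  qed
  finally show ?thesis by (simp add: skew_form_eq sum_negf)
qed

text \<open>The solution, equal to 1 at \<open>l = k\<close>, of the recursion which says that the
  even polynomial pairs to zero with \<open>x ^ (2 * l + 1)\<close> for \<open>l < k\<close>: the
  coefficient at \<open>l\<close> times the moment of order \<open>2 * l + 1\<close> equals the
  coefficient at \<open>l + 1\<close> times the moment of order \<open>2 * l + 2\<close>.\<close>

definition even_coeff :: "nat \<Rightarrow> nat \<Rightarrow> nat \<Rightarrow> real" where
  "even_coeff N k l = (\<Prod>j=l..<k. radial_moment N (2 * j + 2) / radial_moment N (2 * j + 1))"

definition skew_poly :: "nat \<Rightarrow> nat \<Rightarrow> complex poly" where
  "skew_poly N b = (if even b then \<Sum>l\<le>b div 2. monom (complex_of_real (even_coeff N (b div 2) l)) (2 * l)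
     else monom 1 b)"

lemma coeff_skew_poly_even:
  "coeff (skew_poly N (2 * k)) i = (if even i \<and> i \<le> 2 * k then complex_of_real (even_coeff N k (i div 2)) else 0)"
proof -
  have "coeff (skew_poly N (2 * k)) i = (\<Sum>l\<le>k. if i div 2 = l then (if even i then complex_of_real (even_coeff N k l) else 0) else 0)"
    unfolding skew_poly_def by (auto simp: coeff_sum intro!: sum.cong sum.neutral)
  also have "\<dots> = (if even i \<and> i \<le> 2 * k then complex_of_real (even_coeff N k (i div 2)) else 0)"
    by (subst sum.delta') auto
  finally show ?thesis .
qed

lemma skew_poly_odd [simp]: "skew_poly N (Suc (2 * k)) = monom 1 (Suc (2 * k))"
  by (simp add: skew_poly_def)

lemma degree_skew_poly: "degree (skew_poly N b) = b"
  and lead_coeff_skew_poly: "lead_coeff (skew_poly N b) = 1"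
proof -
  have "degree (skew_poly N b) = b \<and> lead_coeff (skew_poly N b) = 1"
  proof (cases b rule: nat_parity_cases)
    case (1 k)
    have c: "coeff (skew_poly N b) b = 1" unfolding 1 coeff_skew_poly_even by (simp add: even_coeff_def)
    moreover have "degree (skew_poly N b) = b"
    proof (rule antisym)
      show "degree (skew_poly N b) \<le> b"
        unfolding 1 by (intro degree_le) (simp add: coeff_skew_poly_even)
      show "b \<le> degree (skew_poly N b)" using c by (intro le_degree) simp
    qed
    ultimately show ?thesis by simp
  next
    case (2 k)
    then show ?thesis by (simp add: degree_monom_eq)
  qed
  then show "degree (skew_poly N b) = b" "lead_coeff (skew_poly N b) = 1" by auto
qed

lemma poly_skew_poly_even:
  "poly (skew_poly N (2 * k)) x = (\<Sum>l\<le>k. complex_of_real (even_coeff N k l) * x ^ (2 * l))"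
  by (simp add: skew_poly_def poly_sum poly_monom)

definition skew_norm :: "nat \<Rightarrow> nat \<Rightarrow> complex" where
  "skew_norm N k = complex_of_real (radial_moment N (Suc (2 * k)))"

text \<open>The odd polynomial is a monomial and sees only the two neighbouring coefficients of the
  even one. For \<open>m < k\<close> their contributions cancel by the recursion behind
  \<open>even_coeff\<close>; for \<open>m = k\<close> only the leading coefficient is left, and for
  \<open>m > k\<close> nothing is.\<close>

lemma skew_form_even_odd:
  assumes nz: "\<And>a. radial_moment N a \<noteq> 0"
  shows "skew_form N (skew_poly N (2 * k)) (skew_poly N (Suc (2 * m))) = (if k = m then skew_norm N k else 0)"
proof -
  let ?c = "\<lambda>i. coeff (skew_poly N (2 * k)) i"
  have deg: "degree (skew_poly N (2 * k)) = 2 * k" "degree (monom (1::complex) (Suc (2 * m))) = Suc (2 * m)"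
    by (simp_all add: degree_skew_poly degree_monom_eq)
  have "skew_form N (skew_poly N (2 * k)) (skew_poly N (Suc (2 * m))) =
      (\<Sum>i\<le>2 * k. \<Sum>j\<le>Suc (2 * m). if j = Suc (2 * m) then ?c i * monomial_moment N i j else 0)"
    unfolding skew_form_eq skew_poly_odd deg by (intro sum.cong refl) auto
  also have "\<dots> = (\<Sum>i\<le>2 * k. ?c i * monomial_moment N i (Suc (2 * m)))"
    by (simp only: sum.delta finite_atMost) simp
  also have "\<dots> = (\<Sum>i\<le>2 * k. (if i = 2 * m then ?c (2 * m) * skew_norm N m else 0)
      + (if i = 2 * m + 2 then - ?c (2 * m + 2) * complex_of_real (radial_moment N (2 * m + 2)) else 0))"
    by (intro sum.cong refl) (auto simp: monomial_moment_def skew_norm_def)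
  also have "\<dots> = (if m \<le> k then ?c (2 * m) * skew_norm N m else 0) -
      (if Suc m \<le> k then ?c (2 * m + 2) * complex_of_real (radial_moment N (2 * m + 2)) else 0)"
    unfolding sum.distrib by (simp add: sum.delta)
  also have "\<dots> = (if k = m then skew_norm N k else 0)"
  proof -
    consider "k < m" | "k = m" | "m < k" by linarith
    then show ?thesis
    proof cases
      case 3
      have "even_coeff N k m = radial_moment N (2 * m + 2) / radial_moment N (2 * m + 1) * even_coeff N k (Suc m)"
        unfolding even_coeff_def using 3 by (subst prod.atLeast_Suc_lessThan) auto
      then have "even_coeff N k m * radial_moment N (Suc (2 * m)) = even_coeff N k (Suc m) * radial_moment N (2 * m + 2)"
        using nz by (simp add: field_simps)
      moreover have "coeff (skew_poly N (2 * k)) (2 * m) = complex_of_real (even_coeff N k m)"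
        "coeff (skew_poly N (2 * k)) (2 * m + 2) = complex_of_real (even_coeff N k (Suc m))"
        using 3 by (auto simp: coeff_skew_poly_even)
      ultimately show ?thesis using 3
        by (simp add: skew_norm_def of_real_mult[symmetric] del: of_real_mult)
    qed (simp_all add: coeff_skew_poly_even even_coeff_def)
  qed
  finally show ?thesis .
qed

lemma skew_blocks_skew_poly:
  assumes nz: "\<And>a. radial_moment N a \<noteq> 0"
  shows "skew_blocks (\<lambda>a b. skew_form N (skew_poly N a) (skew_poly N b)) (skew_norm N)"
proof
  fix m
  show "skew_form N (skew_poly N (2 * m)) (skew_poly N (Suc (2 * m))) = skew_norm N m"
    by (simp only: skew_form_even_odd[OF nz] if_True simp_thms)
next
  fix a b
  show "skew_form N (skew_poly N b) (skew_poly N a) = - skew_form N (skew_poly N a) (skew_poly N b)"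
    by (rule skew_form_skew)
next
  \<comment> \<open>Monomials of equal parity pair to zero, and each polynomial contains only powers
    of the parity of its index.\<close>
  have parity: "skew_form N (skew_poly N a) (skew_poly N b) = 0" if "even a \<longleftrightarrow> even b" for a b
    unfolding skew_form_eq degree_skew_poly
  proof (intro sum.neutral ballI)
    have ev: "coeff (skew_poly N a) i = 0" if "even a \<noteq> even i" for a i
      using that by (cases a rule: nat_parity_cases) (auto simp: coeff_skew_poly_even)
    fix i j
    show "coeff (skew_poly N a) i * coeff (skew_poly N b) j * monomial_moment N i j = 0"
    proof (cases "even i \<longleftrightarrow> even j")
      case True
      then show ?thesis by (auto simp: monomial_moment_def)
    next
      case False
      then have "coeff (skew_poly N a) i = 0 \<or> coeff (skew_poly N b) j = 0"
        using ev \<open>even a \<longleftrightarrow> even b\<close> by blast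
      then show ?thesis by auto
    qed
  qed
  fix a b :: nat assume ne: "a div 2 \<noteq> b div 2"
  show "skew_form N (skew_poly N a) (skew_poly N b) = 0"
  proof (cases a rule: nat_parity_cases)
    case (1 i)
    show ?thesis
    proof (cases b rule: nat_parity_cases)
      case (1 j)
      with \<open>a = 2 * i\<close> show ?thesis by (intro parity) auto
    next
      case (2 j)
      with \<open>a = 2 * i\<close> ne show ?thesis
        using skew_form_even_odd[OF nz, of i j] by (auto simp del: skew_poly_odd)
    qed
  next
    case (2 i)
    show ?thesis
    proof (cases b rule: nat_parity_cases)
      case (1 j)
      with \<open>a = Suc (2 * i)\<close> ne show ?thesis
        using skew_form_even_odd[OF nz, of j i] skew_form_skew[of N "skew_poly N a" "skew_poly N b"]
        by (auto simp del: skew_poly_odd)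
    next
      case (2 j)
      with \<open>a = Suc (2 * i)\<close> show ?thesis by (intro parity) auto
    qed
  qed
qed


subsection \<open>The correlation functions as Pfaffians\<close>

text \<open>The 2 in the denominator is the one in \<open>averaged_sum\<close>. The orientation,
  with the odd polynomial in the first variable of the positive term, is opposite to that of the
  alternating sums; this is why \<open>- pre_kernel\<close> stands in the Pfaffians.\<close>

definition pre_kernel :: "nat \<Rightarrow> complex \<Rightarrow> complex \<Rightarrow> complex" where
  "pre_kernel N x y = (\<Sum>m<N.
     (poly (skew_poly N (Suc (2 * m))) x * poly (skew_poly N (2 * m)) y -
      poly (skew_poly N (2 * m)) x * poly (skew_poly N (Suc (2 * m))) y) / (2 * skew_norm N m))"

text \<open>Permuting the points instead of the polynomials amounts to inverting the permutation, as
  for the determinant of a transpose; the sign is the same.\<close>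

lemma sum_permutations_inv_eq:
  fixes q :: "nat \<Rightarrow> complex \<Rightarrow> complex"
  shows "(\<Sum>\<pi> | \<pi> permutes {..<2 * k}. of_int (sign \<pi>) * (\<Prod>j<k. q (c (2 * j)) (x (\<pi> (2 * j))) * q (c (Suc (2 * j))) (x (\<pi> (Suc (2 * j))))))
    = alternating_sum k (\<lambda>j a b. q a (x (2 * j)) * q b (x (Suc (2 * j)))) c"
proof -
  have "alternating_sum k (\<lambda>j a b. q a (x (2 * j)) * q b (x (Suc (2 * j)))) c =
     (\<Sum>\<pi> | \<pi> permutes {..<2 * k}. of_int (sign \<pi>) * (\<Prod>a<2 * k. q (c (\<pi> a)) (x a)))"
    unfolding alternating_sum_def prod_lessThan_double ..
  also have "\<dots> = (\<Sum>\<pi> | \<pi> permutes {..<2 * k}. of_int (sign (inv_into UNIV \<pi>)) * (\<Prod>a<2 * k. q (c (inv_into UNIV \<pi> a)) (x a)))"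
    by (rule sum_permutations_inverse)
  also have "\<dots> = (\<Sum>\<pi> | \<pi> permutes {..<2 * k}. of_int (sign \<pi>) * (\<Prod>a<2 * k. q (c a) (x (\<pi> a))))"
  proof (rule sum.cong[OF refl], safe)
    fix \<pi> assume \<pi>: "\<pi> permutes {..<2 * k}"
    have "sign (inv_into UNIV \<pi>) = sign \<pi>"
      using \<pi> permutation_permutes sign_inverse by blast
    moreover have "(\<Prod>a<2 * k. q (c (inv_into UNIV \<pi> a)) (x a)) = (\<Prod>a<2 * k. q (c a) (x (\<pi> a)))"
      by (subst prod.permute[OF \<pi>]) (simp add: comp_def permutes_inverses[OF \<pi>])
    ultimately show "of_int (sign (inv_into UNIV \<pi>)) * (\<Prod>a<2 * k. q (c (inv_into UNIV \<pi> a)) (x a)) =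
       of_int (sign \<pi>) * (\<Prod>a<2 * k. q (c a) (x (\<pi> a)))" by simp
  qed
  finally show ?thesis unfolding prod_lessThan_double ..
qed

text \<open>Multilinear expansion: each of the \<open>k\<close> factors chooses a summand
  \<open>m j\<close> of the kernel, and what is left is an alternating sum labelled by the chosen
  pairs of polynomials.\<close>

lemma pfaffian_pre_kernel:
  "pfaffian k (\<lambda>a b. - pre_kernel N (x a) (x b)) =
     (\<Sum>m \<in> {..<k} \<rightarrow>\<^sub>E {..<N}. (\<Prod>j<k. 1 / (2 * skew_norm N (m j))) *
        alternating_sum k (\<lambda>j a b. poly (skew_poly N a) (x (2 * j)) * poly (skew_poly N b) (x (Suc (2 * j)))) (block_lift m)) / fact k"
proof -
  let ?q = "\<lambda>a. poly (skew_poly N a)"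
  \<comment> \<open>One of the two terms of the antisymmetric entry, the one with the even
    polynomial in the first variable; \<open>sum_sign_antisymmetrize\<close> lets it stand for the
    whole entry.\<close>
  define E where "E a b = (\<Sum>m<N. 1 / (2 * skew_norm N m) * (?q (2 * m) (x a) * ?q (Suc (2 * m)) (x b)))" for a b
  have "- pre_kernel N (x a) (x b) = E a b - E b a" for a b
    unfolding pre_kernel_def E_def sum_subtractf[symmetric] sum_negf[symmetric]
    by (intro sum.cong refl) (simp add: diff_divide_distrib mult_ac)
  then have "pfaffian k (\<lambda>a b. - pre_kernel N (x a) (x b)) = 1 / (2 ^ k * fact k) *
     (2 ^ k * (\<Sum>\<pi> | \<pi> permutes {..<2 * k}. of_int (sign \<pi>) * (\<Prod>j<k. E (\<pi> (2 * j)) (\<pi> (Suc (2 * j))))))"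
    unfolding pfaffian_def sum_sign_antisymmetrize[symmetric] by simp
  also have "\<dots> = (\<Sum>\<pi> | \<pi> permutes {..<2 * k}. of_int (sign \<pi>) * (\<Prod>j<k. E (\<pi> (2 * j)) (\<pi> (Suc (2 * j))))) / fact k"
    by simp
  also have "(\<Sum>\<pi> | \<pi> permutes {..<2 * k}. of_int (sign \<pi>) * (\<Prod>j<k. E (\<pi> (2 * j)) (\<pi> (Suc (2 * j))))) =
     (\<Sum>\<pi> | \<pi> permutes {..<2 * k}. \<Sum>m \<in> {..<k} \<rightarrow>\<^sub>E {..<N}. (\<Prod>j<k. 1 / (2 * skew_norm N (m j))) *
       (of_int (sign \<pi>) * (\<Prod>j<k. ?q (2 * m j) (x (\<pi> (2 * j))) * ?q (Suc (2 * m j)) (x (\<pi> (Suc (2 * j)))))))"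
  proof (rule sum.cong[OF refl])
    fix \<pi>
    have "(\<Prod>j<k. E (\<pi> (2 * j)) (\<pi> (Suc (2 * j)))) =
      (\<Sum>m \<in> {..<k} \<rightarrow>\<^sub>E {..<N}. \<Prod>j<k. 1 / (2 * skew_norm N (m j)) *
         (?q (2 * m j) (x (\<pi> (2 * j))) * ?q (Suc (2 * m j)) (x (\<pi> (Suc (2 * j))))))"
      unfolding E_def by (rule prod_sum_PiE) auto
    then show "of_int (sign \<pi>) * (\<Prod>j<k. E (\<pi> (2 * j)) (\<pi> (Suc (2 * j)))) = (\<Sum>m \<in> {..<k} \<rightarrow>\<^sub>E {..<N}. (\<Prod>j<k. 1 / (2 * skew_norm N (m j))) *
       (of_int (sign \<pi>) * (\<Prod>j<k. ?q (2 * m j) (x (\<pi> (2 * j))) * ?q (Suc (2 * m j)) (x (\<pi> (Suc (2 * j)))))))"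
      by (simp only: prod.distrib sum_distrib_left mult_ac)
  qed
  also have "\<dots> = (\<Sum>m \<in> {..<k} \<rightarrow>\<^sub>E {..<N}. \<Sum>\<pi> | \<pi> permutes {..<2 * k}. (\<Prod>j<k. 1 / (2 * skew_norm N (m j))) *
       (of_int (sign \<pi>) * (\<Prod>j<k. ?q (2 * m j) (x (\<pi> (2 * j))) * ?q (Suc (2 * m j)) (x (\<pi> (Suc (2 * j)))))))"
    by (rule sum.swap)
  also have "\<dots> = (\<Sum>m \<in> {..<k} \<rightarrow>\<^sub>E {..<N}. (\<Prod>j<k. 1 / (2 * skew_norm N (m j))) *
        alternating_sum k (\<lambda>j a b. ?q a (x (2 * j)) * ?q b (x (Suc (2 * j)))) (block_lift m))"
  proof (rule sum.cong[OF refl])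
    fix m :: "nat \<Rightarrow> nat"
    show "(\<Sum>\<pi> | \<pi> permutes {..<2 * k}. (\<Prod>j<k. 1 / (2 * skew_norm N (m j))) *
       (of_int (sign \<pi>) * (\<Prod>j<k. ?q (2 * m j) (x (\<pi> (2 * j))) * ?q (Suc (2 * m j)) (x (\<pi> (Suc (2 * j))))))) =
       (\<Prod>j<k. 1 / (2 * skew_norm N (m j))) *
        alternating_sum k (\<lambda>j a b. ?q a (x (2 * j)) * ?q b (x (Suc (2 * j)))) (block_lift m)"
      using sum_permutations_inv_eq[where k = k and q = ?q and c = "block_lift m" and x = x]
      unfolding sum_distrib_left[symmetric] block_lift_even block_lift_odd by (rule arg_cong)
  qed
  finally show ?thesis .
qed

text \<open>A choice that uses a pair of polynomials twice drops out because two labels coincide,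
  and each injective choice comes from \<open>(N - k)!\<close> permutations.\<close>

lemma pfaffian_pre_kernel_eq_averaged:
  assumes "skew_blocks J (skew_norm N)" and k: "k \<le> N"
  shows "pfaffian k (\<lambda>a b. - pre_kernel N (x a) (x b)) =
    skew_blocks.averaged_sum (skew_norm N) N
      (\<lambda>j a b. poly (skew_poly N a) (x (2 * j)) * poly (skew_poly N b) (x (Suc (2 * j)))) k / (fact (N - k) * fact k)"
proof -
  interpret skew_blocks J "skew_norm N" by fact
  let ?H = "\<lambda>j a b. poly (skew_poly N a) (x (2 * j)) * poly (skew_poly N b) (x (Suc (2 * j)))"
  define F where "F m = (\<Prod>j<k. 1 / (2 * skew_norm N (m j))) * alternating_sum k ?H (block_lift m)" for m :: "nat \<Rightarrow> nat"
  have "F \<mu> = F (restrict \<mu> {..<k})" for \<mu>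
  proof -
    have "alternating_sum k ?H (block_lift \<mu>) = alternating_sum k ?H (block_lift (restrict \<mu> {..<k}))"
    proof (rule alternating_sum_cong)
      fix j a b assume "a < 2 * k" "b < 2 * k"
      then have "a div 2 < k" "b div 2 < k" by auto
      then show "?H j (block_lift \<mu> a) (block_lift \<mu> b) =
          ?H j (block_lift (restrict \<mu> {..<k}) a) (block_lift (restrict \<mu> {..<k}) b)"
        by (simp add: block_lift_def)
    qed
    moreover have "(\<Prod>j<k. 1 / (2 * skew_norm N (\<mu> j))) = (\<Prod>j<k. 1 / (2 * skew_norm N (restrict \<mu> {..<k} j)))"
      by (rule prod.cong) auto
    ultimately show ?thesis by (simp add: F_def)
  qed
  then have "averaged_sum N ?H k = (\<Sum>\<mu> | \<mu> permutes {..<N}. F (restrict \<mu> {..<k}))"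
    unfolding averaged_sum_def F_def[symmetric] by (rule sum.cong[OF refl])
  also have "\<dots> = fact (N - k) * (\<Sum>m \<in> {m \<in> {..<k} \<rightarrow>\<^sub>E {..<N}. inj_on m {..<k}}. F m)"
    by (rule sum_permutations_restrict[OF k])
  also have "(\<Sum>m \<in> {m \<in> {..<k} \<rightarrow>\<^sub>E {..<N}. inj_on m {..<k}}. F m) = (\<Sum>m \<in> {..<k} \<rightarrow>\<^sub>E {..<N}. F m)"
  proof (rule sum.mono_neutral_left)
    show "finite ({..<k} \<rightarrow>\<^sub>E {..<N})" by (intro finite_PiE) auto
    show "\<forall>m\<in>({..<k} \<rightarrow>\<^sub>E {..<N}) - {m \<in> {..<k} \<rightarrow>\<^sub>E {..<N}. inj_on m {..<k}}. F m = 0"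
    proof
      fix m assume "m \<in> ({..<k} \<rightarrow>\<^sub>E {..<N}) - {m \<in> {..<k} \<rightarrow>\<^sub>E {..<N}. inj_on m {..<k}}"
      then obtain i j where "i < k" "j < k" "i \<noteq> j" "m i = m j" by (auto simp: inj_on_def)
      then have "alternating_sum k ?H (block_lift m) = 0"
        by (intro alternating_sum_eq_0[of "2 * i" _ "2 * j"]) auto
      then show "F m = 0" by (simp add: F_def)
    qed
  qed auto
  finally show ?thesis unfolding pfaffian_pre_kernel F_def by simp
qed

section \<open>Integrating points out of the weight\<close>

lemma alternating_sum_0 [simp]: "alternating_sum 0 H c = 1"
  by (simp add: alternating_sum_def)

text \<open>The squared modulus of \<open>\<xi> j - cnj (\<xi> j)\<close> is a product of two
  factors of opposite sign. One completes the Vandermonde product of the \<open>2 * N\<close>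
  variables; the other stays with the weight of the point and becomes the factor in
  \<open>skew_form\<close>.\<close>

lemma symplectic_weight_eq:
  "complex_of_real (symplectic_weight N hard_edge_potential \<xi>) =
    (\<Sum>\<pi> | \<pi> permutes {..<2 * N}. of_int (sign \<pi>) * (\<Prod>j<N.
       (\<xi> j - cnj (\<xi> j)) * complex_of_real (disk_weight N (\<xi> j)) *
       (poly (skew_poly N (\<pi> (2 * j))) (\<xi> j) * poly (skew_poly N (\<pi> (Suc (2 * j)))) (cnj (\<xi> j)))))"
proof -
  let ?V = "\<Prod>j<N. \<Prod>k<j. (cmod (\<xi> j - \<xi> k))\<^sup>2 * (cmod (\<xi> j - cnj (\<xi> k)))\<^sup>2"
  let ?S = "\<Sum>\<pi> | \<pi> permutes {..<2 * N}. of_int (sign \<pi>) * (\<Prod>a<2 * N. poly (skew_poly N (\<pi> a)) (interleave \<xi> a))"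
  have V: "(\<Prod>j<N. cnj (\<xi> j) - \<xi> j) * complex_of_real ?V = ?S"
    unfolding alternating_sum_monic[of "skew_poly N", OF degree_skew_poly lead_coeff_skew_poly] Vandermonde_interleave ..
  have "complex_of_real ((cmod (\<xi> j - cnj (\<xi> j)))\<^sup>2) = (\<xi> j - cnj (\<xi> j)) * (cnj (\<xi> j) - \<xi> j)" for j
    unfolding complex_norm_square by simp
  then have "complex_of_real (symplectic_weight N hard_edge_potential \<xi>) =
      (\<Prod>j<N. (\<xi> j - cnj (\<xi> j)) * complex_of_real (disk_weight N (\<xi> j))) * ((\<Prod>j<N. cnj (\<xi> j) - \<xi> j) * complex_of_real ?V)"
    unfolding symplectic_weight_def disk_weight_def[symmetric] of_real_mult of_real_prod
    by (simp only: prod.distrib mult_ac)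
  also have "\<dots> = (\<Prod>j<N. (\<xi> j - cnj (\<xi> j)) * complex_of_real (disk_weight N (\<xi> j))) * ?S"
    unfolding V ..
  also have "\<dots> = (\<Sum>\<pi> | \<pi> permutes {..<2 * N}. of_int (sign \<pi>) * (\<Prod>j<N.
       (\<xi> j - cnj (\<xi> j)) * complex_of_real (disk_weight N (\<xi> j)) *
       (poly (skew_poly N (\<pi> (2 * j))) (\<xi> j) * poly (skew_poly N (\<pi> (Suc (2 * j)))) (cnj (\<xi> j)))))"
    unfolding sum_distrib_left prod_lessThan_double interleave_simps
    by (intro sum.cong refl) (simp only: prod.distrib mult_ac)
  finally show ?thesis .
qed

interpretation area: product_sigma_finite "\<lambda>_. area_measure"
  by (rule product_sigma_finite.intro) (rule sigma_finite_area_measure)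

text \<open>Every summand of the permutation expansion is a product over the points, so Fubini
  integrates each point separately and turns its factor into an entry of the skew Gram
  matrix.\<close>

lemma integral_symplectic_weight:
  assumes k: "k \<le> N"
  shows "complex_of_real (\<integral>\<eta>. symplectic_weight N hard_edge_potential (merge {..<k} {k..<N} (\<zeta>, \<eta>))
        \<partial>(PiM {k..<N} (\<lambda>_. area_measure))) =
    alternating_sum N (\<lambda>j a b. if j < k
      then (\<zeta> j - cnj (\<zeta> j)) * complex_of_real (disk_weight N (\<zeta> j)) *
        (poly (skew_poly N a) (\<zeta> j) * poly (skew_poly N b) (cnj (\<zeta> j)))
      else skew_form N (skew_poly N a) (skew_poly N b)) id" (is "_ = ?rhs")
proof -
  define g where "g \<pi> j z = (z - cnj z) * complex_of_real (disk_weight N z) *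
     (poly (skew_poly N (\<pi> (2 * j))) z * poly (skew_poly N (\<pi> (Suc (2 * j)))) (cnj z))" for \<pi> :: "nat \<Rightarrow> nat" and j z
  have int: "integrable area_measure (g \<pi> j)" for \<pi> j
    unfolding g_def by (rule integrable_skew_form)
  have intI: "integrable (PiM {k..<N} (\<lambda>_. area_measure)) (\<lambda>\<eta>. \<Prod>j\<in>{k..<N}. g \<pi> j (\<eta> j))" for \<pi>
    by (rule area.product_integrable_prod) (simp_all add: int)
  have split: "(\<Prod>j<N. f j) = (\<Prod>j<k. f j) * (\<Prod>j\<in>{k..<N}. f j)" for f :: "nat \<Rightarrow> complex"
    using k by (subst prod.union_disjoint[symmetric]) (auto intro!: prod.cong)
  have pt: "complex_of_real (symplectic_weight N hard_edge_potential (merge {..<k} {k..<N} (\<zeta>, \<eta>))) =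
     (\<Sum>\<pi> | \<pi> permutes {..<2 * N}. (of_int (sign \<pi>) * (\<Prod>j<k. g \<pi> j (\<zeta> j))) * (\<Prod>j\<in>{k..<N}. g \<pi> j (\<eta> j)))" for \<eta>
  proof -
    let ?x = "merge {..<k} {k..<N} (\<zeta>, \<eta>)"
    have "(\<Prod>j<k. g \<pi> j (?x j)) = (\<Prod>j<k. g \<pi> j (\<zeta> j))"
      "(\<Prod>j\<in>{k..<N}. g \<pi> j (?x j)) = (\<Prod>j\<in>{k..<N}. g \<pi> j (\<eta> j))" for \<pi>
      by (intro prod.cong refl; simp add: merge_def)+
    then show ?thesis
      unfolding symplectic_weight_eq g_def[symmetric] split by (simp add: mult.assoc)
  qed
  have "complex_of_real (\<integral>\<eta>. symplectic_weight N hard_edge_potential (merge {..<k} {k..<N} (\<zeta>, \<eta>))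
        \<partial>(PiM {k..<N} (\<lambda>_. area_measure))) =
     (\<integral>\<eta>. (\<Sum>\<pi> | \<pi> permutes {..<2 * N}. (of_int (sign \<pi>) * (\<Prod>j<k. g \<pi> j (\<zeta> j))) * (\<Prod>j\<in>{k..<N}. g \<pi> j (\<eta> j)))
        \<partial>(PiM {k..<N} (\<lambda>_. area_measure)))"
    unfolding integral_complex_of_real[symmetric] pt ..
  also have "\<dots> = (\<Sum>\<pi> | \<pi> permutes {..<2 * N}. (of_int (sign \<pi>) * (\<Prod>j<k. g \<pi> j (\<zeta> j))) *
        (\<integral>\<eta>. (\<Prod>j\<in>{k..<N}. g \<pi> j (\<eta> j)) \<partial>(PiM {k..<N} (\<lambda>_. area_measure))))"
    using intI by (simp add: Bochner_Integration.integral_sum)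
  also have "\<dots> = (\<Sum>\<pi> | \<pi> permutes {..<2 * N}. (of_int (sign \<pi>) * (\<Prod>j<k. g \<pi> j (\<zeta> j))) *
        (\<Prod>j\<in>{k..<N}. integral\<^sup>L area_measure (g \<pi> j)))"
    by (subst area.product_integral_prod) (simp_all add: int)
  also have "\<dots> = ?rhs"
    unfolding alternating_sum_def
  proof (rule sum.cong[OF refl])
    fix \<pi> :: "nat \<Rightarrow> nat"
    have "(\<Prod>j\<in>{k..<N}. integral\<^sup>L area_measure (g \<pi> j)) =
        (\<Prod>j\<in>{k..<N}. skew_form N (skew_poly N (\<pi> (2 * j))) (skew_poly N (\<pi> (Suc (2 * j)))))"
      by (simp add: g_def[abs_def] skew_form_def)
    then show "(of_int (sign \<pi>) * (\<Prod>j<k. g \<pi> j (\<zeta> j))) * (\<Prod>j\<in>{k..<N}. integral\<^sup>L area_measure (g \<pi> j)) =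
       of_int (sign \<pi>) * (\<Prod>j<N. if j < k
        then (\<zeta> j - cnj (\<zeta> j)) * complex_of_real (disk_weight N (\<zeta> j)) *
          (poly (skew_poly N (id (\<pi> (2 * j)))) (\<zeta> j) * poly (skew_poly N (id (\<pi> (Suc (2 * j))))) (cnj (\<zeta> j)))
        else skew_form N (skew_poly N (id (\<pi> (2 * j)))) (skew_poly N (id (\<pi> (Suc (2 * j))))))"
      unfolding split by (simp add: g_def)
  qed
  finally show ?thesis .
qed

text \<open>Numerator and partition function are both instances of \<open>W\<close>, with
  \<open>k\<close> and with 0 points held fixed; the product of the norms cancels in the
  quotient.\<close>

lemma correlation_eq_pfaffian:
  assumes k: "k \<le> N" and nz: "\<And>a. radial_moment N a \<noteq> 0"
  shows "complex_of_real (correlation N hard_edge_potential k \<zeta>) =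
    (\<Prod>j<k. (\<zeta> j - cnj (\<zeta> j)) * complex_of_real (disk_weight N (\<zeta> j))) *
    pfaffian k (\<lambda>a b. - pre_kernel N (interleave \<zeta> a) (interleave \<zeta> b))"
proof -
  define J where "J a b = skew_form N (skew_poly N a) (skew_poly N b)" for a b
  have sb: "skew_blocks J (skew_norm N)"
    unfolding J_def by (rule skew_blocks_skew_poly[OF nz])
  interpret skew_blocks J "skew_norm N" by (rule sb)
  have nz': "skew_norm N m \<noteq> 0" for m using nz by (simp add: skew_norm_def)
  let ?G = "\<lambda>j a b. poly (skew_poly N a) (interleave \<zeta> (2 * j)) * poly (skew_poly N b) (interleave \<zeta> (Suc (2 * j)))"
  let ?c = "\<lambda>j. (\<zeta> j - cnj (\<zeta> j)) * complex_of_real (disk_weight N (\<zeta> j))"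
  let ?W = "\<lambda>k. complex_of_real (\<integral>\<eta>. symplectic_weight N hard_edge_potential (merge {..<k} {k..<N} (\<zeta>, \<eta>))
        \<partial>(PiM {k..<N} (\<lambda>_. area_measure)))"
  define H where "H k j a b = (if j < k then ?c j * (poly (skew_poly N a) (\<zeta> j) * poly (skew_poly N b) (cnj (\<zeta> j)))
     else J a b)" for k j a b
  have W: "?W k = (\<Prod>j<N. 2 * skew_norm N j) * averaged_sum N (H k) k / fact k" if "k \<le> N" for k
  proof -
    have "H k j = J" if "k \<le> j" for j using that by (simp add: H_def fun_eq_iff)
    then have "alternating_sum N (H k) id = (\<Prod>j<N. 2 * skew_norm N j) * averaged_sum N (H k) k / fact k"
      using nz' \<open>k \<le> N\<close> by (intro alternating_sum_eq_averaged) auto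
    then show ?thesis
      unfolding integral_symplectic_weight[OF that] H_def[abs_def] J_def .
  qed
  have avg: "averaged_sum N (H k) k = (\<Prod>j<k. ?c j) * averaged_sum N ?G k"
  proof -
    have "alternating_sum k (H k) c = (\<Prod>j<k. ?c j) * alternating_sum k ?G c" for c
    proof -
      have "(\<Prod>j<k. H k j (f j) (g j)) = (\<Prod>j<k. ?c j) * (\<Prod>j<k. ?G j (f j) (g j))" for f g
        unfolding prod.distrib[symmetric] by (rule prod.cong) (auto simp: H_def)
      then show ?thesis
        unfolding alternating_sum_def sum_distrib_left by (intro sum.cong refl) simp
    qed
    then show ?thesis
      unfolding averaged_sum_def sum_distrib_left by (intro sum.cong refl) simp
  qed
  have part: "complex_of_real (partition_function N hard_edge_potential) = (\<Prod>j<N. 2 * skew_norm N j) * fact N"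
  proof -
    \<comment> \<open>With no point held fixed, merging leaves the values below \<open>N\<close>
      unchanged, and the weight reads only those.\<close>
    have "partition_function N hard_edge_potential =
        (\<integral>\<eta>. symplectic_weight N hard_edge_potential (merge {..<0} {0..<N} (\<zeta>, \<eta>)) \<partial>(PiM {0..<N} (\<lambda>_. area_measure)))"
    proof -
      have "symplectic_weight N hard_edge_potential (merge {..<0} {0..<N} (\<zeta>, \<eta>)) = symplectic_weight N hard_edge_potential \<eta>" for \<eta>
        unfolding symplectic_weight_def
        by (intro arg_cong2[where f = "(*)"] prod.cong refl) (auto simp: merge_def)
      then show ?thesis unfolding partition_function_def atLeast0LessThan by simp
    qed
    moreover have "?W 0 = (\<Prod>j<N. 2 * skew_norm N j) * averaged_sum N (H 0) 0 / fact 0"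
      by (rule W) simp
    ultimately have "complex_of_real (partition_function N hard_edge_potential) =
        (\<Prod>j<N. 2 * skew_norm N j) * averaged_sum N (H 0) 0 / fact 0"
      by (simp only:)
    then have "complex_of_real (partition_function N hard_edge_potential) =
        (\<Prod>j<N. 2 * skew_norm N j) * averaged_sum N (H 0) 0"
      by simp
    \<comment> \<open>The empty product and the empty alternating sum are 1, so the sum counts
      permutations.\<close>
    also have "averaged_sum N (H 0) 0 = fact N"
      by (simp add: averaged_sum_def card_permutations[OF refl])
    finally show ?thesis .
  qed
  have "complex_of_real (correlation N hard_edge_potential k \<zeta>) =
     fact N / fact (N - k) * (?W k / complex_of_real (partition_function N hard_edge_potential))"
    unfolding correlation_def symplectic_density_def by simp
  also have "\<dots> = averaged_sum N (H k) k / (fact (N - k) * fact k)"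
    unfolding W[OF k] part using nz' by (simp add: field_simps)
  also have "\<dots> = (\<Prod>j<k. ?c j) * pfaffian k (\<lambda>a b. - pre_kernel N (interleave \<zeta> a) (interleave \<zeta> b))"
    unfolding avg pfaffian_pre_kernel_eq_averaged[OF sb k] by simp
  finally show ?thesis .
qed


subsection \<open>Riemann sums and the Gaussian limit of falling products\<close>

text \<open>Its integral is the Riemann sum of mesh \<open>1 / sqrt n\<close>, which makes limit
  theorems for integrals available. The cells fill the interval from 0 to \<open>sqrt n\<close>,
  which exhausts the half-line.\<close>

definition step_fun :: "nat \<Rightarrow> (nat \<Rightarrow> 'b::real_vector) \<Rightarrow> real \<Rightarrow> 'b" where
  "step_fun n g x = (\<Sum>i<n. indicator {real i / sqrt n..<(real i + 1) / sqrt n} x *\<^sub>R g i)"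

lemma step_fun_eq:
  assumes n: "n > 0"
  shows "step_fun n g x = (if x \<ge> 0 \<and> nat \<lfloor>sqrt n * x\<rfloor> < n then g (nat \<lfloor>sqrt n * x\<rfloor>) else 0)"
proof -
  have iff: "x \<in> {real i / sqrt n..<(real i + 1) / sqrt n} \<longleftrightarrow> x \<ge> 0 \<and> i = nat \<lfloor>sqrt n * x\<rfloor>" for i
  proof -
    have "x \<in> {real i / sqrt n..<(real i + 1) / sqrt n} \<longleftrightarrow> real i \<le> sqrt n * x \<and> sqrt n * x < real i + 1"
      using n by (auto simp: field_simps)
    also have "\<dots> \<longleftrightarrow> \<lfloor>sqrt n * x\<rfloor> = int i" by linarith
    also have "\<dots> \<longleftrightarrow> sqrt n * x \<ge> 0 \<and> i = nat \<lfloor>sqrt n * x\<rfloor>"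
      by (metis floor_less_zero int_nat_eq linorder_not_less nat_int of_nat_0_le_iff zero_le_floor)
    finally show ?thesis using n by (simp add: zero_le_mult_iff)
  qed
  have "step_fun n g x = (\<Sum>i<n. if i = nat \<lfloor>sqrt n * x\<rfloor> then (if x \<ge> 0 then g i else 0) else 0)"
    unfolding step_fun_def by (intro sum.cong refl) (simp only: indicator_def iff, auto)
  then show ?thesis by (simp add: sum.delta')
qed

lemma step_fun_integral:
  fixes g :: "nat \<Rightarrow> 'b::{banach, second_countable_topology}"
  assumes n: "n > 0"
  shows "has_bochner_integral lborel (step_fun n g) ((1 / sqrt n) *\<^sub>R (\<Sum>i<n. g i))"
proof -
  have "has_bochner_integral lborel (\<lambda>x. indicator {real i / sqrt n..<(real i + 1) / sqrt n} x *\<^sub>R g i) ((1 / sqrt n) *\<^sub>R g i)" for i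
  proof -
    have "has_bochner_integral lborel (indicator {real i / sqrt n..<(real i + 1) / sqrt n} :: real \<Rightarrow> real)
        (measure lborel {real i / sqrt n..<(real i + 1) / sqrt n})"
      by (rule has_bochner_integral_real_indicator) (simp_all add: divide_right_mono)
    moreover have "measure lborel {real i / sqrt n..<(real i + 1) / sqrt n} = 1 / sqrt n"
      by (simp add: divide_right_mono add_divide_distrib)
    ultimately show ?thesis by (intro has_bochner_integral_scaleR_left) simp
  qed
  then have "has_bochner_integral lborel (step_fun n g) (\<Sum>i<n. (1 / sqrt n) *\<^sub>R g i)"
    unfolding step_fun_def[abs_def] by (intro has_bochner_integral_sum)
  then show ?thesis by (simp add: scaleR_sum_right)
qed

text \<open>The majorant is tested at every point of the cell of an index: this is the pointwise
  bound that dominated convergence asks of the step function.\<close>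

definition cell_bound :: "nat \<Rightarrow> (nat \<Rightarrow> 'b::real_normed_vector) \<Rightarrow> (real \<Rightarrow> real) \<Rightarrow> bool" where
  "cell_bound n g D \<longleftrightarrow> n > 0 \<and>
     (\<forall>i<n. \<forall>x\<ge>0. real i \<le> sqrt n * x \<longrightarrow> sqrt n * x < real i + 1 \<longrightarrow> norm (g i) \<le> D x)"

lemma norm_step_fun_le:
  assumes "cell_bound n g D" and "\<And>x. D x \<ge> 0"
  shows "norm (step_fun n g x) \<le> indicator {0..} x *\<^sub>R D x"
proof (cases "x \<ge> 0 \<and> nat \<lfloor>sqrt n * x\<rfloor> < n")
  case True
  then have "real (nat \<lfloor>sqrt n * x\<rfloor>) \<le> sqrt n * x" "sqrt n * x < real (nat \<lfloor>sqrt n * x\<rfloor>) + 1"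
    using floor_correct[of "sqrt n * x"] by (simp_all add: of_nat_nat)
  then show ?thesis using True assms by (auto simp: cell_bound_def step_fun_eq)
next
  case False
  have "n > 0" using assms(1) by (simp add: cell_bound_def)
  then have "step_fun n g x = 0" using False by (simp only: step_fun_eq if_False)
  then show ?thesis using assms(2)[of x] by (simp add: indicator_def)
qed

lemma norm_riemann_sum_le:
  fixes g :: "nat \<Rightarrow> 'b::{banach, second_countable_topology}"
  assumes D: "set_integrable lborel {0..} D" and bound: "cell_bound n g D" and D0: "\<And>x. D x \<ge> 0"
  shows "norm ((1 / sqrt n) *\<^sub>R (\<Sum>i<n. g i)) \<le> (LINT x:{0..}|lborel. D x)"
proof -
  have n: "n > 0" using bound by (simp add: cell_bound_def)
  have "integrable lborel (step_fun n g)"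
    using step_fun_integral[OF n, of g] by (simp add: has_bochner_integral_iff)
  moreover have "integrable lborel (\<lambda>x. indicator {0..} x *\<^sub>R D x)"
    using D by (simp add: set_integrable_def)
  ultimately have "norm (integral\<^sup>L lborel (step_fun n g)) \<le> (\<integral>x. indicator {0..} x *\<^sub>R D x \<partial>lborel)"
    by (rule Bochner_Integration.integral_norm_bound_integral) (rule norm_step_fun_le[OF bound D0])
  then show ?thesis
    using step_fun_integral[OF n, of g] by (simp add: has_bochner_integral_iff set_lebesgue_integral_def)
qed

lemma eventually_gt_sequentially:
  fixes n :: "nat \<Rightarrow> nat"
  assumes "filterlim n at_top sequentially"
  shows "eventually (\<lambda>N. n N > k) sequentially"
proof -
  have "eventually (\<lambda>N. n N \<ge> Suc k) sequentially"
    using assms by (simp only: filterlim_at_top)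
  then show ?thesis by eventually_elim simp
qed

text \<open>Dominated convergence for the step functions. The pointwise limit is demanded almost
  everywhere, which admits sums cut off at a moving index: at the jump itself they may fail to
  converge.\<close>

lemma riemann_sum_tendsto:
  fixes g :: "nat \<Rightarrow> nat \<Rightarrow> 'b::{banach, second_countable_topology}"
  assumes n: "filterlim n at_top sequentially"
    and D: "set_integrable lborel {0..} D" and D0: "\<And>x. D x \<ge> 0"
    and bound: "eventually (\<lambda>N. cell_bound (n N) (g N) D) sequentially"
    and lim: "AE x in lborel. x > 0 \<longrightarrow> (\<lambda>N. g N (nat \<lfloor>sqrt (real (n N)) * x\<rfloor>)) \<longlonglongrightarrow> G x"
    and G [measurable]: "G \<in> borel_measurable borel"
  shows "(\<lambda>N. (1 / sqrt (n N)) *\<^sub>R (\<Sum>i<n N. g N i)) \<longlonglongrightarrow> (LINT x:{0..}|lborel. G x)"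
proof -
  \<comment> \<open>The bound holds eventually while dominated convergence wants it for all
    \<open>N\<close>; the sequence is shifted here and shifted back by
    \<open>LIMSEQ_offset\<close>.\<close>
  obtain N0 where N0: "\<And>N. N \<ge> N0 \<Longrightarrow> cell_bound (n N) (g N) D"
    using bound by (auto simp: eventually_sequentially)
  define s where "s N = step_fun (n (N + N0)) (g (N + N0))" for N
  have pos: "n (N + N0) > 0" for N using N0[of "N + N0"] by (simp add: cell_bound_def)
  have int: "has_bochner_integral lborel (s N) ((1 / sqrt (n (N + N0))) *\<^sub>R (\<Sum>i<n (N + N0). g (N + N0) i))" for N
    unfolding s_def by (rule step_fun_integral[OF pos])
  have AE0: "AE x in lborel. x \<noteq> (0::real)" by (rule AE_lborel_singleton)
  have "(\<lambda>N. integral\<^sup>L lborel (s N)) \<longlonglongrightarrow> (\<integral>x. indicator {0..} x *\<^sub>R G x \<partial>lborel)"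
  proof (rule integral_dominated_convergence)
    show "s N \<in> borel_measurable lborel" for N
      using int[of N] by (rule borel_measurable_has_bochner_integral)
    show "integrable lborel (\<lambda>x. indicator {0..} x *\<^sub>R D x)" using D by (simp add: set_integrable_def)
    show "AE x in lborel. norm (s N x) \<le> indicator {0..} x *\<^sub>R D x" for N
      unfolding s_def by (intro AE_I2 norm_step_fun_le N0 D0) simp
    show "AE x in lborel. (\<lambda>N. s N x) \<longlonglongrightarrow> indicator {0..} x *\<^sub>R G x"
      using lim AE0
    proof eventually_elim
      case (elim x)
      show ?case
      proof (cases "x > 0")
        case True
        have "filterlim (\<lambda>N. n (N + N0)) at_top sequentially"
          by (rule filterlim_compose[OF n filterlim_add_const_nat_at_top])
        then have "eventually (\<lambda>N. n (N + N0) > nat \<lceil>x\<^sup>2\<rceil>) sequentially"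
          by (rule eventually_gt_sequentially)
        \<comment> \<open>A fixed \<open>x\<close> is eventually below \<open>sqrt n\<close>, so the
          index of its cell is in range.\<close>
        then have ev: "eventually (\<lambda>N. s N x = g (N + N0) (nat \<lfloor>sqrt (real (n (N + N0))) * x\<rfloor>)) sequentially"
        proof eventually_elim
          case (elim N)
          let ?m = "real (n (N + N0))"
          have "x\<^sup>2 < ?m" using elim by linarith
          then have "x < sqrt ?m" by (rule real_less_rsqrt)
          then have "sqrt ?m * x < sqrt ?m * sqrt ?m"
            using pos[of N] by (intro mult_strict_left_mono) auto
          then have "sqrt ?m * x < ?m" by simp
          then have "nat \<lfloor>sqrt ?m * x\<rfloor> < n (N + N0)"
            using pos[of N] by linarith
          then show ?case using True by (simp add: s_def step_fun_eq[OF pos])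
        qed
        have "(\<lambda>N. g (N + N0) (nat \<lfloor>sqrt (real (n (N + N0))) * x\<rfloor>)) \<longlonglongrightarrow> G x"
          using LIMSEQ_ignore_initial_segment[of _ _ N0] elim True by blast
        then have "(\<lambda>N. s N x) \<longlonglongrightarrow> G x"
          using ev by (simp add: tendsto_cong)
        then show ?thesis using True by simp
      next
        case False
        then have "s N x = 0" for N unfolding s_def step_fun_eq[OF pos] using elim by auto
        then show ?thesis using False elim by (simp add: indicator_def)
      qed
    qed
  qed simp
  then have "(\<lambda>N. (1 / sqrt (n (N + N0))) *\<^sub>R (\<Sum>i<n (N + N0). g (N + N0) i)) \<longlonglongrightarrow> (LINT x:{0..}|lborel. G x)"
    using int by (simp add: has_bochner_integral_iff set_lebesgue_integral_def)
  then show ?thesis by (rule LIMSEQ_offset)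
qed

lemma eventually_index_less:
  fixes i n :: "nat \<Rightarrow> nat"
  assumes n: "filterlim n at_top sequentially" and c: "c > 0"
    and i: "(\<lambda>N. real (i N) / sqrt (real (n N))) \<longlonglongrightarrow> x"
  shows "eventually (\<lambda>N. real (i N) < c * real (n N)) sequentially"
proof -
  have "filterlim (\<lambda>N. sqrt (real (n N))) at_top sequentially"
    by (intro filterlim_compose[OF sqrt_at_top] filterlim_compose[OF filterlim_real_sequentially] n)
  from tendsto_mult[OF i tendsto_inverse_0_at_top[OF this]]
  have "eventually (\<lambda>N. real (i N) / sqrt (real (n N)) * inverse (sqrt (real (n N))) < c) sequentially"
    using c by (intro order_tendstoD) auto
  then show ?thesis using eventually_gt_sequentially[OF n, of 0]
    by eventually_elim (simp add: field_simps)
qed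

text \<open>If the scaled limits differ, their order eventually decides the comparison of the
  indices; if they coincide it is undecided, hence \<open>ne\<close>.\<close>

lemma truncation_tendsto:
  fixes i j n :: "nat \<Rightarrow> nat" and f :: "nat \<Rightarrow> 'b::real_normed_vector"
  assumes n: "filterlim n at_top sequentially"
    and i: "(\<lambda>N. real (i N) / sqrt (real (n N))) \<longlonglongrightarrow> x"
    and j: "(\<lambda>N. real (j N) / sqrt (real (n N))) \<longlonglongrightarrow> y"
    and ne: "y \<noteq> x" and f: "f \<longlonglongrightarrow> l"
  shows "(\<lambda>N. if i N \<le> j N then f N else 0) \<longlonglongrightarrow> (if x \<le> y then l else 0)"
proof (cases "x < y")
  case True
  have "eventually (\<lambda>N. real (j N) / sqrt (real (n N)) - real (i N) / sqrt (real (n N)) > 0) sequentially"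
    using True by (intro order_tendstoD(1)[OF tendsto_diff[OF j i]]) simp
  then have "eventually (\<lambda>N. (if i N \<le> j N then f N else 0) = f N) sequentially"
    using eventually_gt_sequentially[OF n, of 0] by eventually_elim (auto simp: field_simps)
  then show ?thesis using f True by (simp add: tendsto_cong)
next
  case False
  have "eventually (\<lambda>N. real (j N) / sqrt (real (n N)) - real (i N) / sqrt (real (n N)) < 0) sequentially"
    using False ne by (intro order_tendstoD(2)[OF tendsto_diff[OF j i]]) simp
  then have "eventually (\<lambda>N. (if i N \<le> j N then f N else 0) = 0) sequentially"
    using eventually_gt_sequentially[OF n, of 0] by eventually_elim (auto simp: field_simps)
  then show ?thesis using False ne by (simp add: tendsto_cong)
qed

lemma floor_div_tendsto:
  assumes n: "filterlim n at_top sequentially" and "x \<ge> 0"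
  shows "(\<lambda>N. real (nat \<lfloor>sqrt (real (n N)) * x\<rfloor>) / sqrt (real (n N))) \<longlonglongrightarrow> x"
proof (rule real_tendsto_sandwich)
  have s: "filterlim (\<lambda>N. sqrt (real (n N))) at_top sequentially"
    by (intro filterlim_compose[OF sqrt_at_top] filterlim_compose[OF filterlim_real_sequentially] n)
  have "((\<lambda>N. 1 / sqrt (real (n N))) \<longlongrightarrow> 0) sequentially"
    using tendsto_inverse_0_at_top[OF s] by (simp add: inverse_eq_divide)
  from tendsto_diff[OF tendsto_const this, of x]
  show "(\<lambda>N. x - 1 / sqrt (real (n N))) \<longlonglongrightarrow> x" by simp
  have ev: "eventually (\<lambda>N. sqrt (real (n N)) > 0) sequentially"
    using eventually_gt_sequentially[OF n, of 0] by eventually_elim simp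
  show "\<forall>\<^sub>F N in sequentially. x - 1 / sqrt (real (n N)) \<le> real (nat \<lfloor>sqrt (real (n N)) * x\<rfloor>) / sqrt (real (n N))"
    using ev
  proof eventually_elim
    case (elim N)
    have "sqrt (real (n N)) * x - 1 \<le> real (nat \<lfloor>sqrt (real (n N)) * x\<rfloor>)" by linarith
    then have "(sqrt (real (n N)) * x - 1) / sqrt (real (n N)) \<le> real (nat \<lfloor>sqrt (real (n N)) * x\<rfloor>) / sqrt (real (n N))"
      using elim by (intro divide_right_mono) auto
    moreover have "(sqrt (real (n N)) * x - 1) / sqrt (real (n N)) = x - 1 / sqrt (real (n N))"
      using elim by (simp add: diff_divide_distrib)
    ultimately show ?case by simp
  qed
  show "\<forall>\<^sub>F N in sequentially. real (nat \<lfloor>sqrt (real (n N)) * x\<rfloor>) / sqrt (real (n N)) \<le> x"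
    using ev
  proof eventually_elim
    case (elim N)
    have "real (nat \<lfloor>sqrt (real (n N)) * x\<rfloor>) \<le> sqrt (real (n N)) * x"
      using assms elim by (simp add: of_nat_nat)
    then show ?case using elim by (simp add: field_simps)
  qed
qed simp

section \<open>Gaussian limit of falling products\<close>

lemma gaussian_integrable: "integrable lborel (\<lambda>x::real. exp (- x\<^sup>2 / 2 + c * x))"
proof -
  have "integrable lborel (\<lambda>x. (exp (c\<^sup>2 / 2) * sqrt (2 * pi)) * normal_density c 1 x)"
    by (intro integrable_mult_right integrable_normal_density) simp
  also have "(\<lambda>x. (exp (c\<^sup>2 / 2) * sqrt (2 * pi)) * normal_density c 1 x) = (\<lambda>x. exp (- x\<^sup>2 / 2 + c * x))"
    by (auto simp: normal_density_def exp_add[symmetric] power2_eq_square field_simps)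
  finally show ?thesis .
qed

text \<open>The quotient of a weight \<open>i\<close> steps below the centre by the central one. The
  shift is \<open>s = 1\<close> for Poisson weights and for the even degrees, and
  \<open>s = 1 / 2\<close> for the odd degrees.\<close>

definition falling :: "real \<Rightarrow> nat \<Rightarrow> nat \<Rightarrow> real" where
  "falling s N i = (\<Prod>j<i. 1 - (real j + s) / real N)"

lemma falling_nonneg: "i \<le> N \<Longrightarrow> s \<le> 1 \<Longrightarrow> falling s N i \<ge> 0"
  unfolding falling_def by (intro prod_nonneg) (auto simp: divide_le_eq_1)

lemma sum_lessThan_real: "(\<Sum>j<i. real j) = real i * (real i - 1) / 2"
  by (induction i) (auto simp: field_simps)

lemma falling_le:
  assumes "i \<le> N" "0 \<le> s" "s \<le> 1"
  shows "falling s N i \<le> exp (- (real i * (real i - 1) / (2 * real N)))"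
proof -
  have "falling s N i \<le> (\<Prod>j<i. exp (- (real j / real N)))"
    unfolding falling_def
  proof (rule prod_mono, safe)
    fix j assume "j < i"
    then show "0 \<le> 1 - (real j + s) / real N" using assms by (auto simp: divide_le_eq_1)
    have "1 - (real j + s) / real N \<le> 1 + (- (real j / real N))"
      using assms by (simp add: add_divide_distrib)
    also have "\<dots> \<le> exp (- (real j / real N))" by (rule exp_ge_add_one_self)
    finally show "1 - (real j + s) / real N \<le> exp (- (real j / real N))" .
  qed
  also have "\<dots> = exp (- ((\<Sum>j<i. real j) / real N))"
    by (simp add: exp_sum[symmetric] sum_negf sum_divide_distrib)
  finally show ?thesis by (simp add: sum_lessThan_real)
qed

text \<open>A Gaussian majorant independent of \<open>N\<close>. Passing from the index to a point
  of its cell costs an error of one index, hence a term linear in \<open>x\<close> in the exponent;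
  its coefficient \<open>3 / 2\<close> is rounded up to 2.\<close>

lemma falling_cell_bound:
  assumes "i < N" "0 \<le> s" "s \<le> 1" "x \<ge> 0" "real i \<le> sqrt N * x" "sqrt N * x < real i + 1"
  shows "falling s N i \<le> exp (- x\<^sup>2 / 2 + 2 * x)"
proof -
  define r where "r = sqrt (real N)"
  have N: "real N \<ge> 1" and r: "r \<ge> 1" using assms by (auto simp: r_def)
  have rr: "r * r = real N" by (simp add: r_def)
  note assms = assms(1-4) assms(5,6)[folded r_def]
  \<comment> \<open>For \<open>r * x < 1\<close> squaring \<open>r * x - 1 < i\<close> would be of
    no use, but then the cell forces \<open>i = 0\<close>.\<close>
  have "real i * (real i - 1) \<ge> real N * x\<^sup>2 - 3 * r * x"
  proof (cases "r * x \<ge> 1")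
    case True
    have "(r * x - 1)\<^sup>2 \<le> (real i)\<^sup>2" using True assms by (intro power_mono) auto
    moreover have "(r * x - 1)\<^sup>2 = real N * x\<^sup>2 - 2 * r * x + 1"
      using rr by (simp add: power2_eq_square algebra_simps)
    moreover have "real i * (real i - 1) = (real i)\<^sup>2 - real i"
      by (simp add: power2_eq_square algebra_simps)
    moreover have "real N * x\<^sup>2 - 3 * r * x = (real N * x\<^sup>2 - 2 * r * x) - r * x" by simp
    ultimately show ?thesis using assms by linarith
  next
    case False
    then have "(r * x) * (r * x) \<le> 1 * (r * x)" using assms by (intro mult_right_mono) auto
    moreover have "(r * x) * (r * x) = real N * x\<^sup>2" using rr by (simp add: power2_eq_square algebra_simps)
    moreover have "real i = 0" using False assms by simp
    moreover have "r * x \<ge> 0" using assms by simp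
    ultimately show ?thesis by simp
  qed
  then have "real i * (real i - 1) / (2 * real N) \<ge> (real N * x\<^sup>2 - 3 * r * x) / (2 * real N)"
    by (rule divide_right_mono) simp
  also have "(real N * x\<^sup>2 - 3 * r * x) / (2 * real N) = x\<^sup>2 / 2 - 3 / 2 * (x / r)"
    unfolding rr[symmetric] using r by (simp add: field_simps power2_eq_square)
  finally have *: "x\<^sup>2 / 2 - 3 / 2 * (x / r) \<le> real i * (real i - 1) / (2 * real N)" .
  have "x / r \<le> x" using frac_le[of x x 1 r] r assms by simp
  then have "- (real i * (real i - 1) / (2 * real N)) \<le> - x\<^sup>2 / 2 + 2 * x" using * assms by simp
  then have "exp (- (real i * (real i - 1) / (2 * real N))) \<le> exp (- x\<^sup>2 / 2 + 2 * x)" by simp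
  moreover have "falling s N i \<le> exp (- (real i * (real i - 1) / (2 * real N)))"
    using assms by (intro falling_le) auto
  ultimately show ?thesis by linarith
qed

text \<open>From \<open>ln (1 - u) \<ge> - u - 2 * u^2\<close> for \<open>u \<le> 1 / 2\<close>,
  whence the assumption \<open>2 * i \<le> N\<close>. The quadratic terms add up to at most
  \<open>2 * i^3 / N^2\<close>, which vanishes in the limit when \<open>i\<close> is of order
  \<open>sqrt N\<close>.\<close>

lemma falling_ge:
  assumes "2 * i \<le> N" "0 \<le> s" "s \<le> 1"
  shows "falling s N i \<ge> exp (- (real i * (real i + 1) / (2 * real N)) - 2 * real i ^ 3 / (real N)\<^sup>2)"
proof -
  have "(\<Prod>j<i. exp (- ((real j + 1) / real N) - 2 * (real i / real N)\<^sup>2)) \<le> falling s N i"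
    unfolding falling_def
  proof (rule prod_mono, safe)
    fix j assume j: "j < i"
    let ?u = "(real j + s) / real N"
    have ui: "?u \<le> real i / real N" using j assms by (intro divide_right_mono) auto
    have u0: "0 \<le> ?u" using assms by simp
    have "real i / real N \<le> 1 / 2" using assms j by (simp add: field_simps)
    then have u: "?u \<le> 1 / 2" using ui by linarith
    have "- ?u - 2 * ?u\<^sup>2 \<le> ln (1 - ?u)" by (rule ln_one_minus_pos_lower_bound[OF u0 u])
    moreover have "1 - ?u > 0" using u by linarith
    ultimately have "exp (- ?u - 2 * ?u\<^sup>2) \<le> 1 - ?u" by (simp only: ln_ge_iff)
    have "- ((real j + 1) / real N) - 2 * (real i / real N)\<^sup>2 \<le> - ?u - 2 * ?u\<^sup>2"
    proof -
      have "?u\<^sup>2 \<le> (real i / real N)\<^sup>2" using ui u0 by (rule power_mono)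
      moreover have "?u \<le> (real j + 1) / real N" using assms by (intro divide_right_mono) auto
      ultimately show ?thesis by linarith
    qed
    show "exp (- ((real j + 1) / real N) - 2 * (real i / real N)\<^sup>2) \<le> 1 - ?u"
    proof -
      have "exp (- ((real j + 1) / real N) - 2 * (real i / real N)\<^sup>2) \<le> exp (- ?u - 2 * ?u\<^sup>2)"
        using \<open>- ((real j + 1) / real N) - 2 * (real i / real N)\<^sup>2 \<le> - ?u - 2 * ?u\<^sup>2\<close> by simp
      then show ?thesis using \<open>exp (- ?u - 2 * ?u\<^sup>2) \<le> 1 - ?u\<close> by linarith
    qed
  qed auto
  also have "(\<Prod>j<i. exp (- ((real j + 1) / real N) - 2 * (real i / real N)\<^sup>2)) =
      exp (- ((\<Sum>j<i. real j) + real i) / real N - real i * (2 * (real i / real N)\<^sup>2))"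
    by (simp add: exp_sum[symmetric] sum_subtractf sum_negf sum_divide_distrib[symmetric] sum.distrib)
       (simp add: add_divide_distrib diff_divide_distrib)
  also have "- ((\<Sum>j<i. real j) + real i) / real N - real i * (2 * (real i / real N)\<^sup>2) =
      - (real i * (real i + 1) / (2 * real N)) - 2 * real i ^ 3 / (real N)\<^sup>2"
    by (simp add: sum_lessThan_real power_divide power3_eq_cube power2_eq_square)
       (simp add: field_simps, simp add: diff_divide_distrib add_divide_distrib)
  finally show ?thesis .
qed

lemma falling_tendsto:
  assumes n: "filterlim n at_top sequentially" and s: "0 \<le> s" "s \<le> 1"
    and i: "(\<lambda>N. real (i N) / sqrt (real (n N))) \<longlonglongrightarrow> x"
  shows "(\<lambda>N. falling s (n N) (i N)) \<longlonglongrightarrow> exp (- x\<^sup>2 / 2)"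
proof -
  define y where "y N = real (i N) / sqrt (real (n N))" for N
  define r where "r N = 1 / sqrt (real (n N))" for N
  have y: "y \<longlonglongrightarrow> x" using i by (simp add: y_def[abs_def])
  have sq: "filterlim (\<lambda>N. sqrt (real (n N))) at_top sequentially"
    by (intro filterlim_compose[OF sqrt_at_top] filterlim_compose[OF filterlim_real_sequentially] n)
  have r: "r \<longlonglongrightarrow> 0" using tendsto_inverse_0_at_top[OF sq] by (simp add: r_def[abs_def] inverse_eq_divide)
  have pos: "eventually (\<lambda>N. n N > 0) sequentially" by (rule eventually_gt_sequentially[OF n])
  have small: "eventually (\<lambda>N. 2 * i N \<le> n N) sequentially"
    using eventually_index_less[OF n _ i, of "1 / 2"] by (rule eventually_mono) auto
  have l: "(\<lambda>N. exp (- ((y N)\<^sup>2 + y N * r N) / 2 - 2 * (y N) ^ 3 * r N)) \<longlonglongrightarrow> exp (- (x\<^sup>2 + x * 0) / 2 - 2 * x ^ 3 * 0)"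
    by (intro tendsto_intros y r) auto
  have u: "(\<lambda>N. exp (- ((y N)\<^sup>2 - y N * r N) / 2)) \<longlonglongrightarrow> exp (- (x\<^sup>2 - x * 0) / 2)"
    by (intro tendsto_intros y r) auto
  show ?thesis
  proof (rule real_tendsto_sandwich)
    show "(\<lambda>N. exp (- ((y N)\<^sup>2 + y N * r N) / 2 - 2 * (y N) ^ 3 * r N)) \<longlonglongrightarrow> exp (- x\<^sup>2 / 2)" using l by simp
    show "(\<lambda>N. exp (- ((y N)\<^sup>2 - y N * r N) / 2)) \<longlonglongrightarrow> exp (- x\<^sup>2 / 2)" using u by simp
    show "\<forall>\<^sub>F N in sequentially. exp (- ((y N)\<^sup>2 + y N * r N) / 2 - 2 * (y N) ^ 3 * r N) \<le> falling s (n N) (i N)"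
      using small pos
    proof eventually_elim
      case (elim N)
      define q where "q = sqrt (real (n N))"
      have q: "q > 0" and iq: "real (i N) = y N * q" and nq: "real (n N) = q\<^sup>2"
        using elim by (simp_all add: q_def y_def)
      have "- (real (i N) * (real (i N) + 1) / (2 * real (n N))) - 2 * real (i N) ^ 3 / (real (n N))\<^sup>2 =
         - ((y N)\<^sup>2 + y N * r N) / 2 - 2 * (y N) ^ 3 * r N"
        unfolding iq nq r_def q_def[symmetric] using q
        by (simp add: power2_eq_square power3_eq_cube field_simps)
      then show ?case using falling_ge[OF elim(1) s] by simp
    qed
    show "\<forall>\<^sub>F N in sequentially. falling s (n N) (i N) \<le> exp (- ((y N)\<^sup>2 - y N * r N) / 2)"
      using small pos
    proof eventually_elim
      case (elim N)
      define q where "q = sqrt (real (n N))"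
      have q: "q > 0" and iq: "real (i N) = y N * q" and nq: "real (n N) = q\<^sup>2"
        using elim by (simp_all add: q_def y_def)
      have e: "- (real (i N) * (real (i N) - 1) / (2 * real (n N))) = - ((y N)\<^sup>2 - y N * r N) / 2"
        unfolding iq nq r_def q_def[symmetric] using q
        by (simp add: power2_eq_square field_simps)
      have "i N \<le> n N" using elim by simp
      from falling_le[OF this s] show ?case unfolding e .
    qed
  qed
qed


subsection \<open>Stirling's formula and Poisson tails\<close>

text \<open>Logarithm of Stirling's expression, without its constant, over the factorial. It is
  monotone and bounded, so it converges before the limit is known.\<close>

definition ln_stirling :: "nat \<Rightarrow> real" where
  "ln_stirling M = ln M / 2 - M + M * ln M - ln (fact M)"

lemma exp_ln_stirling:
  assumes "M > 0"
  shows "exp (ln_stirling M) = sqrt M * (exp (- real M) * real M ^ M / fact M)"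
proof -
  have "ln_stirling M = ln (sqrt M * (exp (- real M) * real M ^ M / fact M))"
    using assms by (simp add: ln_stirling_def ln_mult ln_div ln_sqrt ln_realpow)
  then show ?thesis using assms by simp
qed

text \<open>The increment is governed by \<open>ln (M + 1) - ln M\<close>, the integral of
  \<open>1 / x\<close> over a unit interval. The midpoint rule underestimates it, which gives
  monotonicity; the trapezoidal rule overestimates it, with an excess that telescopes.\<close>

lemma ln_stirling_Suc:
  assumes "M > 0"
  shows "ln_stirling M \<le> ln_stirling (Suc M)"
    and "ln_stirling (Suc M) \<le> ln_stirling M + (1 / real M - 1 / real (Suc M)) / 4"
proof -
  have "ln (fact (Suc M) :: real) = ln (real M + 1) + ln (fact M)"
    using assms by (simp add: ln_mult add.commute)
  then have e: "ln_stirling (Suc M) - ln_stirling M = (real M + 1 / 2) * (ln (real M + 1) - ln (real M)) - 1"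
    by (simp add: ln_stirling_def field_simps)
  have "2 / (2 * real M + 1) \<le> ln (real M + 1) - ln (real M)"
    using ln_inverse_approx_ge[of "real M" "real M + 1"] assms by simp
  then have "(real M + 1 / 2) * (2 / (2 * real M + 1)) \<le> (real M + 1 / 2) * (ln (real M + 1) - ln (real M))"
    by (intro mult_left_mono) auto
  moreover have "(real M + 1 / 2) * (2 / (2 * real M + 1)) = 1" by (simp add: field_simps)
  ultimately show "ln_stirling M \<le> ln_stirling (Suc M)" using e by linarith
  have "ln (real M + 1) - ln (real M) \<le> (inverse (real M) + inverse (real M + 1)) / 2"
    using ln_inverse_approx_le[of "real M" 1] assms by simp
  then have "(real M + 1 / 2) * (ln (real M + 1) - ln (real M)) \<le> (real M + 1 / 2) * ((inverse (real M) + inverse (real M + 1)) / 2)"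
    by (intro mult_left_mono) auto
  also have "\<dots> = 1 + (1 / real M - 1 / real (Suc M)) / 4"
  proof -
    define q where "q = real M * (real M + 1)"
    have q: "q > 0" using assms by (simp add: q_def)
    have e: "inverse (real M) + inverse (real M + 1) = (2 * real M + 1) / q"
      "1 / real M - 1 / real (Suc M) = 1 / q"
      using assms by (simp_all add: q_def field_simps)
    have "(real M + 1 / 2) * ((2 * real M + 1) / q / 2) = ((real M + 1 / 2) * (2 * real M + 1)) / (2 * q)"
      by simp
    also have "(real M + 1 / 2) * (2 * real M + 1) = 2 * q + 1 / 2"
      by (simp add: q_def algebra_simps)
    also have "(2 * q + 1 / 2) / (2 * q) = 1 + 1 / q / 4" using q by (simp add: field_simps)
    finally show ?thesis unfolding e .
  qed
  finally show "ln_stirling (Suc M) \<le> ln_stirling M + (1 / real M - 1 / real (Suc M)) / 4" using e by linarith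
qed

lemma ln_stirling_convergent: "\<exists>l. ln_stirling \<longlonglongrightarrow> l"
proof -
  have "ln_stirling (Suc n) \<le> ln_stirling 1 + (1 - 1 / real (Suc n)) / 4" for n
  proof (induction n)
    case (Suc n)
    have "ln_stirling (Suc (Suc n)) \<le> ln_stirling (Suc n) + (1 / real (Suc n) - 1 / real (Suc (Suc n))) / 4"
      by (rule ln_stirling_Suc) simp
    then show ?case using Suc by argo
  qed simp
  moreover have "(1 - 1 / real (Suc n)) / 4 \<le> 1 / 4" for n by simp
  ultimately have "ln_stirling (Suc n) \<le> ln_stirling 1 + 1 / 4" for n by (meson add_left_mono order_trans)
  moreover have "incseq (\<lambda>n. ln_stirling (Suc n))"
    by (intro incseq_SucI ln_stirling_Suc) simp
  ultimately obtain l where "(\<lambda>n. ln_stirling (Suc n)) \<longlonglongrightarrow> l"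
    using incseq_convergent by blast
  then show ?thesis using LIMSEQ_imp_Suc by blast
qed

text \<open>The closed form contains the central binomial coefficient divided by
  \<open>4 ^ n\<close>, which is what a quotient of Stirling expressions at \<open>n\<close> and
  \<open>2 * n\<close> produces.\<close>

lemma wallis_product:
  "(\<Prod>k=1..n. (4 * real k ^ 2) / (4 * real k ^ 2 - 1)) =
     1 / ((fact (2 * n) / (4 ^ n * (fact n)\<^sup>2))\<^sup>2 * (2 * real n + 1))"
proof (induction n)
  case (Suc n)
  have pos: "4 * (1 + real n)\<^sup>2 - 1 = (1 + 2 * real n) * (3 + 2 * real n)"
    by (simp add: power2_eq_square algebra_simps)
  have f: "fact (2 * Suc n) = (2 * real n + 2) * ((2 * real n + 1) * fact (2 * n))"
    by (simp add: algebra_simps)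
  define c where "c = (fact (2 * n) / (4 ^ n * (fact n)\<^sup>2) :: real)"
  have c: "c \<noteq> 0" by (simp add: c_def)
  have "fact (2 * Suc n) / (4 ^ Suc n * (fact (Suc n))\<^sup>2) = c * ((2 * real n + 1) / (2 * (real n + 1)))"
    unfolding f c_def fact_Suc of_nat_mult power_Suc power_mult_distrib
    by (simp add: power2_eq_square divide_simps) (simp add: algebra_simps)
  then have "1 / ((fact (2 * Suc n) / (4 ^ Suc n * (fact (Suc n))\<^sup>2))\<^sup>2 * (2 * real (Suc n) + 1)) =
      1 / ((c * ((2 * real n + 1) / (2 * (real n + 1))))\<^sup>2 * (2 * real n + 3))" by (simp add: add.commute)
  also have "\<dots> = 1 / (c\<^sup>2 * (2 * real n + 1)) * ((4 * (real n + 1)\<^sup>2) / ((2 * real n + 1) * (2 * real n + 3)))"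
    using c by (simp add: power_mult_distrib power_divide divide_simps add_eq_0_iff)
      (simp add: power2_eq_square algebra_simps)
  finally show ?case using Suc.IH by (simp add: pos c_def add.commute)
qed simp

text \<open>The unknown limit \<open>exp l\<close> is also the limit of
  \<open>(S n)^2 / S (2 * n)\<close>. That quotient reduces to a power of \<open>n\<close> times the
  central binomial coefficient over \<open>4 ^ n\<close>, so Wallis' product identifies the
  constant.\<close>

lemma stirling: "(\<lambda>M. sqrt M * (exp (- real M) * real M ^ M / fact M)) \<longlonglongrightarrow> 1 / sqrt (2 * pi)"
proof -
  obtain l where l: "ln_stirling \<longlonglongrightarrow> l" using ln_stirling_convergent by blast
  define S where "S M = exp (ln_stirling M)" for M
  have S: "S \<longlonglongrightarrow> exp l" unfolding S_def by (intro tendsto_intros l)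
  have S2: "(\<lambda>n. S (2 * n)) \<longlonglongrightarrow> exp l"
    using LIMSEQ_subseq_LIMSEQ[OF S, of "\<lambda>n. 2 * n"] by (simp add: strict_mono_def comp_def)
  have "(\<lambda>n. ((S n)\<^sup>2 / S (2 * n))\<^sup>2) \<longlonglongrightarrow> ((exp l)\<^sup>2 / exp l)\<^sup>2"
    by (intro tendsto_intros S S2) simp
  moreover have "eventually (\<lambda>n. ((S n)\<^sup>2 / S (2 * n))\<^sup>2 =
      (real n / (2 * (2 * real n + 1))) / (\<Prod>k=1..n. (4 * real k ^ 2) / (4 * real k ^ 2 - 1))) sequentially"
    using eventually_gt_at_top[of 0]
  proof eventually_elim
    case (elim n)
    define c where "c = (fact (2 * n) / (4 ^ n * (fact n)\<^sup>2) :: real)"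
    define P where "P = exp (- (2 * real n)) * real n ^ (2 * n)"
    have "(S n)\<^sup>2 = real n * (P / (fact n)\<^sup>2)"
      using elim unfolding S_def exp_ln_stirling[OF elim]
      by (simp add: P_def power_mult_distrib power_divide exp_double[symmetric] power_mult[symmetric] mult.commute[of 2])
    moreover have "S (2 * n) = (sqrt 2 * sqrt n) * (4 ^ n * P / fact (2 * n))"
      using elim exp_ln_stirling[of "2 * n"]
      by (simp add: P_def S_def real_sqrt_mult power_mult_distrib power_mult)
    moreover have "(x * (P / f\<^sup>2)) / (a * (q * P / F)) = x / a * (F / (q * f\<^sup>2))"
      if "f \<noteq> 0" "a \<noteq> 0" "q \<noteq> 0" "F \<noteq> 0" for x f a q F :: real
      using that elim by (simp add: P_def field_simps)
    ultimately have "(S n)\<^sup>2 / S (2 * n) = real n / (sqrt 2 * sqrt n) * c"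
      using elim by (simp add: c_def)
    then have "((S n)\<^sup>2 / S (2 * n))\<^sup>2 = (real n / 2) * c\<^sup>2"
      using elim by (simp add: power_mult_distrib power_divide) (simp add: power2_eq_square)
    moreover have "c \<noteq> 0" by (simp add: c_def)
    moreover define d where "d = 2 * real n + 1"
    moreover have "d > 0" by (simp add: d_def)
    ultimately show ?case unfolding wallis_product c_def[symmetric] d_def[symmetric] by simp
  qed
  ultimately have "(\<lambda>n. (real n / (2 * (2 * real n + 1))) / (\<Prod>k=1..n. (4 * real k ^ 2) / (4 * real k ^ 2 - 1))) \<longlonglongrightarrow> ((exp l)\<^sup>2 / exp l)\<^sup>2"
    by (simp add: tendsto_cong)
  moreover have "(\<lambda>n. (real n / (2 * (2 * real n + 1))) / (\<Prod>k=1..n. (4 * real k ^ 2) / (4 * real k ^ 2 - 1))) \<longlonglongrightarrow> (1 / 4) / (pi / 2)"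
  proof (rule tendsto_divide[OF _ wallis])
    show "(\<lambda>n. real n / (2 * (2 * real n + 1))) \<longlonglongrightarrow> 1 / 4" by real_asymp
  qed simp
  ultimately have "((exp l)\<^sup>2 / exp l)\<^sup>2 = (1 / 4) / (pi / 2)" by (rule LIMSEQ_unique)
  then have "(exp l)\<^sup>2 = 1 / (2 * pi)" by (simp add: power2_eq_square)
  then have "sqrt ((exp l)\<^sup>2) = sqrt (1 / (2 * pi))" by (rule arg_cong)
  then have "exp l = 1 / sqrt (2 * pi)" by (simp add: real_sqrt_divide)
  moreover have "eventually (\<lambda>M. S M = sqrt M * (exp (- real M) * real M ^ M / fact M)) sequentially"
    using eventually_gt_at_top[of 0] by eventually_elim (simp add: S_def exp_ln_stirling)
  ultimately show ?thesis using S by (simp add: tendsto_cong)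
qed

section \<open>Poisson weights and tails\<close>

definition poisson_weight :: "nat \<Rightarrow> nat \<Rightarrow> real" where
  "poisson_weight M j = exp (- real M) * real M ^ j / fact j"

text \<open>The probability that a Poisson variable of mean \<open>M\<close> strictly exceeds
  \<open>a\<close>. The finite complement is the form in which it comes out of the incomplete gamma
  integral and in which its limit is taken.\<close>

definition poisson_tail :: "nat \<Rightarrow> nat \<Rightarrow> real" where
  "poisson_tail M a = 1 - (\<Sum>j\<le>a. poisson_weight M j)"

lemma poisson_weight_pos: "M > 0 \<Longrightarrow> poisson_weight M j > 0"
  by (simp add: poisson_weight_def)

lemma poisson_weight_Suc: "poisson_weight M (Suc j) = poisson_weight M j * (real M / real (Suc j))"
  by (simp add: poisson_weight_def field_simps)

lemma poisson_tail_sums: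
  "(\<lambda>j. poisson_weight M (j + Suc a)) sums poisson_tail M a"
proof -
  have "(\<lambda>j. exp (- real M) * (real M ^ j /\<^sub>R fact j)) sums (exp (- real M) * exp (real M))"
    by (intro sums_mult exp_converges)
  then have "poisson_weight M sums 1"
    by (simp add: poisson_weight_def[abs_def] exp_add[symmetric] divide_inverse mult_ac)
  then have "(\<lambda>j. poisson_weight M (j + Suc a)) sums (1 - (\<Sum>j<Suc a. poisson_weight M j))"
    by (subst sums_iff_shift) simp
  then show ?thesis by (simp add: poisson_tail_def lessThan_Suc_atMost)
qed

lemma poisson_tail_pos: "M > 0 \<Longrightarrow> poisson_tail M a > 0"
  using poisson_tail_sums[of M a] suminf_pos[of "\<lambda>j. poisson_weight M (j + Suc a)"] poisson_weight_pos
  by (metis sums_iff)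

lemma poisson_tail_Suc: "poisson_tail M a = poisson_weight M (Suc a) + poisson_tail M (Suc a)"
  by (simp add: poisson_tail_def)

lemma poisson_tail_le_1: "poisson_tail M a \<le> 1"
  unfolding poisson_tail_def by (simp add: sum_nonneg poisson_weight_def)

lemma poisson_tail_antimono: "a \<le> b \<Longrightarrow> poisson_tail M b \<le> poisson_tail M a"
  unfolding poisson_tail_def by (intro diff_left_mono sum_mono2) (auto simp: poisson_weight_def)

text \<open>Splitting one term off a tail reduces the claim to
  \<open>p (a + 1) * P (a + 2) \<le> p (a + 2) * P (a + 1)\<close> for the weights \<open>p\<close>
  and the tails \<open>P\<close>. This holds term by term, since the ratio
  \<open>M / (j + 1)\<close> of consecutive weights decreases.\<close>

lemma poisson_tail_log_concave:
  assumes M: "M > 0"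
  shows "poisson_tail M a * poisson_tail M (Suc (Suc a)) \<le> (poisson_tail M (Suc a))\<^sup>2"
proof -
  let ?p = "poisson_weight M" and ?P = "poisson_tail M"
  have "?p (Suc a) * ?P (Suc (Suc a)) \<le> ?p (Suc (Suc a)) * ?P (Suc a)"
  proof (rule sums_le)
    show "(\<lambda>j. ?p (Suc a) * ?p (j + Suc (Suc (Suc a)))) sums (?p (Suc a) * ?P (Suc (Suc a)))"
      "(\<lambda>j. ?p (Suc (Suc a)) * ?p (j + Suc (Suc a))) sums (?p (Suc (Suc a)) * ?P (Suc a))"
      by (intro sums_mult poisson_tail_sums)+
    fix j
    have "?p (j + Suc (Suc (Suc a))) = ?p (j + Suc (Suc a)) * (real M / real (Suc (j + Suc (Suc a))))"
      unfolding add_Suc_right[of j "Suc (Suc a)"] by (rule poisson_weight_Suc)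
    then have "?p (Suc a) * ?p (j + Suc (Suc (Suc a))) = ?p (Suc a) * ?p (j + Suc (Suc a)) * (real M / real (Suc (j + Suc (Suc a))))"
      by (simp only: mult.assoc)
    also have "\<dots> \<le> ?p (Suc a) * ?p (j + Suc (Suc a)) * (real M / real (Suc (Suc a)))"
      by (intro mult_left_mono divide_left_mono) (auto simp: poisson_weight_def)
    also have "\<dots> = ?p (Suc (Suc a)) * ?p (j + Suc (Suc a))"
      by (simp add: poisson_weight_Suc[of M "Suc a"])
    finally show "?p (Suc a) * ?p (j + Suc (Suc (Suc a))) \<le> ?p (Suc (Suc a)) * ?p (j + Suc (Suc a))" .
  qed
  moreover have "?P a * ?P (Suc (Suc a)) = ?p (Suc a) * ?P (Suc (Suc a)) + ?P (Suc a) * ?P (Suc (Suc a))"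
    by (subst poisson_tail_Suc[of M a]) (simp add: algebra_simps)
  moreover have "(?P (Suc a))\<^sup>2 = ?p (Suc (Suc a)) * ?P (Suc a) + ?P (Suc a) * ?P (Suc (Suc a))"
    unfolding power2_eq_square by (subst poisson_tail_Suc[of M "Suc a"]) (simp add: algebra_simps)
  ultimately show ?thesis by linarith
qed

lemma poisson_weight_falling:
  assumes "m < M"
  shows "poisson_weight M (M - 1 - m) = poisson_weight M M * falling 1 M m"
  using assms
proof (induction m)
  case 0
  then obtain k where "M = Suc k" by (cases M) auto
  then show ?case by (simp add: poisson_weight_Suc falling_def)
next
  case (Suc m)
  define j where "j = M - 1 - Suc m"
  have j: "M - 1 - m = Suc j" and rj: "real (Suc j) = real M - (real m + 1)"
    using Suc.prems by (auto simp: j_def of_nat_diff)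
  have "poisson_weight M j = poisson_weight M (Suc j) * (real (Suc j) / real M)"
    using Suc.prems by (simp add: poisson_weight_Suc)
  also have "\<dots> = poisson_weight M M * falling 1 M m * (1 - (real m + 1) / real M)"
    using Suc.IH Suc.prems unfolding j rj by (simp add: diff_divide_distrib)
  finally show ?case by (simp add: falling_def j_def)
qed

text \<open>The complement is summed downwards from the mean, where a weight is the central one
  times a falling product. The distance \<open>r\<close> below the mean becomes the lower cut-off of
  a Riemann sum.\<close>

lemma poisson_tail_eq:
  assumes "r < M"
  shows "poisson_tail M (M - 1 - r) =
    1 - sqrt M * poisson_weight M M * ((1 / sqrt M) *\<^sub>R (\<Sum>m<M. if r \<le> m then falling 1 M m else 0))"
proof -
  have "(\<Sum>j\<le>M - 1 - r. poisson_weight M j) = (\<Sum>m\<in>{r..<M}. poisson_weight M (M - 1 - m))"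
    by (rule sum.reindex_bij_witness[where i = "\<lambda>m. M - 1 - m" and j = "\<lambda>j. M - 1 - j"]) (use assms in auto)
  also have "\<dots> = (\<Sum>m\<in>{r..<M}. poisson_weight M M * falling 1 M m)"
    by (rule sum.cong[OF refl]) (rule poisson_weight_falling, simp)
  also have "\<dots> = poisson_weight M M * (\<Sum>m<M. if r \<le> m then falling 1 M m else 0)"
    unfolding sum_distrib_left[symmetric]
    by (intro arg_cong2[where f = "(*)"] refl sum.mono_neutral_cong_left) auto
  finally show ?thesis using assms by (simp add: poisson_tail_def)
qed

lemma set_integrable_gaussian: "set_integrable lborel {0..} (\<lambda>x::real. C * exp (- x\<^sup>2 / 2 + c * x))"
  unfolding set_integrable_def
  by (intro integrable_mult_indicator[unfolded real_scaleR_def] integrable_mult_right gaussian_integrable) simp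

text \<open>A summed local limit theorem: Stirling's formula gives the central weight, the falling
  products give the Gaussian profile, and the cut-off tends to \<open>y\<close>.\<close>

lemma poisson_tail_tendsto:
  assumes n: "filterlim n at_top sequentially"
    and r: "(\<lambda>N. real (r N) / sqrt (real (n N))) \<longlonglongrightarrow> y" and y: "y \<ge> 0"
  shows "(\<lambda>N. poisson_tail (n N) (n N - 1 - r N)) \<longlonglongrightarrow>
    1 - 1 / sqrt (2 * pi) * (LINT x:{0..}|lborel. if y \<le> x then exp (- x\<^sup>2 / 2) else 0)"
proof -
  have pos: "eventually (\<lambda>N. n N > 0) sequentially" by (rule eventually_gt_sequentially[OF n])
  have R: "(\<lambda>N. (1 / sqrt (n N)) *\<^sub>R (\<Sum>m<n N. if r N \<le> m then falling 1 (n N) m else 0)) \<longlonglongrightarrow>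
      (LINT x:{0..}|lborel. if y \<le> x then exp (- x\<^sup>2 / 2) else 0)"
  proof (rule riemann_sum_tendsto[OF n set_integrable_gaussian[of 1 2]])
    show "eventually (\<lambda>N. cell_bound (n N) (\<lambda>m. if r N \<le> m then falling 1 (n N) m else 0) (\<lambda>x. 1 * exp (- x\<^sup>2 / 2 + 2 * x))) sequentially"
      using pos
    proof eventually_elim
      case (elim N)
      show ?case
        unfolding cell_bound_def using elim falling_cell_bound[of _ "n N" 1] falling_nonneg[of _ "n N" 1]
        by (auto simp: abs_of_nonneg)
    qed
    show "AE x in lborel. 0 < x \<longrightarrow> (\<lambda>N. if r N \<le> nat \<lfloor>sqrt (real (n N)) * x\<rfloor>
            then falling 1 (n N) (nat \<lfloor>sqrt (real (n N)) * x\<rfloor>) else 0) \<longlonglongrightarrow> (if y \<le> x then exp (- x\<^sup>2 / 2) else 0)"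
      using AE_lborel_singleton[of y]
    proof eventually_elim
      case (elim x)
      show ?case
      proof
        assume x: "0 < x"
        define i where "i N = nat \<lfloor>sqrt (real (n N)) * x\<rfloor>" for N
        have i: "(\<lambda>N. real (i N) / sqrt (real (n N))) \<longlonglongrightarrow> x"
          unfolding i_def using x by (intro floor_div_tendsto n) auto
        have F: "(\<lambda>N. falling 1 (n N) (i N)) \<longlonglongrightarrow> exp (- x\<^sup>2 / 2)"
          by (rule falling_tendsto[OF n _ _ i]) auto
        show "(\<lambda>N. if r N \<le> nat \<lfloor>sqrt (real (n N)) * x\<rfloor>
            then falling 1 (n N) (nat \<lfloor>sqrt (real (n N)) * x\<rfloor>) else 0) \<longlonglongrightarrow> (if y \<le> x then exp (- x\<^sup>2 / 2) else 0)"
          unfolding i_def[symmetric] by (rule truncation_tendsto[OF n r i elim F])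
      qed
    qed
  qed auto
  have S: "(\<lambda>N. sqrt (n N) * poisson_weight (n N) (n N)) \<longlonglongrightarrow> 1 / sqrt (2 * pi)"
    using filterlim_compose[OF stirling n] by (simp add: poisson_weight_def)
  have "(\<lambda>N. 1 - sqrt (n N) * poisson_weight (n N) (n N) * ((1 / sqrt (n N)) *\<^sub>R (\<Sum>m<n N. if r N \<le> m then falling 1 (n N) m else 0))) \<longlonglongrightarrow>
     1 - 1 / sqrt (2 * pi) * (LINT x:{0..}|lborel. if y \<le> x then exp (- x\<^sup>2 / 2) else 0)"
    by (intro tendsto_diff tendsto_mult tendsto_const R S)
  moreover have "eventually (\<lambda>N. poisson_tail (n N) (n N - 1 - r N) =
     1 - sqrt (n N) * poisson_weight (n N) (n N) * ((1 / sqrt (n N)) *\<^sub>R (\<Sum>m<n N. if r N \<le> m then falling 1 (n N) m else 0))) sequentially"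
    using eventually_index_less[OF n _ r, of 1] by (rule eventually_mono[OF _ poisson_tail_eq]) auto
  ultimately show ?thesis by (simp add: tendsto_cong)
qed


subsection \<open>Incomplete gamma integrals and the limiting kernel\<close>

lemma DERIV_gamma_sum:
  "((\<lambda>s::real. exp (- (c * s)) * (\<Sum>j\<le>a. (c * s) ^ j / fact j)) has_real_derivative
     - (c * (exp (- (c * s)) * ((c * s) ^ a / fact a)))) (at s)"
proof (induction a)
  case 0
  show ?case by (auto intro!: derivative_eq_intros)
next
  case (Suc a)
  have d1: "((\<lambda>s. exp (- (c * s))) has_real_derivative - (c * exp (- (c * s)))) (at s)"
    by (auto intro!: derivative_eq_intros)
  have "((\<lambda>s. (c * s) ^ Suc a / fact (Suc a)) has_real_derivative real (Suc a) * (c * s) ^ a * c / fact (Suc a)) (at s)"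
    by (auto intro!: derivative_eq_intros simp del: fact_Suc power_Suc)
  moreover have "real (Suc a) * (c * s) ^ a * c / fact (Suc a) = c * ((c * s) ^ a / fact a)"
    by (simp del: of_nat_Suc)
  ultimately have d2: "((\<lambda>s. (c * s) ^ Suc a / fact (Suc a)) has_real_derivative c * ((c * s) ^ a / fact a)) (at s)"
    by (simp only:)
  note DERIV_mult[OF d1 d2]
  from DERIV_add[OF Suc this] show ?case
    unfolding sum.atMost_Suc distrib_left by (simp add: algebra_simps del: fact_Suc power_Suc)
qed

text \<open>The duality between incomplete gamma integrals and Poisson probabilities; the upper
  limit 2 of integration turns into the mean \<open>2 * N\<close>.\<close>

lemma radial_moment_eq:
  assumes "N > 0"
  shows "radial_moment N a = fact a / real N ^ Suc a * poisson_tail (2 * N) a"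
proof -
  define F where "F s = - (fact a / real N ^ Suc a) * (exp (- (real N * s)) * (\<Sum>j\<le>a. (real N * s) ^ j / fact j))" for s
  have "(\<integral>s. (s ^ a * exp (- (real N * s))) * indicator {0..2} s \<partial>lborel) = F 2 - F 0"
  proof (rule integral_FTC_Icc_real)
    fix s :: real
    have "(F has_real_derivative - (fact a / real N ^ Suc a) * (- (real N * (exp (- (real N * s)) * ((real N * s) ^ a / fact a))))) (at s)"
      unfolding F_def by (intro DERIV_cmult DERIV_gamma_sum)
    moreover have "- (fact a / real N ^ Suc a) * (- (real N * (exp (- (real N * s)) * ((real N * s) ^ a / fact a)))) =
        s ^ a * exp (- (real N * s))"
      using assms by (simp add: power_mult_distrib field_simps)
    ultimately show "(F has_real_derivative s ^ a * exp (- (real N * s))) (at s)" by simp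
  qed (auto intro!: continuous_intros)
  moreover have "F 0 = - (fact a / real N ^ Suc a)"
    by (simp add: F_def power_0_left sum.atMost_shift)
  moreover have "F 2 = - (fact a / real N ^ Suc a) * (\<Sum>j\<le>a. poisson_weight (2 * N) j)"
    by (simp add: F_def poisson_weight_def sum_distrib_left mult.commute)
  ultimately show ?thesis
    by (simp add: radial_moment_def set_lebesgue_integral_def poisson_tail_def algebra_simps)
qed

lemma radial_moment_nonzero: "N > 0 \<Longrightarrow> radial_moment N a \<noteq> 0"
  using poisson_tail_pos[of "2 * N" a] by (simp add: radial_moment_eq)

text \<open>Splitting the integral at a point below \<open>u\<close> leaves a constant and an
  integral over a compact interval, to which the fundamental theorem applies.\<close>

lemma lborel_has_vector_derivative_lower:
  fixes f :: "real \<Rightarrow> 'a::euclidean_space"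
  assumes cont: "continuous_on {..b} f" and int: "set_integrable lborel {..b} f" and u: "u < b"
  shows "((\<lambda>v. LINT t:{..v}|lborel. f t) has_vector_derivative f u) (at u)"
proof -
  define a c where "a = u - 1" and "c = (u + b) / 2"
  have ac: "a < u" "u < c" "c < b" using u by (auto simp: a_def c_def field_simps)
  have split: "(LINT t:{..v}|lborel. f t) = (LINT t:{..a}|lborel. f t) + integral {a..v} f" if v: "v \<in> {a<..<c}" for v
  proof -
    have I: "set_integrable lborel A f" if "A \<subseteq> {..b}" "A \<in> sets lborel" for A
      using set_integrable_subset[OF int that(2,1)] .
    have "{..v} = {..a} \<union> {a<..v}" "{..a} \<inter> {a<..v} = {}" using v by auto
    then have "(LINT t:{..v}|lborel. f t) = (LINT t:{..a}|lborel. f t) + (LINT t:{a<..v}|lborel. f t)"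
      using v ac by (simp only:) (intro set_integral_Un I; auto)
    also have "(LINT t:{a<..v}|lborel. f t) = (LINT t:{a..v}|lborel. f t)"
      unfolding set_lebesgue_integral_def
    proof (rule integral_cong_AE)
      have "set_integrable lborel {a<..v} f" "set_integrable lborel {a..v} f"
        using v ac by (intro I; auto)+
      note this[unfolded set_integrable_def, THEN borel_measurable_integrable]
      then show "(\<lambda>x. indicat_real {a<..v} x *\<^sub>R f x) \<in> borel_measurable lborel"
        "(\<lambda>x. indicat_real {a..v} x *\<^sub>R f x) \<in> borel_measurable lborel" .
      show "AE x in lborel. indicat_real {a<..v} x *\<^sub>R f x = indicat_real {a..v} x *\<^sub>R f x"
        using AE_lborel_singleton[of a] by eventually_elim (auto simp: indicator_def)
    qed
    also have "\<dots> = integral {a..v} f"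
      by (rule set_borel_integral_eq_integral(2)) (use v ac in \<open>intro I; auto\<close>)
    finally show ?thesis .
  qed
  have "((\<lambda>v. integral {a..v} f) has_vector_derivative f u) (at u within {a..c})"
    by (rule integral_has_vector_derivative) (use ac cont in \<open>auto intro: continuous_on_subset\<close>)
  then have "((\<lambda>v. integral {a..v} f) has_vector_derivative f u) (at u)"
    using ac by (simp add: at_within_Icc_at)
  then have "((\<lambda>v. (LINT t:{..a}|lborel. f t) + integral {a..v} f) has_vector_derivative f u) (at u)"
    by (auto intro!: derivative_eq_intros)
  then show ?thesis
    by (rule has_vector_derivative_transform_within_open[of _ _ _ "{a<..<c}"]) (use ac split in auto)
qed

section \<open>The complementary error function\<close>

lemma gauss_integrable: "integrable lborel (\<lambda>t::real. exp (- t\<^sup>2))"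
proof -
  have "integrable lborel (\<lambda>x::real. exp (- (0 + sqrt 2 * x)\<^sup>2 / 2 + 0 * (0 + sqrt 2 * x)))"
    by (rule lborel_integrable_real_affine[OF gaussian_integrable]) simp
  then show ?thesis by (simp add: power_mult_distrib)
qed

lemma set_integrable_gauss: "A \<in> sets borel \<Longrightarrow> set_integrable lborel A (\<lambda>t::real. exp (- t\<^sup>2))"
  unfolding set_integrable_def by (intro integrable_mult_indicator gauss_integrable) simp

lemma erfc_0: "erfc 0 = 1"
  using gaussian_moment_0 by (simp add: erfc_def set_lebesgue_integral_def has_bochner_integral_iff)

lemma erfc_antimono: "x \<le> y \<Longrightarrow> erfc y \<le> erfc x"
  unfolding erfc_def set_lebesgue_integral_def
  using set_integrable_gauss[of "{x..}"] set_integrable_gauss[of "{y..}"]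
  by (intro mult_left_mono integral_mono) (auto simp: set_integrable_def indicator_def)

lemma erfc_ge_1: "x \<le> 0 \<Longrightarrow> erfc x \<ge> 1"
  using erfc_antimono[of x 0] by (simp add: erfc_0)

lemma erfc_reflect_eq: "2 / sqrt pi * (LINT t:{..x}|lborel. exp (- t\<^sup>2)) = erfc (- x)"
proof -
  have "(LINT t:{- x..}|lborel. exp (- t\<^sup>2)) = (LINT t:{..x}|lborel. exp (- t\<^sup>2))"
    unfolding set_lebesgue_integral_def
    by (subst lborel_integral_real_affine[where c = "- 1" and t = 0])
       (auto intro!: Bochner_Integration.integral_cong simp: indicator_def)
  then show ?thesis by (simp add: erfc_def)
qed

lemma erfc_continuous: "continuous_on UNIV erfc"
proof -
  have "isCont (\<lambda>x. erfc (- x)) x" for x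
  proof -
    have "((\<lambda>v. LINT t:{..v}|lborel. exp (- t\<^sup>2)) has_vector_derivative exp (- x\<^sup>2)) (at x)"
      by (rule lborel_has_vector_derivative_lower[of "x + 1"]) (auto intro!: continuous_intros set_integrable_gauss)
    then have "isCont (\<lambda>v. LINT t:{..v}|lborel. exp (- t\<^sup>2)) x"
      by (rule has_vector_derivative_continuous)
    then have "isCont (\<lambda>v. 2 / sqrt pi * (LINT t:{..v}|lborel. exp (- t\<^sup>2))) x"
      by (rule isCont_mult[OF continuous_const])
    then show ?thesis unfolding erfc_reflect_eq .
  qed
  then have "isCont (\<lambda>x. erfc (- (- x))) x" for x
    by (rule isCont_o2[rotated]) (intro continuous_intros)
  then show ?thesis by (simp add: continuous_at_imp_continuous_on)
qed

lemma erfc_measurable [measurable]: "erfc \<in> borel_measurable borel"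
  by (rule borel_measurable_continuous_onI[OF erfc_continuous])

lemma erfc_reflect: "erfc x + erfc (- x) = 2"
proof -
  have deriv: "((\<lambda>v. erfc (- v)) has_vector_derivative 2 / sqrt pi * exp (- x\<^sup>2)) (at x)" for x
  proof -
    have "((\<lambda>v. LINT t:{..v}|lborel. exp (- t\<^sup>2)) has_vector_derivative exp (- x\<^sup>2)) (at x)"
      by (rule lborel_has_vector_derivative_lower[of "x + 1"]) (auto intro!: continuous_intros set_integrable_gauss)
    from has_vector_derivative_mult_right[OF this, of "2 / sqrt pi"]
    show ?thesis unfolding erfc_reflect_eq .
  qed
  have d1: "((\<lambda>v. erfc (- v)) has_real_derivative 2 / sqrt pi * exp (- x\<^sup>2)) (at x)" for x
    using deriv[of x] by (simp add: has_real_derivative_iff_has_vector_derivative)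
  have d2: "((\<lambda>v. erfc (- (- v))) has_real_derivative 2 / sqrt pi * exp (- (- x)\<^sup>2) * (- 1)) (at x)" for x
    by (rule DERIV_chain2[OF d1]) (auto intro!: derivative_eq_intros)
  have "((\<lambda>v. erfc v + erfc (- v)) has_real_derivative 0) (at x)" for x
    using DERIV_add[OF d2[of x] d1[of x]] by simp
  then have "\<forall>x. ((\<lambda>v. erfc v + erfc (- v)) has_real_derivative 0) (at x)" by blast
  then have "erfc x + erfc (- x) = erfc 0 + erfc (- 0)"
    by (rule DERIV_isconst_all[where f = "\<lambda>v. erfc v + erfc (- v)" and x = x and y = 0])
  then show ?thesis by (simp add: erfc_0)
qed

text \<open>The factor \<open>sqrt 2\<close> adapts the exponent \<open>- t^2 / 2\<close> of the
  Poisson limit to the exponent in \<open>erfc\<close>, and reflection turns one minus the tail into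
  a value at a negative argument.\<close>

lemma gaussian_tail_eq_erfc:
  assumes "x \<ge> 0"
  shows "1 - 1 / sqrt (2 * pi) * (LINT t:{0..}|lborel. if sqrt 2 * x \<le> t then exp (- t\<^sup>2 / 2) else 0) = erfc (- x) / 2"
proof -
  have "(LINT t:{0..}|lborel. if sqrt 2 * x \<le> t then exp (- t\<^sup>2 / 2) else 0) =
     sqrt 2 * (LINT t:{x..}|lborel. exp (- t\<^sup>2))"
  proof -
    have "sqrt 2 * x \<ge> 0" using assms by simp
    have "(LINT t:{0..}|lborel. if sqrt 2 * x \<le> t then exp (- t\<^sup>2 / 2) else 0) =
       \<bar>sqrt 2\<bar> *\<^sub>R (\<integral>t. indicator {0..} (0 + sqrt 2 * t) *\<^sub>R (if sqrt 2 * x \<le> 0 + sqrt 2 * t then exp (- (0 + sqrt 2 * t)\<^sup>2 / 2) else 0) \<partial>lborel)"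
      unfolding set_lebesgue_integral_def by (rule lborel_integral_real_affine) simp
    also have "(\<integral>t. indicator {0..} (0 + sqrt 2 * t) *\<^sub>R (if sqrt 2 * x \<le> 0 + sqrt 2 * t then exp (- (0 + sqrt 2 * t)\<^sup>2 / 2) else 0) \<partial>lborel) =
       (LINT t:{x..}|lborel. exp (- t\<^sup>2))"
      unfolding set_lebesgue_integral_def
      using assms by (intro Bochner_Integration.integral_cong refl)
        (auto simp: indicator_def power_mult_distrib zero_le_mult_iff)
    finally show ?thesis by simp
  qed
  also have "\<dots> = sqrt 2 * (sqrt pi / 2 * erfc x)" by (simp add: erfc_def)
  finally have "1 - 1 / sqrt (2 * pi) * (LINT t:{0..}|lborel. if sqrt 2 * x \<le> t then exp (- t\<^sup>2 / 2) else 0) = 1 - erfc x / 2"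
    by (simp add: real_sqrt_mult)
  then show ?thesis using erfc_reflect[of x] by simp
qed

section \<open>The limiting kernel as an iterated integral over the half-line\<close>

text \<open>The integrand of \<open>edge_fun\<close> after the substitution
  \<open>t = - x / 2\<close>, so that \<open>x \<ge> 0\<close> is the limit of an index, counted
  from the top, over \<open>sqrt N\<close>. There \<open>erfc (- x) \<ge> 1\<close> keeps the
  denominator away from 0.\<close>

definition edge_density :: "complex \<Rightarrow> real \<Rightarrow> complex" where
  "edge_density z x = exp (- 2 * (z + complex_of_real x / 2)\<^sup>2) / complex_of_real (sqrt (erfc (- x)))"

definition edge_tail :: "complex \<Rightarrow> real \<Rightarrow> complex" where
  "edge_tail z x = (LINT y:{x..}|lborel. edge_density z y)"

lemma edge_density_measurable [measurable]: "edge_density z \<in> borel_measurable borel"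
  unfolding edge_density_def by measurable

lemma edge_tail_measurable [measurable]: "edge_tail z \<in> borel_measurable borel"
proof -
  have "edge_tail z = (\<lambda>x. \<integral>y. (if x \<le> y then 1 else 0) *\<^sub>R edge_density z y \<partial>lborel)"
    unfolding edge_tail_def set_lebesgue_integral_def
    by (intro ext Bochner_Integration.integral_cong refl) (simp add: indicator_def)
  then show ?thesis by simp
qed

definition edge_bound :: "real \<Rightarrow> real \<Rightarrow> real" where
  "edge_bound R x = exp (2 * R\<^sup>2) * exp (- x\<^sup>2 / 2 + 2 * R * x)"

lemma norm_edge_density_le:
  assumes x: "x \<ge> 0" and z: "cmod z \<le> R"
  shows "cmod (edge_density z x) \<le> edge_bound R x"
proof -
  have "Re (- 2 * (z + complex_of_real x / 2)\<^sup>2) = - x\<^sup>2 / 2 - 2 * x * Re z - 2 * (Re z)\<^sup>2 + 2 * (Im z)\<^sup>2"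
    by (simp add: power2_eq_square algebra_simps)
  also have "\<dots> \<le> 2 * R\<^sup>2 + (- x\<^sup>2 / 2 + 2 * R * x)"
  proof -
    have "(Im z)\<^sup>2 \<le> R\<^sup>2" using abs_Im_le_cmod[of z] z by (intro power2_le_iff_abs_le[THEN iffD2]) auto
    moreover have "- (2 * x * Re z) \<le> 2 * R * x"
      using mult_left_mono[of "- Re z" R "2 * x"] abs_Re_le_cmod[of z] z x by (simp add: mult_ac)
    moreover have "0 \<le> (Re z)\<^sup>2" by simp
    ultimately show ?thesis by linarith
  qed
  finally have "cmod (exp (- 2 * (z + complex_of_real x / 2)\<^sup>2)) \<le> edge_bound R x"
    by (simp add: edge_bound_def norm_exp_eq_Re exp_add[symmetric])
  moreover have "sqrt (erfc (- x)) \<ge> 1" using erfc_ge_1[of "- x"] x by simp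
  then have "cmod (exp (- 2 * (z + complex_of_real x / 2)\<^sup>2)) / sqrt (erfc (- x)) \<le> cmod (exp (- 2 * (z + complex_of_real x / 2)\<^sup>2))"
    by (simp add: divide_le_eq mult_le_cancel_left1)
  ultimately show ?thesis
    using \<open>sqrt (erfc (- x)) \<ge> 1\<close> by (simp add: edge_density_def norm_divide)
qed

lemma edge_bound_integrable: "integrable lborel (edge_bound R)"
  unfolding edge_bound_def by (intro integrable_mult_right gaussian_integrable)

lemma edge_bound_nonneg: "edge_bound R x \<ge> 0" by (simp add: edge_bound_def)

lemma edge_density_set_integrable:
  assumes "a \<ge> 0"
  shows "set_integrable lborel {a..} (edge_density z)"
  unfolding set_integrable_def
proof (rule Bochner_Integration.integrable_bound[OF edge_bound_integrable[of "cmod z"]])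
  show "AE x in lborel. norm (indicator {a..} x *\<^sub>R edge_density z x) \<le> norm (edge_bound (cmod z) x)"
    using norm_edge_density_le[of _ z "cmod z"] edge_bound_nonneg assms by (auto simp: indicator_def)
qed simp

lemma norm_edge_tail_le:
  assumes "x \<ge> 0"
  shows "cmod (edge_tail z x) \<le> integral\<^sup>L lborel (edge_bound (cmod z))"
  unfolding edge_tail_def set_lebesgue_integral_def
proof (rule Bochner_Integration.integral_norm_bound_integral)
  show "integrable lborel (\<lambda>y. indicat_real {x..} y *\<^sub>R edge_density z y)"
    using edge_density_set_integrable[OF assms] by (simp add: set_integrable_def)
  show "norm (indicat_real {x..} y *\<^sub>R edge_density z y) \<le> edge_bound (cmod z) y" for y
    using norm_edge_density_le[of y z "cmod z"] edge_bound_nonneg assms by (auto simp: indicator_def)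
qed (rule edge_bound_integrable)

lemma edge_density_tail_integrable: "set_integrable lborel {0..} (\<lambda>x. edge_density z x * edge_tail w x)"
  unfolding set_integrable_def
proof (rule Bochner_Integration.integrable_bound)
  let ?C = "integral\<^sup>L lborel (edge_bound (cmod w))"
  show "integrable lborel (\<lambda>x. ?C * edge_bound (cmod z) x)"
    by (intro integrable_mult_right edge_bound_integrable)
  have C: "?C \<ge> 0" by (intro integral_nonneg_AE) (simp add: edge_bound_nonneg)
  show "AE x in lborel. norm (indicator {0..} x *\<^sub>R (edge_density z x * edge_tail w x)) \<le> norm (?C * edge_bound (cmod z) x)"
  proof (rule AE_I2)
    fix x :: real
    show "norm (indicator {0..} x *\<^sub>R (edge_density z x * edge_tail w x)) \<le> norm (?C * edge_bound (cmod z) x)"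
    proof (cases "x \<ge> 0")
      case True
      then have "cmod (edge_density z x) * cmod (edge_tail w x) \<le> edge_bound (cmod z) x * ?C"
        by (intro mult_mono norm_edge_density_le norm_edge_tail_le edge_bound_nonneg) auto
      then show ?thesis using True C by (simp add: norm_mult abs_mult edge_bound_nonneg mult.commute)
    qed (simp add: indicator_def)
  qed
qed simp

lemma edge_fun_eq: "edge_fun z u = edge_tail z (- 2 * u) / complex_of_real (sqrt pi)"
proof -
  have "edge_tail z (- 2 * u) = \<bar>- 2\<bar> *\<^sub>R (\<integral>t. indicator {- 2 * u..} (0 + - 2 * t) *\<^sub>R edge_density z (0 + - 2 * t) \<partial>lborel)"
    unfolding edge_tail_def set_lebesgue_integral_def by (rule lborel_integral_real_affine) simp
  also have "(\<integral>t. indicator {- 2 * u..} (0 + - 2 * t) *\<^sub>R edge_density z (0 + - 2 * t) \<partial>lborel) =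
      (LINT t:{..u}|lborel. exp (- 2 * (z - complex_of_real t)\<^sup>2) / complex_of_real (sqrt (erfc (2 * t))))"
    unfolding set_lebesgue_integral_def
    by (intro Bochner_Integration.integral_cong refl) (simp add: indicator_def edge_density_def)
  finally show ?thesis by (simp add: edge_fun_def scaleR_conv_of_real)
qed

lemma edge_fun_has_vector_derivative:
  assumes u: "u < 0"
  shows "(edge_fun z has_vector_derivative 2 / complex_of_real (sqrt pi) * edge_density z (- 2 * u)) (at u)"
proof -
  let ?f = "\<lambda>t. exp (- 2 * (z - complex_of_real t)\<^sup>2) / complex_of_real (sqrt (erfc (2 * t)))"
  have f: "?f t = edge_density z (- 2 * t)" for t by (simp add: edge_density_def)
  have "((\<lambda>v. LINT t:{..v}|lborel. ?f t) has_vector_derivative ?f u) (at u)"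
  proof (rule lborel_has_vector_derivative_lower[OF _ _ u])
    have "continuous_on {..0} (\<lambda>t. erfc (2 * t))"
      by (rule continuous_on_compose2[OF erfc_continuous]) (auto intro!: continuous_intros)
    moreover have "erfc (2 * t) \<noteq> 0" if "t \<le> 0" for t using erfc_ge_1[of "2 * t"] that by auto
    ultimately show "continuous_on {..0} ?f"
      by (intro continuous_intros) auto
    have "integrable lborel (\<lambda>t. indicator {0..} (0 + - 2 * t) *\<^sub>R edge_density z (0 + - 2 * t))"
      using edge_density_set_integrable[OF order_refl, of z] unfolding set_integrable_def
      by (rule lborel_integrable_real_affine) simp
    also have "(\<lambda>t. indicator {0..} (0 + - 2 * t) *\<^sub>R edge_density z (0 + - 2 * t)) = (\<lambda>t. indicator {..0} t *\<^sub>R ?f t)"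
      by (simp add: edge_density_def indicator_def fun_eq_iff)
    finally show "set_integrable lborel {..0} ?f" by (simp add: set_integrable_def)
  qed
  then show ?thesis unfolding edge_fun_def[abs_def] f by (rule has_vector_derivative_mult_right)
qed

text \<open>Substituting \<open>u = - x / 2\<close> in the Wronskian gives an antisymmetrised
  iterated integral, the form in which the limit of the double sums appears.\<close>

lemma edge_kernel_eq:
  "edge_kernel z w = exp (z\<^sup>2 + w\<^sup>2) / complex_of_real (sqrt pi) *
     ((LINT x:{0..}|lborel. edge_density z x * edge_tail w x) - (LINT x:{0..}|lborel. edge_density w x * edge_tail z x))"
proof -
  define D where "D x = edge_density z x * edge_tail w x - edge_density w x * edge_tail z x" for x
  define W where "W u = wronskian (edge_fun w) (edge_fun z) u" for u
  define W' where "W' u = 2 / complex_of_real pi * D (- 2 * u)" for u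
  have [measurable]: "D \<in> borel_measurable borel" unfolding D_def by measurable
  have [measurable]: "W' \<in> borel_measurable borel" unfolding W'_def by measurable
  have pi: "complex_of_real (sqrt pi) * complex_of_real (sqrt pi) = complex_of_real pi"
    by (simp add: of_real_mult[symmetric] del: of_real_mult)
  have WW: "W u = W' u" if "u < 0" for u
  proof -
    note vd = vector_derivative_at[OF edge_fun_has_vector_derivative[OF that]]
    define c where "c = complex_of_real (sqrt pi)"
    have "c \<noteq> 0" by (simp add: c_def)
    then show ?thesis
      unfolding W_def W'_def wronskian_def D_def vd edge_fun_eq pi[symmetric] c_def[symmetric]
      by (simp add: field_simps)
  qed
  \<comment> \<open>The derivative of \<open>edge_fun\<close> is known for \<open>u < 0\<close>. The
    endpoint is split off as a term supported on a null set, which also yields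
    measurability.\<close>
  have eq: "indicator {..0} u *\<^sub>R W u = indicator {..0} u *\<^sub>R W' u + indicator {0} u *\<^sub>R (W 0 - W' 0)" for u
    using WW[of u] by (cases "u = 0") (auto simp: indicator_def)
  have "(LINT u:{..0}|lborel. W u) = (LINT u:{..0}|lborel. W' u)"
    unfolding set_lebesgue_integral_def
  proof (rule integral_cong_AE)
    show "(\<lambda>u. indicat_real {..0} u *\<^sub>R W u) \<in> borel_measurable lborel" unfolding eq by measurable
    show "AE u in lborel. indicat_real {..0} u *\<^sub>R W u = indicat_real {..0} u *\<^sub>R W' u"
      using AE_lborel_singleton[of 0] by eventually_elim (simp add: eq)
  qed measurable
  also have "(LINT x:{0..}|lborel. D x) = \<bar>- 2\<bar> *\<^sub>R (\<integral>t. indicator {0..} (0 + - 2 * t) *\<^sub>R D (0 + - 2 * t) \<partial>lborel)"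
    unfolding set_lebesgue_integral_def by (rule lborel_integral_real_affine) simp
  then have "(LINT u:{..0}|lborel. W' u) = (LINT x:{0..}|lborel. D x) / complex_of_real pi"
    unfolding set_lebesgue_integral_def W'_def
    by (simp add: indicator_def scaleR_conv_of_real if_distrib[of "\<lambda>x. x * _"] mult.left_commute)
  finally have "edge_kernel z w = complex_of_real (sqrt pi) * exp (z\<^sup>2 + w\<^sup>2) * ((LINT x:{0..}|lborel. D x) / (complex_of_real (sqrt pi) * complex_of_real (sqrt pi)))"
    by (simp add: edge_kernel_def W_def pi)
  also have "\<dots> = exp (z\<^sup>2 + w\<^sup>2) / complex_of_real (sqrt pi) * (LINT x:{0..}|lborel. D x)"
    by simp
  also have "(LINT x:{0..}|lborel. D x) = (LINT x:{0..}|lborel. edge_density z x * edge_tail w x) - (LINT x:{0..}|lborel. edge_density w x * edge_tail z x)"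
    unfolding D_def by (rule set_integral_diff(2)) (rule edge_density_tail_integrable)+
  finally show ?thesis .
qed


subsection \<open>The pre-kernel as a double sum\<close>

text \<open>What remains of a product of moment ratios once factorials and powers of
  \<open>N\<close> are taken out.\<close>

definition tail_ratio :: "nat \<Rightarrow> nat \<Rightarrow> real" where
  "tail_ratio N l = (\<Prod>j<l. poisson_tail (2 * N) (2 * j + 2) / poisson_tail (2 * N) (2 * j + 1))"

lemma tail_ratio_pos: "N > 0 \<Longrightarrow> tail_ratio N l > 0"
  unfolding tail_ratio_def by (intro prod_pos) (auto intro!: divide_pos_pos poisson_tail_pos)

text \<open>Every second ratio of consecutive tails is compared with both of its neighbours by log-concavity.\<close>

lemma tail_ratio_bounds:
  assumes N: "N > 0"
  shows "poisson_tail (2 * N) (2 * l + 1) / poisson_tail (2 * N) 1 \<le> (tail_ratio N l)\<^sup>2"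
    and "(tail_ratio N l)\<^sup>2 \<le> poisson_tail (2 * N) (2 * l) / poisson_tail (2 * N) 0"
proof -
  let ?P = "poisson_tail (2 * N)"
  have pos: "?P a > 0" for a using N by (intro poisson_tail_pos) simp
  have lc: "?P a * ?P (a + 2) \<le> (?P (a + 1))\<^sup>2" for a
    using poisson_tail_log_concave[of "2 * N" a] N by simp
  have step: "(tail_ratio N (Suc l))\<^sup>2 = (tail_ratio N l)\<^sup>2 * ((?P (2 * l + 2))\<^sup>2 / (?P (2 * l + 1))\<^sup>2)" for l
    by (simp add: tail_ratio_def power_mult_distrib power_divide)
  show "?P (2 * l + 1) / ?P 1 \<le> (tail_ratio N l)\<^sup>2"
  proof (induction l)
    case 0
    then show ?case using pos[of 1] by (simp add: tail_ratio_def)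
  next
    case (Suc l)
    have "?P (2 * Suc l + 1) \<le> (?P (2 * l + 2))\<^sup>2 / ?P (2 * l + 1)"
      using lc[of "2 * l + 1"] pos[of "2 * l + 1"] by (simp add: field_simps)
    then have "?P (2 * Suc l + 1) / ?P 1 \<le> (?P (2 * l + 2))\<^sup>2 / ?P (2 * l + 1) / ?P 1"
      using pos[of 1] by (intro divide_right_mono) auto
    also have "\<dots> = ?P (2 * l + 1) / ?P 1 * ((?P (2 * l + 2))\<^sup>2 / (?P (2 * l + 1))\<^sup>2)"
      using pos[of "2 * l + 1"] by (simp add: power2_eq_square)
    also have "\<dots> \<le> (tail_ratio N (Suc l))\<^sup>2"
      unfolding step by (intro mult_right_mono Suc.IH) auto
    finally show ?case .
  qed
  show "(tail_ratio N l)\<^sup>2 \<le> ?P (2 * l) / ?P 0"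
  proof (induction l)
    case 0
    then show ?case using pos[of 0] by (simp add: tail_ratio_def)
  next
    case (Suc l)
    have "(tail_ratio N (Suc l))\<^sup>2 \<le> ?P (2 * l) / ?P 0 * ((?P (2 * l + 2))\<^sup>2 / (?P (2 * l + 1))\<^sup>2)"
      unfolding step by (intro mult_right_mono Suc.IH) auto
    also have "\<dots> = (?P (2 * l) * ?P (2 * l + 2)) / (?P (2 * l + 1))\<^sup>2 * (?P (2 * l + 2) / ?P 0)"
      by (simp add: power2_eq_square mult_ac)
    also have "\<dots> \<le> 1 * (?P (2 * l + 2) / ?P 0)"
    proof (rule mult_right_mono)
      show "?P (2 * l) * ?P (2 * l + 2) / (?P (2 * l + 1))\<^sup>2 \<le> 1"
        using lc[of "2 * l"] pos[of "2 * l + 1"] by (simp add: divide_le_eq_1)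
      show "0 \<le> ?P (2 * l + 2) / ?P 0"
        using pos[of "2 * l + 2"] pos[of 0] by (intro divide_nonneg_nonneg) auto
    qed
    finally show ?case by simp
  qed
qed

text \<open>Extending the product down to 0 writes it as a quotient of a function of
  \<open>k\<close> by the same function of \<open>l\<close>. This separation is what turns the
  kernel into nested sums of products.\<close>

lemma even_coeff_eq:
  assumes N: "N > 0" and l: "l \<le> k"
  shows "even_coeff N k l = ((2 / real N) ^ k * fact k * tail_ratio N k) / ((2 / real N) ^ l * fact l * tail_ratio N l)"
proof -
  define E where "E n = (\<Prod>j<n. radial_moment N (2 * j + 2) / radial_moment N (2 * j + 1))" for n
  have E: "E n = (2 / real N) ^ n * fact n * tail_ratio N n" for n
  proof (induction n)
    case (Suc n)
    have "radial_moment N (2 * n + 2) / radial_moment N (2 * n + 1) =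
        (2 / real N) * real (Suc n) * (poisson_tail (2 * N) (2 * n + 2) / poisson_tail (2 * N) (2 * n + 1))"
      using N poisson_tail_pos[of "2 * N" "2 * n + 1"]
      by (simp add: radial_moment_eq[OF N] divide_simps)
    moreover have "E (Suc n) = E n * (radial_moment N (2 * n + 2) / radial_moment N (2 * n + 1))"
      by (simp add: E_def)
    moreover have "tail_ratio N (Suc n) = tail_ratio N n * (poisson_tail (2 * N) (2 * n + 2) / poisson_tail (2 * N) (2 * n + 1))"
      by (simp add: tail_ratio_def)
    ultimately show ?case unfolding Suc.IH by (simp add: mult_ac)
  qed (simp add: E_def tail_ratio_def)
  have "E k = E l * even_coeff N k l"
    unfolding E_def even_coeff_def using l
    by (simp add: prod.atLeastLessThan_concat lessThan_atLeast0)
  moreover have "E l \<noteq> 0" unfolding E using N tail_ratio_pos[OF N, of l] by simp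
  ultimately have "even_coeff N k l = E k / E l" by simp
  then show ?thesis unfolding E .
qed

text \<open>The quotient of neighbouring expressions is \<open>(2 * m + 3) / (2 * N)\<close>, which
  is \<open>1 - (i + 1 / 2) / N\<close> in the index counted from the top; the half comes from the
  odd factorial.\<close>

lemma odd_weight_falling:
  assumes "i < N"
  shows "4 ^ (N - Suc i) * fact (N - Suc i) * real N ^ (N - Suc i + 2) / (2 * fact (2 * (N - Suc i) + 1)) =
    4 ^ (N - 1) * fact (N - 1) * real N ^ (N + 1) / (2 * fact (2 * (N - 1) + 1)) * falling (1 / 2) N i"
  using assms
proof (induction i)
  case 0
  then show ?case by (cases N) (simp_all add: falling_def)
next
  case (Suc i)
  define m where "m = N - Suc (Suc i)"
  have m: "N - Suc i = Suc m" and rm: "real m = real N - real i - 2" using Suc.prems by (auto simp: m_def of_nat_diff)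
  have "4 ^ m * fact m * real N ^ (m + 2) / (2 * fact (2 * m + 1)) =
      4 ^ Suc m * fact (Suc m) * real N ^ (Suc m + 2) / (2 * fact (2 * Suc m + 1)) * ((2 * real m + 3) / (2 * real N))"
  proof -
    have gen: "p * g * x / (2 * F) = (4 * p) * (u / 2 * g) * (n * x) / (2 * (t * (u * F))) * (t / (2 * n))"
      if "u > 0" "t > 0" "n > 0" "F > 0" for p g x F u n t :: real
      using that by (simp add: field_simps)
    have f: "fact (2 * Suc m + 1) = (2 * real m + 3) * ((2 * real m + 2) * fact (2 * m + 1))"
      "fact (Suc m) = (2 * real m + 2) / 2 * fact m"
      by (simp_all add: algebra_simps)
    have "real N ^ (Suc m + 2) = real N * real N ^ (m + 2)" "(4::real) ^ Suc m = 4 * 4 ^ m" by simp_all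
    then show ?thesis unfolding f using Suc.prems by (simp only:) (rule gen, auto)
  qed
  also have "(2 * real m + 3) / (2 * real N) = 1 - (real i + 1 / 2) / real N"
    using Suc.prems by (simp add: rm field_simps)
  finally have R: "4 ^ m * fact m * real N ^ (m + 2) / (2 * fact (2 * m + 1)) =
      4 ^ Suc m * fact (Suc m) * real N ^ (Suc m + 2) / (2 * fact (2 * Suc m + 1)) * (1 - (real i + 1 / 2) / real N)" .
  note IH = Suc.IH[OF Suc_lessD[OF Suc.prems], unfolded m]
  show ?case unfolding m_def[symmetric] R IH falling_def prod.lessThan_Suc by (simp only: mult.assoc)
qed

lemma even_weight_falling:
  assumes "j < N"
  shows "real N ^ (N - Suc j) / fact (N - Suc j) = real N ^ N / fact N * falling 1 N j"
proof -
  have "exp (- real N) * (real N ^ (N - Suc j) / fact (N - Suc j)) = exp (- real N) * (real N ^ N / fact N * falling 1 N j)"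
    using poisson_weight_falling[OF assms] by (simp add: poisson_weight_def)
  then show ?thesis by (simp only: mult_cancel_left exp_not_eq_zero simp_thms)
qed

text \<open>The factorials of the central odd and even factors combine to a multiple of the central
  weight of the Poisson distribution with mean \<open>2 * N\<close>, whose exponential is supplied
  by \<open>scaled_kernel\<close>.\<close>

lemma central_weight:
  assumes "N > 0"
  shows "4 ^ (N - 1) * fact (N - 1) * real N ^ (N + 1) / (2 * fact (2 * (N - 1) + 1)) * (real N ^ N / fact N) =
    real N / 4 * (real (2 * N) ^ (2 * N) / fact (2 * N))"
proof -
  obtain n where n: "N = Suc n" using assms by (cases N) auto
  have f: "fact (2 * N) = 2 * real N * fact (2 * n + 1)" "fact N = real N * fact n"
    by (simp_all add: n)
  have "4 ^ n * fact n * real N ^ (N + 1) / (2 * fact (2 * n + 1)) * (real N ^ N / (real N * fact n)) =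
      real N / 4 * (4 ^ N * real N ^ (2 * N) / (2 * real N * fact (2 * n + 1)))"
  proof -
    have gen: "p * g * x / (2 * F) * (y / (r * g)) = r / 4 * ((4 * p) * z / (2 * r * F))"
      if xy: "x * y = r * z" and "g > 0" "F > 0" "r > 0" for p g x F y r z :: real
    proof -
      have "p * g * x / (2 * F) * (y / (r * g)) = p * (x * y) / (2 * F * r)"
        using that by (simp add: field_simps)
      then show ?thesis unfolding xy using that by (simp add: field_simps)
    qed
    have "real N ^ (N + 1) * real N ^ N = real N * real N ^ (2 * N)"
      by (simp add: mult_2 power_add)
    moreover have "(4::real) ^ N = 4 * 4 ^ n" by (simp add: n)
    ultimately show ?thesis using assms by (simp only:) (rule gen, auto)
  qed
  moreover have "real (2 * N) ^ (2 * N) = 4 ^ N * real N ^ (2 * N)"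
    by (simp add: power_mult_distrib power_mult)
  ultimately show ?thesis unfolding f by (simp add: n)
qed

text \<open>The factors \<open>sqrt 2 * 2 ^ m\<close> and \<open>2 ^ l\<close> are the powers of the
  radius \<open>sqrt 2\<close> in the two monomials; \<open>scale N ^ 3\<close> and the exponential
  belong to \<open>scaled_kernel\<close>. The division by \<open>real N\<close> on the right
  provides the two meshes \<open>1 / sqrt N\<close>.\<close>

lemma kernel_coefficient:
  assumes j: "j < N" and ij: "i \<le> j"
  defines "m \<equiv> N - Suc i" and "l \<equiv> N - Suc j"
  shows "scale N ^ 3 * sqrt 2 * exp (- (2 * real N)) * (2 ^ m * 2 ^ l) *
      (even_coeff N m l / (2 * radial_moment N (Suc (2 * m)))) =
    sqrt N * poisson_weight (2 * N) (2 * N) / real N *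
      (falling (1 / 2) N i * (tail_ratio N m / poisson_tail (2 * N) (Suc (2 * m)))) * (falling 1 N j / tail_ratio N l)"
proof -
  have N: "N > 0" and i: "i < N" and lm: "l \<le> m" using assms by (auto simp: m_def l_def)
  have B: "tail_ratio N m > 0" "tail_ratio N l > 0" and P: "poisson_tail (2 * N) (Suc (2 * m)) > 0"
    using tail_ratio_pos[OF N] poisson_tail_pos[of "2 * N"] N by auto
  define A where "A = 4 ^ m * fact m * real N ^ (m + 2) / (2 * fact (2 * m + 1))"
  define C where "C = real N ^ l / fact l"
  have "(2 ^ m * 2 ^ l) * (even_coeff N m l / (2 * radial_moment N (Suc (2 * m)))) =
     (A * (tail_ratio N m / poisson_tail (2 * N) (Suc (2 * m)))) * (C / tail_ratio N l)"
  proof -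
    have "2 ^ m * ((2 / real N) ^ m * fact m * tail_ratio N m) / (2 * radial_moment N (Suc (2 * m))) =
        A * (tail_ratio N m / poisson_tail (2 * N) (Suc (2 * m)))"
    proof -
      have "real N ^ Suc (Suc (2 * m)) = real N ^ m * real N ^ (m + 2)"
        by (simp add: power_add[symmetric] mult_2)
      moreover have "(4::real) ^ m = 2 ^ m * 2 ^ m" by (simp add: power_mult_distrib[symmetric])
      ultimately show ?thesis using N P
        unfolding A_def radial_moment_eq[OF N] by (simp del: fact_Suc power_Suc add: power_divide field_simps)
    qed
    moreover have "2 ^ l / ((2 / real N) ^ l * fact l * tail_ratio N l) = C / tail_ratio N l"
      using N B unfolding C_def by (simp add: power_divide field_simps)
    moreover have "(2 ^ m * 2 ^ l) * (even_coeff N m l / (2 * radial_moment N (Suc (2 * m)))) =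
      (2 ^ m * ((2 / real N) ^ m * fact m * tail_ratio N m) / (2 * radial_moment N (Suc (2 * m)))) *
      (2 ^ l / ((2 / real N) ^ l * fact l * tail_ratio N l))"
      unfolding even_coeff_eq[OF N lm] by (simp add: mult_ac)
    ultimately show ?thesis by simp
  qed
  also have "A = 4 ^ (N - 1) * fact (N - 1) * real N ^ (N + 1) / (2 * fact (2 * (N - 1) + 1)) * falling (1 / 2) N i"
    unfolding A_def m_def by (rule odd_weight_falling[OF i])
  also have "C = real N ^ N / fact N * falling 1 N j"
    unfolding C_def l_def by (rule even_weight_falling[OF j])
  finally have e: "(2 ^ m * 2 ^ l) * (even_coeff N m l / (2 * radial_moment N (Suc (2 * m)))) =
      real N / 4 * (real (2 * N) ^ (2 * N) / fact (2 * N)) *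
      ((falling (1 / 2) N i * (tail_ratio N m / poisson_tail (2 * N) (Suc (2 * m)))) * (falling 1 N j / tail_ratio N l))"
    unfolding central_weight[OF N, symmetric] by (simp add: mult_ac)
  have s: "scale N ^ 3 * sqrt 2 = 4 / (real N * sqrt N)"
  proof -
    have "scale N ^ 3 * sqrt 2 = (sqrt 2 * sqrt 2) * (sqrt 2 * sqrt 2) / ((sqrt N * sqrt N) * sqrt N)"
      unfolding scale_def by (simp add: real_sqrt_divide power_divide power3_eq_cube)
    then show ?thesis using N by simp
  qed
  have "scale N ^ 3 * sqrt 2 * exp (- (2 * real N)) * (real N / 4 * (real (2 * N) ^ (2 * N) / fact (2 * N))) =
      poisson_weight (2 * N) (2 * N) / sqrt N"
    unfolding s poisson_weight_def using N by (simp add: field_simps)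
  also have "\<dots> = sqrt N * poisson_weight (2 * N) (2 * N) / real N"
    using N by (simp add: field_simps)
  finally have t: "scale N ^ 3 * sqrt 2 * exp (- (2 * real N)) * (real N / 4 * (real (2 * N) ^ (2 * N) / fact (2 * N))) =
      sqrt N * poisson_weight (2 * N) (2 * N) / real N" .
  have "scale N ^ 3 * sqrt 2 * exp (- (2 * real N)) * (2 ^ m * 2 ^ l) * (even_coeff N m l / (2 * radial_moment N (Suc (2 * m)))) =
     scale N ^ 3 * sqrt 2 * exp (- (2 * real N)) * ((2 ^ m * 2 ^ l) * (even_coeff N m l / (2 * radial_moment N (Suc (2 * m)))))"
    by (simp only: mult.assoc)
  also have "\<dots> = scale N ^ 3 * sqrt 2 * exp (- (2 * real N)) * (real N / 4 * (real (2 * N) ^ (2 * N) / fact (2 * N))) *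
      ((falling (1 / 2) N i * (tail_ratio N m / poisson_tail (2 * N) (Suc (2 * m)))) * (falling 1 N j / tail_ratio N l))"
    unfolding e by (simp only: mult.assoc)
  finally show ?thesis unfolding t by (simp only: mult.assoc)
qed

section \<open>Terms of the double sum\<close>

text \<open>A power of \<open>1 + z / sqrt N\<close> divided by its leading growth
  \<open>exp (2 * sqrt N * z)\<close>.\<close>

definition growth :: "nat \<Rightarrow> complex \<Rightarrow> nat \<Rightarrow> complex" where
  "growth N z d = (1 + z / complex_of_real (sqrt N)) ^ (2 * N - d) * exp (- 2 * complex_of_real (sqrt N) * z)"

text \<open>The index \<open>i\<close> stands for \<open>m = N - 1 - i\<close>, so the odd degree
  \<open>2 * m + 1\<close> is \<open>2 * N - (2 * i + 1)\<close>; the even degree belonging to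
  \<open>j\<close> is \<open>2 * N - (2 * j + 2)\<close>.\<close>

definition odd_term :: "nat \<Rightarrow> complex \<Rightarrow> nat \<Rightarrow> complex" where
  "odd_term N z i = complex_of_real (falling (1 / 2) N i *
     (tail_ratio N (N - Suc i) / poisson_tail (2 * N) (Suc (2 * (N - Suc i))))) * growth N z (2 * i + 1)"

definition even_term :: "nat \<Rightarrow> complex \<Rightarrow> nat \<Rightarrow> complex" where
  "even_term N z j = complex_of_real (falling 1 N j / tail_ratio N (N - Suc j)) * growth N z (2 * j + 2)"

definition even_sum :: "nat \<Rightarrow> complex \<Rightarrow> nat \<Rightarrow> complex" where
  "even_sum N w i = (1 / sqrt N) *\<^sub>R (\<Sum>j<N. if i \<le> j then even_term N w j else 0)"

definition double_sum :: "nat \<Rightarrow> complex \<Rightarrow> complex \<Rightarrow> complex" where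
  "double_sum N z w = (1 / sqrt N) *\<^sub>R (\<Sum>i<N. odd_term N z i * even_sum N w i)"

definition rescale :: "nat \<Rightarrow> complex \<Rightarrow> complex \<Rightarrow> complex" where
  "rescale N \<sigma> z = \<sigma> * complex_of_real (sqrt 2) * (1 + z / complex_of_real (sqrt N))"

text \<open>Of \<open>scale N ^ 3\<close>, two powers come from rescaling a correlation function and
  one from \<open>\<zeta> - cnj \<zeta>\<close>, which also contributes \<open>\<sigma>\<close>. The
  real factor \<open>exp (- (2 * real N))\<close> is the weight at the edge point itself.\<close>

definition scaled_kernel :: "nat \<Rightarrow> complex \<Rightarrow> complex \<Rightarrow> complex \<Rightarrow> complex" where
  "scaled_kernel N \<sigma> z w = complex_of_real (scale N ^ 3) * \<sigma> * complex_of_real (exp (- (2 * real N))) *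
     exp (- 2 * complex_of_real (sqrt N) * (z + w)) * pre_kernel N (rescale N \<sigma> z) (rescale N \<sigma> w)"

definition kernel_half :: "nat \<Rightarrow> complex \<Rightarrow> complex \<Rightarrow> complex" where
  "kernel_half N x y = (\<Sum>i<N. \<Sum>j<N. if i \<le> j then complex_of_real (even_coeff N (N - Suc i) (N - Suc j) /
     (2 * radial_moment N (Suc (2 * (N - Suc i))))) * x ^ Suc (2 * (N - Suc i)) * y ^ (2 * (N - Suc j)) else 0)"

lemma pre_kernel_eq_halves: "pre_kernel N x y = kernel_half N x y - kernel_half N y x"
proof -
  define T where "T x y m = poly (skew_poly N (Suc (2 * m))) x * poly (skew_poly N (2 * m)) y / (2 * skew_norm N m)" for x y m
  have "sum (T x y) {..<N} = kernel_half N x y" for x y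
  proof -
    have "sum (T x y) {..<N} = (\<Sum>i<N. T x y (N - Suc i))" by (rule sum.nat_diff_reindex[symmetric])
    also have "\<dots> = kernel_half N x y"
      unfolding kernel_half_def
    proof (rule sum.cong[OF refl])
      fix i assume i: "i \<in> {..<N}"
      define m where "m = N - Suc i"
      have "poly (skew_poly N (2 * m)) y = (\<Sum>l<N. if l \<le> m then complex_of_real (even_coeff N m l) * y ^ (2 * l) else 0)"
        unfolding poly_skew_poly_even using i
        by (intro sum.mono_neutral_cong_left) (auto simp: m_def)
      also have "\<dots> = (\<Sum>j<N. if N - Suc j \<le> m then complex_of_real (even_coeff N m (N - Suc j)) * y ^ (2 * (N - Suc j)) else 0)"
        by (rule sum.nat_diff_reindex[symmetric])
      also have "\<dots> = (\<Sum>j<N. if i \<le> j then complex_of_real (even_coeff N m (N - Suc j)) * y ^ (2 * (N - Suc j)) else 0)"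
        using i by (intro sum.cong refl) (auto simp: m_def)
      finally show "T x y (N - Suc i) = (\<Sum>j<N. if i \<le> j then complex_of_real (even_coeff N (N - Suc i) (N - Suc j) /
         (2 * radial_moment N (Suc (2 * (N - Suc i))))) * x ^ Suc (2 * (N - Suc i)) * y ^ (2 * (N - Suc j)) else 0)"
        unfolding m_def[symmetric] T_def
        by (simp add: poly_monom skew_norm_def sum_distrib_left sum_divide_distrib del: power_Suc)
           (intro sum.cong refl, simp)
    qed
    finally show ?thesis .
  qed
  then show ?thesis
    unfolding pre_kernel_def diff_divide_distrib sum_subtractf T_def[symmetric]
    by (simp add: T_def mult.commute)
qed

lemma scaled_kernel_eq:
  assumes N: "N > 0" and \<sigma>: "\<sigma> \<in> {1, -1}"
  shows "scaled_kernel N \<sigma> z w = complex_of_real (sqrt N * poisson_weight (2 * N) (2 * N)) * (double_sum N z w - double_sum N w z)"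
proof -
  define c where "c = complex_of_real (scale N ^ 3) * \<sigma> * complex_of_real (exp (- (2 * real N)))"
  define q where "q = complex_of_real (sqrt N * poisson_weight (2 * N) (2 * N))"
  have half: "c * exp (- 2 * complex_of_real (sqrt N) * (z + w)) * kernel_half N (rescale N \<sigma> z) (rescale N \<sigma> w) = q * double_sum N z w" for z w
  proof -
    have "c * exp (- 2 * complex_of_real (sqrt N) * (z + w)) * kernel_half N (rescale N \<sigma> z) (rescale N \<sigma> w) =
       (\<Sum>i<N. \<Sum>j<N. if i \<le> j then q / of_nat N * odd_term N z i * even_term N w j else 0)"
      unfolding kernel_half_def sum_distrib_left
    proof (intro sum.cong refl)
      fix i j assume "i \<in> {..<N}" "j \<in> {..<N}"
      then have i: "i < N" and j: "j < N" by auto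
      define m where "m = N - Suc i"
      define l where "l = N - Suc j"
      show "c * exp (- 2 * complex_of_real (sqrt N) * (z + w)) * (if i \<le> j then complex_of_real (even_coeff N (N - Suc i) (N - Suc j) /
         (2 * radial_moment N (Suc (2 * (N - Suc i))))) * rescale N \<sigma> z ^ Suc (2 * (N - Suc i)) * rescale N \<sigma> w ^ (2 * (N - Suc j)) else 0) =
         (if i \<le> j then q / of_nat N * odd_term N z i * even_term N w j else 0)"
      proof (cases "i \<le> j")
        case True
        \<comment> \<open>The odd monomial leaves one \<open>\<sigma>\<close>, which is squared away
          by the explicit one in \<open>scaled_kernel\<close>; so the two ends of the diameter give
          the same kernel.\<close>
        have \<sigma>2: "\<sigma> * \<sigma> = 1" using \<sigma> by auto
        define Z where "Z = 1 + z / complex_of_real (sqrt N)"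
        define W where "W = 1 + w / complex_of_real (sqrt N)"
        have sq2: "complex_of_real (sqrt 2) * complex_of_real (sqrt 2) = 2"
          by (simp add: of_real_mult[symmetric] del: of_real_mult)
        have X2: "(rescale N \<sigma> z)\<^sup>2 = 2 * Z\<^sup>2" "(rescale N \<sigma> w)\<^sup>2 = 2 * W\<^sup>2" 
        proof -
          have "(\<sigma> * complex_of_real (sqrt 2) * Y)\<^sup>2 = (\<sigma> * \<sigma>) * (complex_of_real (sqrt 2) * complex_of_real (sqrt 2)) * Y\<^sup>2" for Y
            by (simp only: power2_eq_square mult_ac)
          then show "(rescale N \<sigma> z)\<^sup>2 = 2 * Z\<^sup>2" "(rescale N \<sigma> w)\<^sup>2 = 2 * W\<^sup>2"
            unfolding rescale_def Z_def[symmetric] W_def[symmetric] \<sigma>2 sq2 by simp_all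
        qed
        have pz: "rescale N \<sigma> z ^ Suc (2 * m) = \<sigma> * complex_of_real (sqrt 2) * 2 ^ m * Z ^ Suc (2 * m)"
          unfolding power_Suc power_mult X2 by (simp add: power_mult_distrib rescale_def Z_def)
        have pw: "rescale N \<sigma> w ^ (2 * l) = 2 ^ l * W ^ (2 * l)"
          unfolding power_mult X2 by (simp add: power_mult_distrib)
        have ez: "Suc (2 * m) = 2 * N - (2 * i + 1)" "2 * l = 2 * N - (2 * j + 2)"
          using i j by (auto simp: m_def l_def)
        have g: "growth N z (2 * i + 1) = Z ^ Suc (2 * m) * exp (- 2 * complex_of_real (sqrt N) * z)"
          "growth N w (2 * j + 2) = W ^ (2 * l) * exp (- 2 * complex_of_real (sqrt N) * w)"
          unfolding growth_def ez Z_def W_def by simp_all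
        have "c * exp (- 2 * complex_of_real (sqrt N) * (z + w)) * (complex_of_real (even_coeff N m l /
         (2 * radial_moment N (Suc (2 * m)))) * rescale N \<sigma> z ^ Suc (2 * m) * rescale N \<sigma> w ^ (2 * l)) =
           complex_of_real (scale N ^ 3 * sqrt 2 * exp (- (2 * real N)) * (2 ^ m * 2 ^ l) *
             (even_coeff N m l / (2 * radial_moment N (Suc (2 * m))))) * (\<sigma> * \<sigma>) *
           growth N z (2 * i + 1) * growth N w (2 * j + 2)"
          unfolding pz pw g c_def distrib_left exp_add of_real_mult by (simp del: power_Suc add: mult_ac)
        also have "\<dots> = complex_of_real (sqrt N * poisson_weight (2 * N) (2 * N) / real N *
            (falling (1 / 2) N i * (tail_ratio N m / poisson_tail (2 * N) (Suc (2 * m)))) * (falling 1 N j / tail_ratio N l)) *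
           growth N z (2 * i + 1) * growth N w (2 * j + 2)"
          unfolding \<sigma>2 using kernel_coefficient[OF j True] unfolding m_def l_def by (simp only: mult_1_right)
        also have "\<dots> = q / of_nat N * odd_term N z i * even_term N w j"
          unfolding odd_term_def even_term_def q_def m_def[symmetric] l_def[symmetric] by simp
        finally show ?thesis using True by (simp add: m_def l_def del: power_Suc)
      qed simp
    qed
    also have "\<dots> = (\<Sum>i<N. q / of_nat N * odd_term N z i * (\<Sum>j<N. if i \<le> j then even_term N w j else 0))"
      unfolding sum_distrib_left by (intro sum.cong refl) simp
    also have "\<dots> = (\<Sum>i<N. q * ((1 / sqrt N) *\<^sub>R (odd_term N z i * even_sum N w i)))"
    proof (rule sum.cong[OF refl])
      fix i
      define t where "t = complex_of_real (1 / sqrt N)"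
      define S where "S = (\<Sum>j<N. if i \<le> j then even_term N w j else 0)"
      \<comment> \<open>The factor \<open>1 / N\<close> is shared out as one mesh for each of the
        nested sums.\<close>
      have "t * t = 1 / of_nat N" unfolding t_def of_real_mult[symmetric] by simp
      then have "q / of_nat N * odd_term N z i * S = q * (t * t) * odd_term N z i * S" by simp
      also have "\<dots> = q * (t * (odd_term N z i * (t * S)))" by (simp only: mult_ac)
      finally show "q / of_nat N * odd_term N z i * (\<Sum>j<N. if i \<le> j then even_term N w j else 0) =
         q * ((1 / sqrt N) *\<^sub>R (odd_term N z i * even_sum N w i))"
        unfolding even_sum_def scaleR_conv_of_real t_def S_def .
    qed
    also have "\<dots> = q * double_sum N z w"
      unfolding double_sum_def scaleR_sum_right sum_distrib_left ..
    finally show ?thesis .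
  qed
  have "scaled_kernel N \<sigma> z w = c * exp (- 2 * complex_of_real (sqrt N) * (z + w)) * kernel_half N (rescale N \<sigma> z) (rescale N \<sigma> w) -
      c * exp (- 2 * complex_of_real (sqrt N) * (w + z)) * kernel_half N (rescale N \<sigma> w) (rescale N \<sigma> z)"
    unfolding scaled_kernel_def c_def[symmetric] pre_kernel_eq_halves by (simp add: algebra_simps)
  then show ?thesis unfolding half q_def[symmetric] by (simp add: algebra_simps)
qed


subsection \<open>Convergence of the kernel\<close>

lemma Ln_approx_quadratic:
  fixes u :: complex
  assumes "norm u < 1"
  shows "norm (Ln (1 + u) - u + u\<^sup>2 / 2) \<le> norm u ^ 3 / (1 - norm u)"
proof -
  define f where "f n = - ((- u) ^ n) / of_nat n" for n
  have "f sums Ln (1 + u)" unfolding f_def using assms by (rule Ln_series')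
  then have "(\<lambda>n. f (n + 3)) sums (Ln (1 + u) - (\<Sum>n<3. f n))" by (simp add: sums_iff_shift)
  moreover have "(\<Sum>n<3. f n) = u - u\<^sup>2 / 2"
    by (simp add: f_def numeral_3_eq_3 power2_eq_square)
  ultimately have "(\<lambda>n. f (n + 3)) sums (Ln (1 + u) - u + u\<^sup>2 / 2)" by (simp add: algebra_simps)
  moreover have "(\<lambda>n. norm u ^ 3 * norm u ^ n) sums (norm u ^ 3 * (1 / (1 - norm u)))"
    using assms by (intro sums_mult geometric_sums) simp
  moreover have "norm (f (n + 3)) \<le> norm u ^ 3 * norm u ^ n" for n
  proof -
    have "norm (f (n + 3)) = norm u ^ (n + 3) / real (n + 3)"
      by (simp add: f_def norm_divide norm_power del: of_nat_add)
    also have "\<dots> \<le> norm u ^ (n + 3) / 1" by (intro divide_left_mono) auto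
    finally show ?thesis by (simp add: power_add mult.commute)
  qed
  ultimately have "norm (Ln (1 + u) - u + u\<^sup>2 / 2) \<le> norm u ^ 3 * (1 / (1 - norm u))"
    by (rule norm_sums_le)
  then show ?thesis by simp
qed

lemma Ln_approx_half:
  fixes u :: complex
  assumes "norm u < 1 / 2"
  shows "norm (Ln (1 + u) - u) \<le> 2 * (norm u)\<^sup>2"
    and "norm (Ln (1 + u) - u + u\<^sup>2 / 2) \<le> 2 * norm u ^ 3"
proof -
  have *: "x / (1 - norm u) \<le> 2 * x" if "x \<ge> 0" for x
  proof -
    have "x / (1 - norm u) \<le> x / (1 / 2)" using that assms by (intro divide_left_mono) auto
    then show ?thesis by simp
  qed
  have "norm u < 1" using assms by simp
  note Ln_approx_linear[OF this] Ln_approx_quadratic[OF this]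
  then show "norm (Ln (1 + u) - u) \<le> 2 * (norm u)\<^sup>2" "norm (Ln (1 + u) - u + u\<^sup>2 / 2) \<le> 2 * norm u ^ 3"
    using *[of "(norm u)\<^sup>2"] *[of "norm u ^ 3"] by (auto intro: order_trans)
qed

text \<open>An exact rewriting that separates two effects: \<open>Ln (1 + u) - u\<close> is of
  second order and is multiplied by \<open>2 * N\<close>, while \<open>Ln (1 + u)\<close> is of
  first order and is multiplied by \<open>d\<close>.\<close>

lemma growth_eq_exp:
  assumes N: "N > 0" and u: "cmod (z / complex_of_real (sqrt N)) < 1 / 2" and d: "d \<le> 2 * N"
  defines "u \<equiv> z / complex_of_real (sqrt N)"
  shows "growth N z d = exp (of_nat (2 * N) * (Ln (1 + u) - u) - of_nat d * Ln (1 + u))"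
proof -
  have "1 + u \<noteq> 0"
  proof
    assume "1 + u = 0"
    then have "u = - 1" by (simp add: eq_neg_iff_add_eq_0 add.commute)
    then show False using u by (simp add: u_def[symmetric])
  qed
  then have "(1 + u) ^ (2 * N - d) = exp (of_nat (2 * N - d) * Ln (1 + u))"
    by (simp add: exp_of_nat_mult)
  moreover have "complex_of_real (sqrt N) * z = of_nat N * u"
  proof -
    have "complex_of_real (sqrt N) * complex_of_real (sqrt N) = of_nat N"
      by (simp add: of_real_mult[symmetric] del: of_real_mult)
    moreover have "z = complex_of_real (sqrt N) * u" using N by (simp add: u_def)
    ultimately show ?thesis by (metis mult.assoc)
  qed
  ultimately have "growth N z d = exp (of_nat (2 * N - d) * Ln (1 + u) + (- 2 * (of_nat N * u)))"
    unfolding growth_def u_def[symmetric] exp_add by (simp add: mult.assoc)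
  also have "of_nat (2 * N - d) * Ln (1 + u) + (- 2 * (of_nat N * u)) = of_nat (2 * N) * (Ln (1 + u) - u) - of_nat d * Ln (1 + u)"
    using d by (simp add: of_nat_diff algebra_simps)
  finally show ?thesis .
qed

lemma small_quotient:
  assumes "4 * R\<^sup>2 < real N" "cmod z \<le> R"
  shows "N > 0" "cmod (z / complex_of_real (sqrt N)) < 1 / 2"
proof -
  have R: "R \<ge> 0" using assms(2) norm_ge_zero order_trans by blast
  have "0 < real N" using assms(1) by (meson le_less_trans mult_nonneg_nonneg zero_le_numeral zero_le_power2)
  then show N: "N > 0" by simp
  have "(2 * R)\<^sup>2 < real N" using assms by (simp add: power_mult_distrib)
  then have "2 * R < sqrt (real N)" by (rule real_less_rsqrt)
  then have "cmod z < sqrt (real N) / 2" using assms by simp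
  then show "cmod (z / complex_of_real (sqrt N)) < 1 / 2" using N by (simp add: norm_divide field_simps)
qed

lemma norm_growth_le:
  assumes N4: "4 * R\<^sup>2 < real N" and z: "cmod z \<le> R" and d: "d \<le> 2 * N"
  shows "cmod (growth N z d) \<le> exp (4 * R\<^sup>2 + 2 * R * (real d / sqrt N))"
proof -
  note N = small_quotient[OF N4 z]
  define u where "u = z / complex_of_real (sqrt N)"
  have u: "cmod u < 1 / 2" "cmod u = cmod z / sqrt N" using N by (simp_all add: u_def norm_divide)
  have "cmod (growth N z d) \<le> exp (cmod (of_nat (2 * N) * (Ln (1 + u) - u) - of_nat d * Ln (1 + u)))"
    unfolding growth_eq_exp[OF N d] u_def[symmetric] norm_exp_eq_Re exp_le_cancel_iff
    by (rule complex_Re_le_cmod)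
  also have "cmod (of_nat (2 * N) * (Ln (1 + u) - u) - of_nat d * Ln (1 + u)) \<le>
      real (2 * N) * cmod (Ln (1 + u) - u) + real d * cmod (Ln (1 + u))"
    by (rule order_trans[OF norm_triangle_ineq4]) (simp add: norm_mult del: of_nat_mult)
  also have "\<dots> \<le> real (2 * N) * (2 * (cmod u)\<^sup>2) + real d * (2 * cmod u)"
    by (intro add_mono mult_left_mono Ln_approx_half(1) norm_Ln_le u) auto
  also have "\<dots> = 4 * (cmod z)\<^sup>2 + 2 * cmod z * (real d / sqrt N)"
    unfolding u(2) using N by (simp add: power_divide)
  also have "\<dots> \<le> 4 * R\<^sup>2 + 2 * R * (real d / sqrt N)"
    using z order_trans[OF norm_ge_zero z] by (intro add_mono mult_mono power_mono) auto
  finally show ?thesis by simp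
qed

lemma eventually_real_gt: "eventually (\<lambda>N. c < real N) sequentially"
  by (metis eventually_sequentiallyI less_le_trans of_nat_le_iff reals_Archimedean2)

lemma inverse_sqrt_tendsto: "(\<lambda>N. 1 / sqrt (real N)) \<longlonglongrightarrow> 0"
  by real_asymp

text \<open>As \<open>u\<close> is of order \<open>1 / sqrt N\<close>, the quadratic term of the
  logarithm yields \<open>- z^2\<close>, and the linear term, multiplied by \<open>d\<close>, yields
  \<open>y * z\<close>.\<close>

lemma growth_tendsto:
  fixes d :: "nat \<Rightarrow> nat"
  assumes z: "zs \<longlonglongrightarrow> z" and d: "(\<lambda>N. real (d N) / sqrt N) \<longlonglongrightarrow> y"
  shows "(\<lambda>N. growth N (zs N) (d N)) \<longlonglongrightarrow> exp (- z\<^sup>2 - complex_of_real y * z)"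
proof -
  obtain R where R: "\<And>N. cmod (zs N) \<le> R"
    using convergent_imp_Bseq[of zs] z by (auto simp: convergent_def Bseq_def)
  define u where "u N = zs N / complex_of_real (sqrt N)" for N
  have ev: "eventually (\<lambda>N. 4 * R\<^sup>2 < real N) sequentially" by (rule eventually_real_gt)
  have d2: "eventually (\<lambda>N. d N \<le> 2 * N) sequentially"
    using eventually_index_less[OF filterlim_ident _ d, of 2] by (rule eventually_mono) auto
  have us: "cmod (u N) < 1 / 2" "cmod (u N) = cmod (zs N) / sqrt N" "real N > 0" if "4 * R\<^sup>2 < real N" for N
    using small_quotient[OF that R[of N]] by (simp_all add: u_def norm_divide)
  have L1: "(\<lambda>N. of_nat (2 * N) * (Ln (1 + u N) - u N)) \<longlonglongrightarrow> - z\<^sup>2"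
  proof (rule Lim_transform2[where f = "\<lambda>N. - (zs N)\<^sup>2"])
    show "(\<lambda>N. - (zs N)\<^sup>2) \<longlonglongrightarrow> - z\<^sup>2" by (intro tendsto_intros z)
    show "(\<lambda>N. - (zs N)\<^sup>2 - of_nat (2 * N) * (Ln (1 + u N) - u N)) \<longlonglongrightarrow> 0"
    proof (rule Lim_null_comparison)
      show "(\<lambda>N. 4 * R ^ 3 * (1 / sqrt (real N))) \<longlonglongrightarrow> 0"
        by (intro tendsto_mult_right_zero inverse_sqrt_tendsto)
      show "eventually (\<lambda>N. cmod (- (zs N)\<^sup>2 - of_nat (2 * N) * (Ln (1 + u N) - u N)) \<le> 4 * R ^ 3 * (1 / sqrt (real N))) sequentially"
        using ev
      proof eventually_elim
        case (elim N)
        have "(zs N)\<^sup>2 = of_nat N * (u N)\<^sup>2"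
          using us(3)[OF elim] by (simp add: u_def power_divide flip: of_real_power)
        then have "- (zs N)\<^sup>2 - of_nat (2 * N) * (Ln (1 + u N) - u N) = - (of_nat (2 * N) * (Ln (1 + u N) - u N + (u N)\<^sup>2 / 2))"
          by (simp add: algebra_simps)
        then have "cmod (- (zs N)\<^sup>2 - of_nat (2 * N) * (Ln (1 + u N) - u N)) = real (2 * N) * cmod (Ln (1 + u N) - u N + (u N)\<^sup>2 / 2)"
          by (simp only: norm_minus_cancel norm_mult norm_of_nat)
        also have "\<dots> \<le> real (2 * N) * (2 * cmod (u N) ^ 3)"
          by (intro mult_left_mono Ln_approx_half(2) us(1)[OF elim]) auto
        also have "\<dots> = 4 * cmod (zs N) ^ 3 * (1 / sqrt N)"
        proof -
          have "sqrt (real N) ^ 3 = real N * sqrt N" by (simp add: power3_eq_cube)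
          then show ?thesis unfolding us(2)[OF elim] using us(3)[OF elim] by (simp add: power_divide)
        qed
        also have "\<dots> \<le> 4 * R ^ 3 * (1 / sqrt N)"
          by (intro mult_right_mono mult_left_mono power_mono R) auto
        finally show ?case .
      qed
    qed
  qed
  have L2: "(\<lambda>N. of_nat (d N) * Ln (1 + u N)) \<longlonglongrightarrow> complex_of_real y * z"
  proof (rule Lim_transform2[where f = "\<lambda>N. complex_of_real (real (d N) / sqrt N) * zs N"])
    show "(\<lambda>N. complex_of_real (real (d N) / sqrt N) * zs N) \<longlonglongrightarrow> complex_of_real y * z"
      by (intro tendsto_intros z d)
    show "(\<lambda>N. complex_of_real (real (d N) / sqrt N) * zs N - of_nat (d N) * Ln (1 + u N)) \<longlonglongrightarrow> 0"
    proof (rule Lim_null_comparison)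
      have "(\<lambda>N. (real (d N) / sqrt N) * (2 * R\<^sup>2 * (1 / sqrt (real N)))) \<longlonglongrightarrow> y * (2 * R\<^sup>2 * 0)"
        by (intro tendsto_intros d inverse_sqrt_tendsto)
      then show "(\<lambda>N. (real (d N) / sqrt N) * (2 * R\<^sup>2 * (1 / sqrt (real N)))) \<longlonglongrightarrow> 0" by simp
      show "eventually (\<lambda>N. cmod (complex_of_real (real (d N) / sqrt N) * zs N - of_nat (d N) * Ln (1 + u N)) \<le>
          (real (d N) / sqrt N) * (2 * R\<^sup>2 * (1 / sqrt (real N)))) sequentially"
        using ev
      proof eventually_elim
        case (elim N)
        have "complex_of_real (real (d N) / sqrt N) * zs N = of_nat (d N) * u N" by (simp add: u_def)
        then have "complex_of_real (real (d N) / sqrt N) * zs N - of_nat (d N) * Ln (1 + u N) = - (of_nat (d N) * (Ln (1 + u N) - u N))"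
          by (simp add: algebra_simps)
        then have "cmod (complex_of_real (real (d N) / sqrt N) * zs N - of_nat (d N) * Ln (1 + u N)) = real (d N) * cmod (Ln (1 + u N) - u N)"
          by (simp only: norm_minus_cancel norm_mult norm_of_nat)
        also have "\<dots> \<le> real (d N) * (2 * (cmod (u N))\<^sup>2)"
          by (intro mult_left_mono Ln_approx_half(1) us(1)[OF elim]) auto
        also have "\<dots> = (real (d N) / sqrt N) * (2 * (cmod (zs N))\<^sup>2 * (1 / sqrt N))"
          unfolding us(2)[OF elim] by (simp add: power_divide)
        also have "\<dots> \<le> (real (d N) / sqrt N) * (2 * R\<^sup>2 * (1 / sqrt N))"
          by (intro mult_right_mono mult_left_mono power_mono R) auto
        finally show ?case .
      qed
    qed
  qed
  have "(\<lambda>N. exp (of_nat (2 * N) * (Ln (1 + u N) - u N) - of_nat (d N) * Ln (1 + u N))) \<longlonglongrightarrow> exp (- z\<^sup>2 - complex_of_real y * z)"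
    by (intro tendsto_exp tendsto_diff L1 L2)
  moreover have "eventually (\<lambda>N. growth N (zs N) (d N) = exp (of_nat (2 * N) * (Ln (1 + u N) - u N) - of_nat (d N) * Ln (1 + u N))) sequentially"
    using ev d2
  proof eventually_elim
    case (elim N)
    then show ?case unfolding u_def using small_quotient[OF elim(1) R[of N]] by (intro growth_eq_exp) auto
  qed
  ultimately show ?thesis by (simp add: tendsto_cong)
qed

section \<open>Tails and their ratios at the edge\<close>

lemma filterlim_double: "filterlim (\<lambda>N::nat. 2 * N) at_top sequentially"
  by (rule filterlim_subseq) (simp add: strict_mono_def)

text \<open>Two steps of the Poisson index for each step of \<open>i\<close>, measured in the
  standard deviation \<open>sqrt (2 * N)\<close>, give the distance \<open>sqrt 2 * x\<close>. The
  offset \<open>c\<close> serves to reach both parities and disappears in the limit.\<close>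

lemma poisson_tail_edge_tendsto:
  fixes i :: "nat \<Rightarrow> nat"
  assumes i: "(\<lambda>N. real (i N) / sqrt N) \<longlonglongrightarrow> x" and x: "x \<ge> 0"
  shows "(\<lambda>N. poisson_tail (2 * N) (2 * N - 1 - (2 * i N + c))) \<longlonglongrightarrow> erfc (- x) / 2"
proof -
  have "(\<lambda>N. 2 / sqrt 2 * (real (i N) / sqrt N) + real c / sqrt 2 * (1 / sqrt N)) \<longlonglongrightarrow> 2 / sqrt 2 * x + real c / sqrt 2 * 0"
    by (intro tendsto_intros i inverse_sqrt_tendsto) auto
  moreover have "2 / sqrt 2 * (real (i N) / sqrt N) + real c / sqrt 2 * (1 / sqrt N) = real (2 * i N + c) / sqrt (real (2 * N))" for N
    by (simp add: real_sqrt_mult add_divide_distrib)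
  moreover have "2 / sqrt 2 = sqrt 2" by (simp add: real_div_sqrt)
  ultimately have "(\<lambda>N. real (2 * i N + c) / sqrt (real (2 * N))) \<longlonglongrightarrow> sqrt 2 * x" by simp
  from poisson_tail_tendsto[OF filterlim_double this] x show ?thesis
    unfolding gaussian_tail_eq_erfc[OF x] by simp
qed

lemma poisson_tail_low_tendsto:
  "(\<lambda>N. poisson_tail (2 * N) 0) \<longlonglongrightarrow> 1" "(\<lambda>N. poisson_tail (2 * N) 1) \<longlonglongrightarrow> 1"
proof -
  have "(\<lambda>N::nat. 1 - exp (- (2 * real N))) \<longlonglongrightarrow> 1" by real_asymp
  then show "(\<lambda>N. poisson_tail (2 * N) 0) \<longlonglongrightarrow> 1"
    by (simp add: poisson_tail_def poisson_weight_def)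
  have "(\<lambda>N::nat. 1 - (exp (- (2 * real N)) + exp (- (2 * real N)) * (2 * real N))) \<longlonglongrightarrow> 1" by real_asymp
  then show "(\<lambda>N. poisson_tail (2 * N) 1) \<longlonglongrightarrow> 1"
    by (simp add: poisson_tail_def poisson_weight_def)
qed

text \<open>The tail at \<open>2 * N - 1\<close> tends to 1 / 2, hence is eventually above 1 / 4,
  and the tails at lower indices are larger.\<close>

definition tails_bounded :: "nat \<Rightarrow> bool" where
  "tails_bounded N \<longleftrightarrow> (\<forall>a<2 * N. poisson_tail (2 * N) a \<ge> 1 / 4)"

lemma eventually_tails_bounded: "eventually tails_bounded sequentially"
proof -
  have "(\<lambda>N. poisson_tail (2 * N) (2 * N - 1 - (2 * 0 + 0))) \<longlonglongrightarrow> erfc (- 0) / 2"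
    by (rule poisson_tail_edge_tendsto) auto
  then have "(\<lambda>N. poisson_tail (2 * N) (2 * N - 1)) \<longlonglongrightarrow> 1 / 2" by (simp add: erfc_0)
  then have "eventually (\<lambda>N. poisson_tail (2 * N) (2 * N - 1) > 1 / 4) sequentially"
    by (intro order_tendstoD) auto
  then show ?thesis
  proof eventually_elim
    case (elim N)
    show ?case
      unfolding tails_bounded_def
    proof safe
      fix a assume "a < 2 * N"
      then have "poisson_tail (2 * N) (2 * N - 1) \<le> poisson_tail (2 * N) a" by (intro poisson_tail_antimono) simp
      then show "1 / 4 \<le> poisson_tail (2 * N) a" using elim by linarith
    qed
  qed
qed

lemma tail_ratio_between:
  assumes N: "N > 0"
  shows "sqrt (poisson_tail (2 * N) (2 * l + 1) / poisson_tail (2 * N) 1) \<le> tail_ratio N l"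
    and "tail_ratio N l \<le> sqrt (poisson_tail (2 * N) (2 * l) / poisson_tail (2 * N) 0)"
  using tail_ratio_bounds[OF N, of l] tail_ratio_pos[OF N, of l]
  by (simp_all add: real_le_lsqrt real_le_rsqrt)

lemma tail_ratio_le_1:
  assumes N: "N > 0"
  shows "tail_ratio N l \<le> 1"
proof -
  have "poisson_tail (2 * N) (2 * l) / poisson_tail (2 * N) 0 \<le> 1"
    using poisson_tail_antimono[of 0 "2 * l" "2 * N"] poisson_tail_pos[of "2 * N" 0] N by simp
  then show ?thesis using tail_ratio_between(2)[OF N, of l] by (meson order_trans real_sqrt_le_1_iff)
qed

lemma tail_ratio_ge:
  assumes N: "N > 0" and t: "tails_bounded N" and l: "l < N"
  shows "tail_ratio N l \<ge> 1 / 2"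
proof -
  have "(1 / 2)\<^sup>2 \<le> poisson_tail (2 * N) (2 * l + 1) / 1"
    using t l by (simp add: tails_bounded_def power_divide)
  also have "\<dots> \<le> poisson_tail (2 * N) (2 * l + 1) / poisson_tail (2 * N) 1"
    using poisson_tail_le_1[of "2 * N" 1] poisson_tail_pos[of "2 * N"] N by (intro divide_left_mono) (auto simp: less_imp_le)
  finally have "1 / 2 \<le> sqrt (poisson_tail (2 * N) (2 * l + 1) / poisson_tail (2 * N) 1)" by (rule real_le_rsqrt)
  then show ?thesis using tail_ratio_between(1)[OF N, of l] by linarith
qed

text \<open>The two square roots that enclose the ratio have the same limit: the tails at 0 and 1
  tend to 1, and neighbouring tails at the edge share their limit.\<close>

lemma tail_ratio_tendsto:
  fixes i :: "nat \<Rightarrow> nat"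
  assumes i: "(\<lambda>N. real (i N) / sqrt N) \<longlonglongrightarrow> x" and x: "x \<ge> 0"
  shows "(\<lambda>N. tail_ratio N (N - Suc (i N))) \<longlonglongrightarrow> sqrt (erfc (- x) / 2)"
    and "(\<lambda>N. poisson_tail (2 * N) (Suc (2 * (N - Suc (i N))))) \<longlonglongrightarrow> erfc (- x) / 2"
proof -
  have lt: "eventually (\<lambda>N. i N < N) sequentially"
    using eventually_index_less[OF filterlim_ident _ i, of 1] by (rule eventually_mono) auto
  have "eventually (\<lambda>N. poisson_tail (2 * N) (2 * N - 1 - (2 * i N + 0)) = poisson_tail (2 * N) (Suc (2 * (N - Suc (i N))))) sequentially"
    using lt by eventually_elim (rule arg_cong[where f = "poisson_tail _"], simp)
  then show P1: "(\<lambda>N. poisson_tail (2 * N) (Suc (2 * (N - Suc (i N))))) \<longlonglongrightarrow> erfc (- x) / 2"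
    using poisson_tail_edge_tendsto[OF i x, of 0] by (simp add: tendsto_cong)
  have "eventually (\<lambda>N. poisson_tail (2 * N) (2 * N - 1 - (2 * i N + 1)) = poisson_tail (2 * N) (2 * (N - Suc (i N)))) sequentially"
    using lt by eventually_elim (rule arg_cong[where f = "poisson_tail _"], simp)
  then have P0: "(\<lambda>N. poisson_tail (2 * N) (2 * (N - Suc (i N)))) \<longlonglongrightarrow> erfc (- x) / 2"
    using poisson_tail_edge_tendsto[OF i x, of 1] by (simp add: tendsto_cong)
  show "(\<lambda>N. tail_ratio N (N - Suc (i N))) \<longlonglongrightarrow> sqrt (erfc (- x) / 2)"
  proof (rule real_tendsto_sandwich)
    have "(\<lambda>N. sqrt (poisson_tail (2 * N) (Suc (2 * (N - Suc (i N)))) / poisson_tail (2 * N) 1)) \<longlonglongrightarrow> sqrt (erfc (- x) / 2 / 1)"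
      by (intro tendsto_real_sqrt tendsto_divide P1 poisson_tail_low_tendsto) simp
    then show "(\<lambda>N. sqrt (poisson_tail (2 * N) (Suc (2 * (N - Suc (i N)))) / poisson_tail (2 * N) 1)) \<longlonglongrightarrow> sqrt (erfc (- x) / 2)" by simp
    have "(\<lambda>N. sqrt (poisson_tail (2 * N) (2 * (N - Suc (i N))) / poisson_tail (2 * N) 0)) \<longlonglongrightarrow> sqrt (erfc (- x) / 2 / 1)"
      by (intro tendsto_real_sqrt tendsto_divide P0 poisson_tail_low_tendsto) simp
    then show "(\<lambda>N. sqrt (poisson_tail (2 * N) (2 * (N - Suc (i N))) / poisson_tail (2 * N) 0)) \<longlonglongrightarrow> sqrt (erfc (- x) / 2)" by simp
    show "\<forall>\<^sub>F N in sequentially. sqrt (poisson_tail (2 * N) (Suc (2 * (N - Suc (i N)))) / poisson_tail (2 * N) 1) \<le> tail_ratio N (N - Suc (i N))"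
      using eventually_gt_at_top[of 0] by eventually_elim (use tail_ratio_between(1) in simp)
    show "\<forall>\<^sub>F N in sequentially. tail_ratio N (N - Suc (i N)) \<le> sqrt (poisson_tail (2 * N) (2 * (N - Suc (i N))) / poisson_tail (2 * N) 0)"
      using eventually_gt_at_top[of 0] by eventually_elim (rule tail_ratio_between(2))
  qed
qed

lemma shifted_index_tendsto:
  fixes i :: "nat \<Rightarrow> nat"
  assumes i: "(\<lambda>N. real (i N) / sqrt N) \<longlonglongrightarrow> x"
  shows "(\<lambda>N. real (2 * i N + c) / sqrt N) \<longlonglongrightarrow> 2 * x"
proof -
  have "(\<lambda>N. 2 * (real (i N) / sqrt N) + real c * (1 / sqrt N)) \<longlonglongrightarrow> 2 * x + real c * 0"
    by (intro tendsto_intros i inverse_sqrt_tendsto)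
  then show ?thesis by (simp add: add_divide_distrib)
qed

text \<open>Completing the square: \<open>- x^2 / 2 - z^2 - 2 * x * z\<close> is
  \<open>z^2 - 2 * (z + x / 2)^2\<close>. The factor \<open>sqrt 2\<close> stems from the half in
  \<open>erfc (- x) / 2\<close>.\<close>

lemma edge_density_limit_eq:
  assumes "x \<ge> 0"
  shows "complex_of_real (exp (- x\<^sup>2 / 2) * (1 / sqrt (erfc (- x) / 2))) * exp (- z\<^sup>2 - complex_of_real (2 * x) * z) =
    complex_of_real (sqrt 2) * exp (z\<^sup>2) * edge_density z x"
proof -
  have "complex_of_real (exp (- x\<^sup>2 / 2)) * exp (- z\<^sup>2 - complex_of_real (2 * x) * z) =
      exp (z\<^sup>2) * exp (- 2 * (z + complex_of_real x / 2)\<^sup>2)"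
    unfolding exp_of_real[symmetric] exp_add[symmetric]
    by (rule arg_cong[where f = exp]) (simp add: power2_eq_square field_simps)
  moreover have "1 / sqrt (erfc (- x) / 2) = sqrt 2 / sqrt (erfc (- x))"
    by (simp add: real_sqrt_divide)
  ultimately show ?thesis by (simp add: edge_density_def mult_ac)
qed

text \<open>Here the tail ratio stands over a full tail, in \<open>even_term\<close> it is the
  denominator. Since it tends to the square root of the limit of the tail, odd and even terms have
  the same limit.\<close>

lemma odd_term_tendsto:
  fixes i :: "nat \<Rightarrow> nat"
  assumes z: "zs \<longlonglongrightarrow> z" and i: "(\<lambda>N. real (i N) / sqrt N) \<longlonglongrightarrow> x" and x: "x \<ge> 0"
  shows "(\<lambda>N. odd_term N (zs N) (i N)) \<longlonglongrightarrow> complex_of_real (sqrt 2) * exp (z\<^sup>2) * edge_density z x"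
proof -
  have e: "erfc (- x) \<ge> 1" using x by (intro erfc_ge_1) simp
  have "(\<lambda>N. odd_term N (zs N) (i N)) \<longlonglongrightarrow>
     complex_of_real (exp (- x\<^sup>2 / 2) * (sqrt (erfc (- x) / 2) / (erfc (- x) / 2))) * exp (- z\<^sup>2 - complex_of_real (2 * x) * z)"
    unfolding odd_term_def using e
    by (intro tendsto_mult tendsto_of_real tendsto_divide falling_tendsto[OF filterlim_ident] tail_ratio_tendsto[OF i x]
          growth_tendsto[OF z] shifted_index_tendsto[OF i] i) auto
  moreover have "sqrt (erfc (- x) / 2) / (erfc (- x) / 2) = 1 / sqrt (erfc (- x) / 2)"
    using e by (simp add: real_div_sqrt field_simps)
  ultimately show ?thesis using edge_density_limit_eq[OF x, of z] by (simp only:)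
qed

lemma even_term_tendsto:
  fixes i :: "nat \<Rightarrow> nat"
  assumes z: "zs \<longlonglongrightarrow> z" and i: "(\<lambda>N. real (i N) / sqrt N) \<longlonglongrightarrow> x" and x: "x \<ge> 0"
  shows "(\<lambda>N. even_term N (zs N) (i N)) \<longlonglongrightarrow> complex_of_real (sqrt 2) * exp (z\<^sup>2) * edge_density z x"
proof -
  have e: "erfc (- x) \<ge> 1" using x by (intro erfc_ge_1) simp
  have "(\<lambda>N. even_term N (zs N) (i N)) \<longlonglongrightarrow>
     complex_of_real (exp (- x\<^sup>2 / 2) / sqrt (erfc (- x) / 2)) * exp (- z\<^sup>2 - complex_of_real (2 * x) * z)"
    unfolding even_term_def using e
    by (intro tendsto_mult tendsto_of_real tendsto_divide falling_tendsto[OF filterlim_ident] tail_ratio_tendsto[OF i x]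
          growth_tendsto[OF z] shifted_index_tendsto[OF i] i) auto
  then show ?thesis using edge_density_limit_eq[OF x, of z] by simp
qed

section \<open>Dominated convergence of the double sum\<close>

definition term_bound :: "real \<Rightarrow> real \<Rightarrow> real" where
  "term_bound R x = 4 * exp (4 * R\<^sup>2 + 4 * R) * exp (- x\<^sup>2 / 2 + (2 + 4 * R) * x)"

lemma term_bound_integrable: "set_integrable lborel {0..} (term_bound R)"
  unfolding term_bound_def by (rule set_integrable_gaussian)

lemma term_bound_nonneg: "term_bound R x \<ge> 0"
  by (simp add: term_bound_def)

text \<open>The factor \<open>c\<close> is the part made of tails: under
  \<open>tails_bounded\<close> it is at most 4 in the odd terms and at most 2 in the even ones.
  Since \<open>sqrt N \<ge> 1\<close>, the offset 2 in the bound on \<open>d\<close> costs only a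
  constant factor.\<close>

lemma norm_term_le:
  assumes N4: "4 * R\<^sup>2 < real N" and z: "cmod z \<le> R" and i: "i < N"
    and x: "x \<ge> 0" "real i \<le> sqrt N * x" "sqrt N * x < real i + 1"
    and s: "0 \<le> s" "s \<le> 1" and c: "0 \<le> c" "c \<le> 4" and d: "d \<le> 2 * i + 2"
  shows "cmod (complex_of_real (falling s N i * c) * growth N z d) \<le> term_bound R x"
proof -
  have R: "R \<ge> 0" using order_trans[OF norm_ge_zero z] .
  have N: "sqrt (real N) \<ge> 1" using i by simp
  have "real d / sqrt N \<le> (2 * (sqrt N * x) + 2) / sqrt N"
    using x d by (intro divide_right_mono) auto
  also have "\<dots> = 2 * x + 2 / sqrt N" using N by (simp add: add_divide_distrib)
  also have "\<dots> \<le> 2 * x + 2" using N by (simp add: divide_le_eq)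
  finally have "2 * R * (real d / sqrt N) \<le> 2 * R * (2 * x + 2)"
    using R by (intro mult_left_mono) auto
  moreover have "cmod (growth N z d) \<le> exp (4 * R\<^sup>2 + 2 * R * (real d / sqrt N))"
    using N4 z d i by (intro norm_growth_le) auto
  moreover have "4 * R\<^sup>2 + 2 * R * (2 * x + 2) = (4 * R\<^sup>2 + 4 * R) + 4 * R * x" by (simp add: algebra_simps)
  ultimately have g: "cmod (growth N z d) \<le> exp ((4 * R\<^sup>2 + 4 * R) + 4 * R * x)"
    by (smt (verit) exp_le_cancel_iff)
  have f: "falling s N i \<le> exp (- x\<^sup>2 / 2 + 2 * x)" "falling s N i \<ge> 0"
    using falling_cell_bound[OF i s x] falling_nonneg[of i N s] i s by auto
  have "cmod (complex_of_real (falling s N i * c) * growth N z d) = falling s N i * c * cmod (growth N z d)"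
    using f c by (simp add: norm_mult)
  also have "\<dots> \<le> exp (- x\<^sup>2 / 2 + 2 * x) * 4 * exp ((4 * R\<^sup>2 + 4 * R) + 4 * R * x)"
    using f c g by (intro mult_mono) auto
  also have "\<dots> = term_bound R x"
  proof -
    have e: "- x\<^sup>2 / 2 + (2 + 4 * R) * x = (- x\<^sup>2 / 2 + 2 * x) + 4 * R * x" by (simp add: algebra_simps)
    show ?thesis unfolding term_bound_def e exp_add by (simp only: mult_ac)
  qed
  finally show ?thesis .
qed

lemma odd_term_cell_bound:
  assumes N4: "4 * R\<^sup>2 < real N" and z: "cmod z \<le> R" and t: "tails_bounded N"
  shows "cell_bound N (odd_term N z) (term_bound R)"
  unfolding cell_bound_def
proof (intro conjI allI impI)
  show N: "N > 0" by (rule small_quotient[OF N4 z])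
  fix i x assume i: "i < N" and x: "(x::real) \<ge> 0" "real i \<le> sqrt N * x" "sqrt N * x < real i + 1"
  let ?P = "poisson_tail (2 * N) (Suc (2 * (N - Suc i)))"
  have P: "?P \<ge> 1 / 4" using t i by (simp add: tails_bounded_def)
  have B: "tail_ratio N (N - Suc i) \<le> 1" "tail_ratio N (N - Suc i) > 0"
    using tail_ratio_le_1[OF N] tail_ratio_pos[OF N] by auto
  have "tail_ratio N (N - Suc i) / ?P \<le> 1 / (1 / 4)" using B P by (intro frac_le) auto
  then show "cmod (odd_term N z i) \<le> term_bound R x"
    unfolding odd_term_def using N4 z i x B P by (intro norm_term_le) auto
qed

lemma even_term_cell_bound:
  assumes N4: "4 * R\<^sup>2 < real N" and z: "cmod z \<le> R" and t: "tails_bounded N"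
  shows "cell_bound N (\<lambda>j. if i \<le> j then even_term N z j else 0) (term_bound R)"
  unfolding cell_bound_def
proof (intro conjI allI impI)
  show N: "N > 0" by (rule small_quotient[OF N4 z])
  fix j x assume j: "j < N" and x: "(x::real) \<ge> 0" "real j \<le> sqrt N * x" "sqrt N * x < real j + 1"
  have B: "tail_ratio N (N - Suc j) \<ge> 1 / 2"
    using tail_ratio_ge[OF N t] j by simp
  have c: "1 / tail_ratio N (N - Suc j) \<le> 4" "0 \<le> 1 / tail_ratio N (N - Suc j)" using B by (auto simp: divide_le_eq)
  have "even_term N z j = complex_of_real (falling 1 N j * (1 / tail_ratio N (N - Suc j))) * growth N z (2 * j + 2)"
    by (simp add: even_term_def)
  also have "cmod \<dots> \<le> term_bound R x"
    using N4 z j x c by (intro norm_term_le) auto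
  finally show "cmod (if i \<le> j then even_term N z j else 0) \<le> term_bound R x"
    by (simp add: term_bound_nonneg)
qed

context
  fixes R :: real and ws :: "nat \<Rightarrow> complex" and w :: complex
  assumes ws: "ws \<longlonglongrightarrow> w" and ws_le: "\<And>N. cmod (ws N) \<le> R"
begin

lemma eventually_tails_bounded_large: "eventually (\<lambda>N. 4 * R\<^sup>2 < real N \<and> tails_bounded N) sequentially"
  using eventually_real_gt eventually_tails_bounded by (rule eventually_conj)

text \<open>The cut-off \<open>i N\<close> moves with \<open>N\<close>, so the limiting integral
  starts at \<open>x\<close>; this is the pointwise convergence that the outer sum asks for.\<close>

lemma even_sum_tendsto:
  assumes i: "(\<lambda>N. real (i N) / sqrt (real N)) \<longlonglongrightarrow> x" and x: "x \<ge> 0"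
  shows "(\<lambda>N. even_sum N (ws N) (i N)) \<longlonglongrightarrow> complex_of_real (sqrt 2) * exp (w\<^sup>2) * edge_tail w x"
proof -
  let ?c = "complex_of_real (sqrt 2) * exp (w\<^sup>2)"
  have "(\<lambda>N. even_sum N (ws N) (i N)) \<longlonglongrightarrow> (LINT y:{0..}|lborel. if x \<le> y then ?c * edge_density w y else 0)"
    unfolding even_sum_def
  proof (rule riemann_sum_tendsto[OF filterlim_ident term_bound_integrable[of R] term_bound_nonneg])
    show "eventually (\<lambda>N. cell_bound N (\<lambda>j. if i N \<le> j then even_term N (ws N) j else 0) (term_bound R)) sequentially"
      using eventually_tails_bounded_large by eventually_elim (auto intro: even_term_cell_bound ws_le)
    show "AE y in lborel. 0 < y \<longrightarrow> (\<lambda>N. if i N \<le> nat \<lfloor>sqrt (real N) * y\<rfloor> then even_term N (ws N) (nat \<lfloor>sqrt (real N) * y\<rfloor>) else 0)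
        \<longlonglongrightarrow> (if x \<le> y then ?c * edge_density w y else 0)"
      using AE_lborel_singleton[of x]
    proof eventually_elim
      case (elim y)
      show ?case
      proof
        assume y: "0 < y"
        define j where "j N = nat \<lfloor>sqrt (real N) * y\<rfloor>" for N
        have j: "(\<lambda>N. real (j N) / sqrt (real N)) \<longlonglongrightarrow> y"
          unfolding j_def using y by (intro floor_div_tendsto[of "\<lambda>N. N"] filterlim_ident) auto
        have E: "(\<lambda>N. even_term N (ws N) (j N)) \<longlonglongrightarrow> ?c * edge_density w y"
          using y by (intro even_term_tendsto ws j) auto
        have "(\<lambda>N. if i N \<le> j N then even_term N (ws N) (j N) else 0) \<longlonglongrightarrow> (if x \<le> y then ?c * edge_density w y else 0)"
          by (rule truncation_tendsto[OF filterlim_ident i j elim E])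
        then show "(\<lambda>N. if i N \<le> nat \<lfloor>sqrt (real N) * y\<rfloor> then even_term N (ws N) (nat \<lfloor>sqrt (real N) * y\<rfloor>) else 0)
          \<longlonglongrightarrow> (if x \<le> y then ?c * edge_density w y else 0)" unfolding j_def .
      qed
    qed
  qed measurable
  also have "(LINT y:{0..}|lborel. if x \<le> y then ?c * edge_density w y else 0) = ?c * edge_tail w x"
  proof -
    have "(LINT y:{0..}|lborel. if x \<le> y then ?c * edge_density w y else 0) = (LINT y:{x..}|lborel. ?c * edge_density w y)"
      unfolding set_lebesgue_integral_def using x
      by (intro Bochner_Integration.integral_cong refl) (auto simp: indicator_def)
    then show ?thesis by (simp add: edge_tail_def)
  qed
  finally show ?thesis .
qed

text \<open>The inner sums are bounded by one constant \<open>C\<close> for all indices and all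
  large \<open>N\<close>, so \<open>C\<close> times the majorant of the odd terms dominates the
  outer sum.\<close>

lemma double_sum_tendsto:
  assumes zs: "zs \<longlonglongrightarrow> z" and zs_le: "\<And>N. cmod (zs N) \<le> R"
  shows "(\<lambda>N. double_sum N (zs N) (ws N)) \<longlonglongrightarrow>
    2 * exp (z\<^sup>2 + w\<^sup>2) * (LINT x:{0..}|lborel. edge_density z x * edge_tail w x)"
proof -
  define C where "C = (LINT x:{0..}|lborel. term_bound R x)"
  have C: "C \<ge> 0"
    unfolding C_def set_lebesgue_integral_def by (intro integral_nonneg_AE) (auto simp: term_bound_nonneg)
  have "(\<lambda>N. double_sum N (zs N) (ws N)) \<longlonglongrightarrow>
      (LINT x:{0..}|lborel. 2 * exp (z\<^sup>2 + w\<^sup>2) * (edge_density z x * edge_tail w x))"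
    unfolding double_sum_def
  proof (rule riemann_sum_tendsto[where D = "\<lambda>x. C * term_bound R x", OF filterlim_ident])
    show "set_integrable lborel {0..} (\<lambda>x. C * term_bound R x)"
      by (intro set_integrable_mult_right term_bound_integrable)
    show "C * term_bound R x \<ge> 0" for x using C term_bound_nonneg by simp
    show "eventually (\<lambda>N. cell_bound N (\<lambda>i. odd_term N (zs N) i * even_sum N (ws N) i) (\<lambda>x. C * term_bound R x)) sequentially"
      using eventually_tails_bounded_large
    proof eventually_elim
      case (elim N)
      have "cmod (even_sum N (ws N) i) \<le> C" for i
        unfolding even_sum_def C_def using elim
        by (intro norm_riemann_sum_le term_bound_integrable even_term_cell_bound term_bound_nonneg ws_le) auto
      moreover have "cell_bound N (odd_term N (zs N)) (term_bound R)"
        using elim by (intro odd_term_cell_bound zs_le) auto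
      ultimately show ?case
        unfolding cell_bound_def norm_mult mult.commute[of C]
        by (auto intro!: mult_mono term_bound_nonneg)
    qed
    show "AE x in lborel. 0 < x \<longrightarrow> (\<lambda>N. odd_term N (zs N) (nat \<lfloor>sqrt (real N) * x\<rfloor>) * even_sum N (ws N) (nat \<lfloor>sqrt (real N) * x\<rfloor>))
        \<longlonglongrightarrow> 2 * exp (z\<^sup>2 + w\<^sup>2) * (edge_density z x * edge_tail w x)"
    proof (rule AE_I2, rule impI)
      fix x :: real assume x: "0 < x"
      define i where "i N = nat \<lfloor>sqrt (real N) * x\<rfloor>" for N
      have i: "(\<lambda>N. real (i N) / sqrt (real N)) \<longlonglongrightarrow> x"
        unfolding i_def using x by (intro floor_div_tendsto[of "\<lambda>N. N"] filterlim_ident) auto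
      have "(\<lambda>N. odd_term N (zs N) (i N) * even_sum N (ws N) (i N)) \<longlonglongrightarrow>
          (complex_of_real (sqrt 2) * exp (z\<^sup>2) * edge_density z x) * (complex_of_real (sqrt 2) * exp (w\<^sup>2) * edge_tail w x)"
        using x by (intro tendsto_mult odd_term_tendsto even_sum_tendsto zs i) auto
      also have "(complex_of_real (sqrt 2) * exp (z\<^sup>2) * edge_density z x) * (complex_of_real (sqrt 2) * exp (w\<^sup>2) * edge_tail w x) =
          (complex_of_real (sqrt 2) * complex_of_real (sqrt 2)) * (exp (z\<^sup>2) * exp (w\<^sup>2)) * (edge_density z x * edge_tail w x)"
        by (simp only: mult_ac)
      also have "\<dots> = 2 * exp (z\<^sup>2 + w\<^sup>2) * (edge_density z x * edge_tail w x)"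
        unfolding exp_add[symmetric] of_real_mult[symmetric] by simp
      finally show "(\<lambda>N. odd_term N (zs N) (nat \<lfloor>sqrt (real N) * x\<rfloor>) * even_sum N (ws N) (nat \<lfloor>sqrt (real N) * x\<rfloor>))
        \<longlonglongrightarrow> 2 * exp (z\<^sup>2 + w\<^sup>2) * (edge_density z x * edge_tail w x)" by (simp add: i_def)
    qed
  qed measurable
  then show ?thesis by simp
qed

end

text \<open>The central Poisson weight contributes \<open>1 / (2 * sqrt pi)\<close>, and the two
  factors \<open>sqrt 2\<close> in the limits of odd and even terms restore the 2.\<close>

lemma scaled_kernel_tendsto:
  assumes \<sigma>: "\<sigma> \<in> {1, -1}" and zs: "zs \<longlonglongrightarrow> z" and ws: "ws \<longlonglongrightarrow> w"
  shows "(\<lambda>N. scaled_kernel N \<sigma> (zs N) (ws N)) \<longlonglongrightarrow> edge_kernel z w"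
proof -
  obtain R1 where R1: "\<And>N. cmod (zs N) \<le> R1"
    using convergent_imp_Bseq[of zs] zs by (auto simp: convergent_def Bseq_def)
  obtain R2 where R2: "\<And>N. cmod (ws N) \<le> R2"
    using convergent_imp_Bseq[of ws] ws by (auto simp: convergent_def Bseq_def)
  define R where "R = max R1 R2"
  have zR: "cmod (zs N) \<le> R" and wR: "cmod (ws N) \<le> R" for N
    using R1[of N] R2[of N] by (auto simp: R_def)
  let ?L = "\<lambda>z w. LINT x:{0..}|lborel. edge_density z x * edge_tail w x"
  have "(\<lambda>N. sqrt (real (2 * N)) * poisson_weight (2 * N) (2 * N) / sqrt 2) \<longlonglongrightarrow> 1 / sqrt (2 * pi) / sqrt 2"
    using filterlim_compose[OF stirling filterlim_double] unfolding poisson_weight_def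
    by (intro tendsto_divide tendsto_const) auto
  moreover have "1 / sqrt (2 * pi) / sqrt 2 = 1 / (2 * sqrt pi)" by (simp add: real_sqrt_mult)
  moreover have "sqrt (real (2 * N)) * poisson_weight (2 * N) (2 * N) / sqrt 2 = sqrt N * poisson_weight (2 * N) (2 * N)" for N
    by (simp add: real_sqrt_mult)
  ultimately have S: "(\<lambda>N. sqrt (real N) * poisson_weight (2 * N) (2 * N)) \<longlonglongrightarrow> 1 / (2 * sqrt pi)" by simp
  have "(\<lambda>N. complex_of_real (sqrt N * poisson_weight (2 * N) (2 * N)) * (double_sum N (zs N) (ws N) - double_sum N (ws N) (zs N))) \<longlonglongrightarrow>
      complex_of_real (1 / (2 * sqrt pi)) * (2 * exp (z\<^sup>2 + w\<^sup>2) * ?L z w - 2 * exp (w\<^sup>2 + z\<^sup>2) * ?L w z)"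
    by (intro tendsto_mult tendsto_of_real S tendsto_diff double_sum_tendsto[where R = R] zs ws zR wR)
  also have "complex_of_real (1 / (2 * sqrt pi)) * (2 * exp (z\<^sup>2 + w\<^sup>2) * ?L z w - 2 * exp (w\<^sup>2 + z\<^sup>2) * ?L w z) = edge_kernel z w"
  proof -
    have comm: "w\<^sup>2 + z\<^sup>2 = z\<^sup>2 + w\<^sup>2" by (rule add.commute)
    show ?thesis unfolding edge_kernel_eq comm right_diff_distrib by simp
  qed
  finally have lim: "(\<lambda>N. complex_of_real (sqrt N * poisson_weight (2 * N) (2 * N)) * (double_sum N (zs N) (ws N) - double_sum N (ws N) (zs N))) \<longlonglongrightarrow> edge_kernel z w" .
  have "eventually (\<lambda>N. scaled_kernel N \<sigma> (zs N) (ws N) =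
      complex_of_real (sqrt N * poisson_weight (2 * N) (2 * N)) * (double_sum N (zs N) (ws N) - double_sum N (ws N) (zs N))) sequentially"
    using eventually_gt_at_top[of 0] by eventually_elim (rule scaled_kernel_eq[OF _ \<sigma>])
  then show ?thesis using lim by (simp add: tendsto_cong)
qed


subsection \<open>Continuous convergence\<close>

text \<open>Each value is repeated on the stretch of indices just before its own, \<open>m N\<close>
  being the first position whose index reaches \<open>N\<close>. This makes a hypothesis about full
  sequences applicable to a counterexample that lives on a subsequence.\<close>

lemma strict_mono_interpolate:
  fixes r :: "nat \<Rightarrow> nat" and x :: "nat \<Rightarrow> 'a::topological_space"
  assumes r: "strict_mono r" and x: "x \<longlonglongrightarrow> l"
  obtains y where "y \<longlonglongrightarrow> l" "\<And>n. y (r n) = x n" "range y \<subseteq> range x"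
proof
  define m where "m N = (LEAST n. N \<le> r n)" for N
  have ex: "\<exists>n. N \<le> r n" for N using strict_mono_imp_increasing[OF r] by blast
  have m: "N \<le> r (m N)" for N unfolding m_def by (rule LeastI_ex[OF ex])
  have "filterlim m at_top sequentially"
    unfolding filterlim_at_top
  proof safe
    fix Z
    have "Z \<le> m N" if "N \<ge> r Z" for N
    proof -
      have "r Z \<le> r (m N)" using m[of N] that by linarith
      then show ?thesis using strict_mono_less_eq[OF r] by blast
    qed
    then show "eventually (\<lambda>N. Z \<le> m N) sequentially" by (auto simp: eventually_sequentially)
  qed
  then show "(\<lambda>N. x (m N)) \<longlonglongrightarrow> l" by (rule filterlim_compose[OF x])
  have "m (r n) = n" for n
    unfolding m_def by (rule Least_equality) (use strict_mono_less_eq[OF r] in auto)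
  then show "x (m (r n)) = x n" for n by simp
qed auto

text \<open>Convergence along every convergent sequence of arguments is joint convergence, which is locally
  uniform and forces the limit to be continuous.\<close>

lemma continuous_convergence_joint:
  fixes f :: "nat \<Rightarrow> 'a::metric_space \<Rightarrow> 'b::metric_space"
  assumes conv: "\<And>x xs. xs \<longlonglongrightarrow> x \<Longrightarrow> (\<lambda>N. f N (xs N)) \<longlonglongrightarrow> g x" and e: "e > 0"
  shows "\<exists>N0. \<exists>d>0. \<forall>N\<ge>N0. \<forall>y. dist y x < d \<longrightarrow> dist (f N y) (g x) < e"
proof (rule ccontr)
  assume "\<not> ?thesis"
  then have bad: "\<exists>N\<ge>N0. \<exists>y. dist y x < d \<and> dist (f N y) (g x) \<ge> e" if "d > 0" for N0 d
    using that by (meson not_le)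
  define P where "P n p \<longleftrightarrow> dist (snd p) x < 1 / real (Suc n) \<and> dist (f (fst p) (snd p)) (g x) \<ge> e" for n :: nat and p
  have "\<exists>h. \<forall>n. P n (h n) \<and> fst (h n) < fst (h (Suc n))"
  proof (rule dependent_nat_choice)
    show "\<exists>p. P 0 p" using bad[of 1 0] by (auto simp: P_def)
    fix p :: "nat \<times> 'a" and n
    show "\<exists>q. P (Suc n) q \<and> fst p < fst q"
      using bad[of "1 / real (Suc (Suc n))" "Suc (fst p)"] by (auto simp: P_def Suc_le_eq)
  qed
  then obtain h where h: "\<And>n. P n (h n)" "\<And>n. fst (h n) < fst (h (Suc n))" by blast
  have r: "strict_mono (\<lambda>n. fst (h n))" using h(2) by (simp add: strict_mono_Suc_iff)
  have "(\<lambda>n. snd (h n)) \<longlonglongrightarrow> x"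
  proof (rule metric_tendsto_imp_tendsto)
    show "(\<lambda>n. 1 / real (Suc n)) \<longlonglongrightarrow> 0" using LIMSEQ_inverse_real_of_nat by (simp add: inverse_eq_divide)
    show "eventually (\<lambda>n. dist (snd (h n)) x \<le> dist (1 / real (Suc n)) 0) sequentially"
      using h(1) by (auto simp: P_def less_imp_le)
  qed
  from strict_mono_interpolate[OF r this] obtain y where y: "y \<longlonglongrightarrow> x" "\<And>n. y (fst (h n)) = snd (h n)" by metis
  have "(\<lambda>n. f (fst (h n)) (y (fst (h n)))) \<longlonglongrightarrow> g x"
    using LIMSEQ_subseq_LIMSEQ[OF conv[OF y(1)] r] by (simp add: comp_def)
  then have "eventually (\<lambda>n. dist (f (fst (h n)) (y (fst (h n)))) (g x) < e) sequentially"
    using e by (rule tendstoD)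
  then obtain n where "dist (f (fst (h n)) (snd (h n))) (g x) < e" using y(2) by (auto simp: eventually_sequentially)
  then show False using h(1)[of n] by (simp add: P_def)
qed

text \<open>Constant sequences of arguments give pointwise convergence, under which the strict bound
  becomes a weak one.\<close>

lemma continuous_convergence_dist_limit:
  fixes f :: "nat \<Rightarrow> 'a::metric_space \<Rightarrow> 'b::metric_space"
  assumes conv: "\<And>x xs. xs \<longlonglongrightarrow> x \<Longrightarrow> (\<lambda>N. f N (xs N)) \<longlonglongrightarrow> g x"
    and "\<And>N. N \<ge> M \<Longrightarrow> dist (f N y) c < e"
  shows "dist (g y) c \<le> e"
proof (rule tendsto_upperbound)
  show "(\<lambda>N. dist (f N y) c) \<longlonglongrightarrow> dist (g y) c"
    by (intro tendsto_intros conv[of "\<lambda>_. y"])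
  show "eventually (\<lambda>N. dist (f N y) c \<le> e) sequentially"
    by (rule eventually_sequentiallyI[of M], rule less_imp_le, rule assms(2))
qed simp

lemma continuous_convergence_imp_continuous:
  fixes f :: "nat \<Rightarrow> 'a::metric_space \<Rightarrow> 'b::metric_space"
  assumes conv: "\<And>x xs. xs \<longlonglongrightarrow> x \<Longrightarrow> (\<lambda>N. f N (xs N)) \<longlonglongrightarrow> g x"
  shows "continuous_on UNIV g"
  unfolding continuous_on_iff
proof safe
  fix x :: 'a and e :: real assume e: "e > 0"
  have "\<exists>N0. \<exists>d>0. \<forall>N\<ge>N0. \<forall>y. dist y x < d \<longrightarrow> dist (f N y) (g x) < e / 2"
    by (rule continuous_convergence_joint[OF conv]) (use e in auto)
  then obtain N0 d where d: "d > 0" "\<And>N y. N \<ge> N0 \<Longrightarrow> dist y x < d \<Longrightarrow> dist (f N y) (g x) < e / 2"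
    by blast
  have "dist (g y) (g x) < e" if "dist y x < d" for y
  proof -
    have "dist (g y) (g x) \<le> e / 2"
      by (rule continuous_convergence_dist_limit[OF conv, where M = N0]) (use d(2) that in auto)
    then show ?thesis using e by linarith
  qed
  then show "\<exists>d>0. \<forall>y\<in>UNIV. dist y x < d \<longrightarrow> dist (g y) (g x) < e" using d(1) by blast
qed

text \<open>Near each \<open>x\<close>, joint convergence compares both \<open>f N y\<close> and
  \<open>g y\<close> with the one value \<open>g x\<close>; finitely many such neighbourhoods cover
  \<open>K\<close>.\<close>

lemma continuous_convergence_imp_uniform_limit:
  fixes f :: "nat \<Rightarrow> 'a::metric_space \<Rightarrow> 'b::metric_space"
  assumes conv: "\<And>x xs. xs \<longlonglongrightarrow> x \<Longrightarrow> (\<lambda>N. f N (xs N)) \<longlonglongrightarrow> g x" and K: "compact K"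
  shows "uniform_limit K f g sequentially"
  unfolding uniform_limit_iff
proof safe
  fix e :: real assume e: "e > 0"
  have "\<exists>N0. \<exists>d>0. \<forall>N\<ge>N0. \<forall>y. dist y x < d \<longrightarrow> dist (f N y) (g x) < e / 2" for x
    by (rule continuous_convergence_joint[OF conv]) (use e in auto)
  then obtain N0 d where d: "\<And>x. d x > 0" "\<And>x N y. N \<ge> N0 x \<Longrightarrow> dist y x < d x \<Longrightarrow> dist (f N y) (g x) < e / 2"
    by metis
  obtain C where C: "C \<subseteq> K" "finite C" "K \<subseteq> (\<Union>x\<in>C. ball x (d x))"
  proof (rule compactE_image[OF K, of K "\<lambda>x. ball x (d x)"])
    show "K \<subseteq> (\<Union>x\<in>K. ball x (d x))" using d(1) by auto
  qed auto
  have "eventually (\<lambda>N. \<forall>x\<in>C. N \<ge> N0 x) sequentially"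
    using C(2) by (simp add: eventually_ball_finite eventually_ge_at_top)
  then show "\<forall>\<^sub>F N in sequentially. \<forall>y\<in>K. dist (f N y) (g y) < e"
  proof eventually_elim
    case (elim N)
    show ?case
    proof
      fix y assume "y \<in> K"
      then obtain x where x: "x \<in> C" "dist y x < d x" using C(3) by (auto simp: dist_commute)
      have "dist (f N y) (g x) < e / 2" using d(2) x elim by blast
      moreover have "dist (g y) (g x) \<le> e / 2"
        by (rule continuous_convergence_dist_limit[OF conv, where M = "N0 x"]) (use d(2) x(2) in auto)
      ultimately show "dist (f N y) (g y) < e" using dist_triangle2[of "f N y" "g y" "g x"] by linarith
    qed
  qed
qed


subsection \<open>Convergence of the correlation functions\<close>

lemma pfaffian_cong:
  assumes "\<And>a b. a < 2 * k \<Longrightarrow> b < 2 * k \<Longrightarrow> A a b = B a b"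
  shows "pfaffian k A = pfaffian k B"
proof -
  have "\<pi> x < 2 * k" if "\<pi> permutes {..<2 * k}" "x < 2 * k" for \<pi> x
    using that permutes_in_image by fastforce
  then show ?thesis
    unfolding pfaffian_def
    by (intro arg_cong2[where f = "(*)"] refl sum.cong prod.cong assms) auto
qed

text \<open>Every letter occurs exactly once in each product of the Pfaffian, so factors attached to
  rows and columns come out as one product.\<close>

lemma pfaffian_scale:
  "pfaffian k (\<lambda>a b. t * (c a * c b) * A a b) = t ^ k * (\<Prod>j<k. c (2 * j) * c (Suc (2 * j))) * pfaffian k A"
proof -
  have "(\<Prod>j<k. t * (c (\<pi> (2 * j)) * c (\<pi> (2 * j + 1))) * A (\<pi> (2 * j)) (\<pi> (2 * j + 1))) =
      t ^ k * (\<Prod>j<k. c (2 * j) * c (Suc (2 * j))) * (\<Prod>j<k. A (\<pi> (2 * j)) (\<pi> (2 * j + 1)))"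
    if \<pi>: "\<pi> permutes {..<2 * k}" for \<pi>
  proof -
    have "(\<Prod>j<k. c (\<pi> (2 * j)) * c (\<pi> (2 * j + 1))) = (\<Prod>a<2 * k. c (\<pi> a))"
      unfolding prod_lessThan_double by simp
    also have "\<dots> = (\<Prod>a<2 * k. c a)"
      using prod.permute[OF \<pi>, of c] by (simp add: comp_def)
    finally show ?thesis unfolding prod_lessThan_double by (simp add: prod.distrib)
  qed
  then have "(\<Sum>\<pi> | \<pi> permutes {..<2 * k}. of_int (sign \<pi>) *
        (\<Prod>j<k. t * (c (\<pi> (2 * j)) * c (\<pi> (2 * j + 1))) * A (\<pi> (2 * j)) (\<pi> (2 * j + 1)))) =
      t ^ k * (\<Prod>j<k. c (2 * j) * c (Suc (2 * j))) *
        (\<Sum>\<pi> | \<pi> permutes {..<2 * k}. of_int (sign \<pi>) * (\<Prod>j<k. A (\<pi> (2 * j)) (\<pi> (2 * j + 1))))"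
    unfolding sum_distrib_left by (intro sum.cong refl) (simp add: mult_ac)
  then show ?thesis
    unfolding pfaffian_def by (simp only: mult_ac)
qed

text \<open>The edge point is real, so conjugation acts on the rescaled coordinate; the conjugate
  variable of a point can be fed to the same kernel.\<close>

lemma rescale_cnj:
  assumes "\<sigma> \<in> {1, -1}"
  shows "cnj (rescale N \<sigma> z) = rescale N \<sigma> (cnj z)"
  using assms by (auto simp: rescale_def)

lemma rescale_diff:
  assumes "\<sigma> \<in> {1, -1}"
  shows "rescale N \<sigma> z - cnj (rescale N \<sigma> z) = \<sigma> * complex_of_real (scale N) * (z - cnj z)"
  unfolding rescale_cnj[OF assms] by (simp add: rescale_def scale_def real_sqrt_divide algebra_simps diff_divide_distrib)

text \<open>This is the exponent of the weight near the edge. It also tells when a point lies in the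
  disk: the terms after \<open>2 * real N\<close> must have a sum that is not positive.\<close>

lemma cmod_rescale_sq:
  assumes N: "N > 0" and \<sigma>: "\<sigma> \<in> {1, -1}"
  shows "real N * (cmod (rescale N \<sigma> z))\<^sup>2 = 2 * real N + 4 * sqrt N * Re z + 2 * (cmod z)\<^sup>2"
proof -
  define q where "q = sqrt (real N)"
  have q: "q > 0" "real N = q\<^sup>2" using N by (simp_all add: q_def)
  have "(cmod (rescale N \<sigma> z))\<^sup>2 = 2 * (cmod (1 + z / complex_of_real q))\<^sup>2"
    using \<sigma> by (auto simp: rescale_def norm_mult power_mult_distrib q_def)
  also have "(cmod (1 + z / complex_of_real q))\<^sup>2 = (1 + Re z / q)\<^sup>2 + (Im z / q)\<^sup>2"
    by (simp add: cmod_power2)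
  finally show ?thesis unfolding q_def[symmetric] cmod_power2 unfolding q(2)
    using q(1) by (simp add: power2_eq_square field_simps)
qed

text \<open>The factor \<open>exp (- 2 * sqrt N * z)\<close> in \<^const>\<open>scaled_kernel\<close> differs from the square root of the weight
  by a phase, which cancels in the Pfaffian because \<open>z\<close> and \<open>cnj z\<close> occur equally often.\<close>

lemma rescaled_correlation_eq:
  assumes N: "N > 0" "k \<le> N" and \<sigma>: "\<sigma> \<in> {1, -1}" and p: "p = \<sigma> * complex_of_real (sqrt 2)"
    and disk: "\<And>j. j < k \<Longrightarrow> cmod (rescale N \<sigma> (z j)) \<le> sqrt 2"
  shows "complex_of_real (rescaled_correlation p \<sigma> N hard_edge_potential k z) =
    (\<Prod>j<k. cnj (z j) - z j) * pfaffian k (\<lambda>a b.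
      complex_of_real (exp (- (cmod (z (a div 2)))\<^sup>2 - (cmod (z (b div 2)))\<^sup>2)) *
      scaled_kernel N \<sigma> (interleave z a) (interleave z b))"
proof -
  define \<zeta> where "\<zeta> = (\<lambda>j\<in>{..<k}. p + \<sigma> * complex_of_real (scale N) * z j)"
  have \<zeta>: "\<zeta> j = rescale N \<sigma> (z j)" if "j < k" for j
    using that by (simp add: \<zeta>_def p rescale_def scale_def real_sqrt_divide algebra_simps)
  have il: "interleave \<zeta> a = rescale N \<sigma> (interleave z a)" if "a < 2 * k" for a
  proof -
    have "a div 2 < k" using that by simp
    then show ?thesis by (simp add: interleave_def \<zeta> rescale_cnj[OF \<sigma>])
  qed
  define A where "A a b = pre_kernel N (rescale N \<sigma> (interleave z a)) (rescale N \<sigma> (interleave z b))" for a b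
  define c where "c a = complex_of_real (exp (- (cmod (z (a div 2)))\<^sup>2)) * exp (- 2 * complex_of_real (sqrt N) * interleave z a)" for a
  define s where "s = complex_of_real (scale N)"
  define E where "E = complex_of_real (exp (- (2 * real N)))"
  have "pfaffian k (\<lambda>a b. complex_of_real (exp (- (cmod (z (a div 2)))\<^sup>2 - (cmod (z (b div 2)))\<^sup>2)) *
      scaled_kernel N \<sigma> (interleave z a) (interleave z b)) = pfaffian k (\<lambda>a b. (s ^ 3 * \<sigma> * E) * (c a * c b) * A a b)"
    by (rule pfaffian_cong)
       (simp add: scaled_kernel_def A_def c_def s_def E_def exp_add[symmetric] exp_of_real[symmetric] distrib_left exp_add exp_diff mult_ac
         exp_minus divide_inverse)
  also have "\<dots> = (s ^ 3 * \<sigma> * E) ^ k * (\<Prod>j<k. c (2 * j) * c (Suc (2 * j))) * pfaffian k A"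
    by (rule pfaffian_scale)
  finally have P: "pfaffian k (\<lambda>a b. complex_of_real (exp (- (cmod (z (a div 2)))\<^sup>2 - (cmod (z (b div 2)))\<^sup>2)) *
      scaled_kernel N \<sigma> (interleave z a) (interleave z b)) =
      (s ^ 3 * \<sigma> * E) ^ k * (\<Prod>j<k. c (2 * j) * c (Suc (2 * j))) * pfaffian k A" .
  have w: "complex_of_real (disk_weight N (\<zeta> j)) = E * (c (2 * j) * c (Suc (2 * j)))" if j: "j < k" for j
  proof -
    have "disk_weight N (\<zeta> j) = exp (- (2 * real N + 4 * sqrt N * Re (z j) + 2 * (cmod (z j))\<^sup>2))"
      using disk[OF j] unfolding disk_weight_eq \<zeta>[OF j] cmod_rescale_sq[OF N(1) \<sigma>] by simp
    then have "complex_of_real (disk_weight N (\<zeta> j)) = exp (complex_of_real (- (2 * real N + 4 * sqrt N * Re (z j) + 2 * (cmod (z j))\<^sup>2)))"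
      by (simp only: exp_of_real)
    also have "complex_of_real (- (2 * real N + 4 * sqrt N * Re (z j) + 2 * (cmod (z j))\<^sup>2)) =
       complex_of_real (- (2 * real N)) +
       (complex_of_real (- (cmod (z j))\<^sup>2) + (- 2 * complex_of_real (sqrt N) * z j) +
        (complex_of_real (- (cmod (z j))\<^sup>2) + (- 2 * complex_of_real (sqrt N) * cnj (z j))))"
      by (simp add: complex_eq_iff)
    finally show ?thesis
      unfolding E_def c_def interleave_simps exp_of_real[symmetric] exp_add by simp
  qed
  have "complex_of_real (correlation N hard_edge_potential k \<zeta>) =
      (\<Prod>j<k. (\<zeta> j - cnj (\<zeta> j)) * complex_of_real (disk_weight N (\<zeta> j))) *
      pfaffian k (\<lambda>a b. - pre_kernel N (interleave \<zeta> a) (interleave \<zeta> b))"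
    by (rule correlation_eq_pfaffian[OF N(2) radial_moment_nonzero[OF N(1)]])
  also have "pfaffian k (\<lambda>a b. - pre_kernel N (interleave \<zeta> a) (interleave \<zeta> b)) = pfaffian k (\<lambda>a b. (- 1) * (1 * 1) * A a b)"
    by (rule pfaffian_cong) (simp add: il A_def)
  also have "\<dots> = (- 1) ^ k * pfaffian k A"
    using pfaffian_scale[of k "- 1" "\<lambda>_. 1" A] by simp
  also have "(\<Prod>j<k. (\<zeta> j - cnj (\<zeta> j)) * complex_of_real (disk_weight N (\<zeta> j))) =
     (\<Prod>j<k. (\<sigma> * s * (z j - cnj (z j))) * (E * (c (2 * j) * c (Suc (2 * j)))))"
    by (intro prod.cong refl) (simp add: w, simp add: \<zeta> rescale_diff[OF \<sigma>] s_def)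
  finally have R: "complex_of_real (correlation N hard_edge_potential k \<zeta>) =
     (\<Prod>j<k. (\<sigma> * s * (z j - cnj (z j))) * (E * (c (2 * j) * c (Suc (2 * j))))) * ((- 1) ^ k * pfaffian k A)" .
  have "complex_of_real (rescaled_correlation p \<sigma> N hard_edge_potential k z) =
     s ^ (2 * k) * complex_of_real (correlation N hard_edge_potential k \<zeta>)"
    by (simp add: rescaled_correlation_def \<zeta>_def s_def)
  also have "\<dots> = (\<Prod>j<k. s\<^sup>2 * (- 1) * ((\<sigma> * s * (z j - cnj (z j))) * (E * (c (2 * j) * c (Suc (2 * j)))))) * pfaffian k A"
  proof -
    have h: "(\<Prod>j<k. s\<^sup>2 * (- 1) * X j) = s ^ (2 * k) * (- 1) ^ k * (\<Prod>j<k. X j)" for X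
      unfolding prod.distrib by (simp add: power_mult)
    show ?thesis unfolding R h by (simp only: mult_ac)
  qed
  also have "(\<Prod>j<k. s\<^sup>2 * (- 1) * ((\<sigma> * s * (z j - cnj (z j))) * (E * (c (2 * j) * c (Suc (2 * j)))))) =
      (\<Prod>j<k. (cnj (z j) - z j) * ((s ^ 3 * \<sigma> * E) * (c (2 * j) * c (Suc (2 * j)))))"
    by (intro prod.cong refl) (simp add: power2_eq_square power3_eq_cube algebra_simps)
  finally show ?thesis unfolding P by (simp add: prod.distrib mult.assoc power_mult_distrib)
qed

section \<open>Uniform limits of Pfaffians and the convergence theorem\<close>

text \<open>Boundedness of the limits is carried along, because multiplying uniform limits uses it
  at every step of the induction.\<close>

lemma uniform_limit_prod:
  fixes f :: "'i \<Rightarrow> 'n \<Rightarrow> 'a \<Rightarrow> complex"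
  assumes "finite J" and "\<And>j. j \<in> J \<Longrightarrow> uniform_limit U (f j) (g j) F" and "\<And>j. j \<in> J \<Longrightarrow> bounded (g j ` U)"
  shows "uniform_limit U (\<lambda>N x. \<Prod>j\<in>J. f j N x) (\<lambda>x. \<Prod>j\<in>J. g j x) F \<and> bounded ((\<lambda>x. \<Prod>j\<in>J. g j x) ` U)"
  using assms
proof (induction J rule: finite_induct)
  case empty
  then show ?case by (auto intro: uniform_limit_const bounded_subset[of "{1}"])
next
  case (insert j J)
  then have IH: "uniform_limit U (\<lambda>N x. \<Prod>j\<in>J. f j N x) (\<lambda>x. \<Prod>j\<in>J. g j x) F"
      "bounded ((\<lambda>x. \<Prod>j\<in>J. g j x) ` U)"
    and j: "uniform_limit U (f j) (g j) F" "bounded (g j ` U)" by auto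
  obtain B1 where B1: "\<And>x. x \<in> U \<Longrightarrow> cmod (g j x) \<le> B1" using j(2) by (auto simp: bounded_iff)
  obtain B2 where B2: "\<And>x. x \<in> U \<Longrightarrow> cmod (\<Prod>j\<in>J. g j x) \<le> B2" using IH(2) by (auto simp: bounded_iff)
  have "cmod (g j x * (\<Prod>j\<in>J. g j x)) \<le> B1 * B2" if "x \<in> U" for x
    unfolding norm_mult using B1[OF that] B2[OF that] order_trans[OF norm_ge_zero B1[OF that]]
    by (intro mult_mono) auto
  then have "bounded ((\<lambda>x. g j x * (\<Prod>j\<in>J. g j x)) ` U)" by (auto simp: bounded_iff)
  then show ?case
    using insert.hyps uniform_lim_mult[OF j(1) IH(1) j(2) IH(2)] by simp
qed

lemma uniform_limit_finite_sum:
  fixes f :: "'i \<Rightarrow> 'n \<Rightarrow> 'a \<Rightarrow> 'b::real_normed_vector"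
  assumes "finite J" and "\<And>j. j \<in> J \<Longrightarrow> uniform_limit U (f j) (g j) F"
  shows "uniform_limit U (\<lambda>N x. \<Sum>j\<in>J. f j N x) (\<lambda>x. \<Sum>j\<in>J. g j x) F"
  using assms by (induction J rule: finite_induct) (auto intro!: uniform_limit_add uniform_limit_const)

lemma uniform_limit_pfaffian:
  assumes lim: "\<And>a b. a < 2 * k \<Longrightarrow> b < 2 * k \<Longrightarrow> uniform_limit U (\<lambda>N x. A N x a b) (\<lambda>x. B x a b) F"
    and bdd: "\<And>a b. a < 2 * k \<Longrightarrow> b < 2 * k \<Longrightarrow> bounded ((\<lambda>x. B x a b) ` U)"
  shows "uniform_limit U (\<lambda>N x. pfaffian k (A N x)) (\<lambda>x. pfaffian k (B x)) F"
    and "bounded ((\<lambda>x. pfaffian k (B x)) ` U)"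
proof -
  let ?p = "\<lambda>\<pi> (M :: nat \<Rightarrow> nat \<Rightarrow> complex). \<Prod>j<k. M (\<pi> (2 * j)) (\<pi> (2 * j + 1))"
  have P: "uniform_limit U (\<lambda>N x. ?p \<pi> (A N x)) (\<lambda>x. ?p \<pi> (B x)) F \<and> bounded ((\<lambda>x. ?p \<pi> (B x)) ` U)"
    if \<pi>: "\<pi> permutes {..<2 * k}" for \<pi>
  proof (rule uniform_limit_prod)
    fix j assume "j \<in> {..<k}"
    then have "\<pi> (2 * j) < 2 * k" "\<pi> (2 * j + 1) < 2 * k" using permutes_in_image[OF \<pi>] by auto
    then show "uniform_limit U (\<lambda>N x. A N x (\<pi> (2 * j)) (\<pi> (2 * j + 1))) (\<lambda>x. B x (\<pi> (2 * j)) (\<pi> (2 * j + 1))) F"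
      "bounded ((\<lambda>x. B x (\<pi> (2 * j)) (\<pi> (2 * j + 1))) ` U)" by (rule lim bdd)+
  qed simp
  have fin: "finite {\<pi>. \<pi> permutes {..<2 * k}}" by (simp add: finite_permutations)
  show "uniform_limit U (\<lambda>N x. pfaffian k (A N x)) (\<lambda>x. pfaffian k (B x)) F"
    unfolding pfaffian_def
    by (intro bounded_linear.uniform_limit[OF bounded_linear_mult_right] uniform_limit_finite_sum fin conjunct1[OF P]) simp
  have "\<forall>\<pi>\<in>{\<pi>. \<pi> permutes {..<2 * k}}. \<exists>M. \<forall>x\<in>U. cmod (?p \<pi> (B x)) \<le> M"
    using P by (auto simp: bounded_iff)
  then obtain M where M: "\<And>\<pi> x. \<pi> permutes {..<2 * k} \<Longrightarrow> x \<in> U \<Longrightarrow> cmod (?p \<pi> (B x)) \<le> M \<pi>"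
    by (metis mem_Collect_eq)
  have "cmod (pfaffian k (B x)) \<le> cmod (1 / (2 ^ k * fact k)) * (\<Sum>\<pi> | \<pi> permutes {..<2 * k}. M \<pi>)" if x: "x \<in> U" for x
    unfolding pfaffian_def norm_mult
  proof (intro mult_left_mono sum_norm_le)
    fix \<pi> assume "\<pi> \<in> {\<pi>. \<pi> permutes {..<2 * k}}"
    moreover have "cmod (of_int (sign \<pi>)) = 1" by (simp add: sign_def)
    ultimately show "cmod (of_int (sign \<pi>) * ?p \<pi> (B x)) \<le> M \<pi>"
      using M[of \<pi> x] x by (simp only: norm_mult) simp
  qed simp
  then show "bounded ((\<lambda>x. pfaffian k (B x)) ` U)" by (auto simp: bounded_iff)
qed

lemma edge_matrix_eq:
  "edge_matrix z a b = complex_of_real (exp (- (cmod (z (a div 2)))\<^sup>2 - (cmod (z (b div 2)))\<^sup>2)) *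
    edge_kernel (interleave z a) (interleave z b)"
  by (simp add: edge_matrix_def interleave_def Let_def)

text \<open>The kernel converges uniformly on a compact product of two disks, and composing with the
  evaluation of two coordinates transports this to configurations. Continuity of the limit gives its
  boundedness there.\<close>

lemma kernel_entry_uniform_limit:
  assumes \<sigma>: "\<sigma> \<in> {1, -1}" and U: "\<And>z j. z \<in> U \<Longrightarrow> j < k \<Longrightarrow> cmod (z j) \<le> R"
    and a: "a < 2 * k" and b: "b < 2 * k"
  shows "uniform_limit U (\<lambda>N z. complex_of_real (exp (- (cmod (z (a div 2)))\<^sup>2 - (cmod (z (b div 2)))\<^sup>2)) *
      scaled_kernel N \<sigma> (interleave z a) (interleave z b)) (\<lambda>z. edge_matrix z a b) sequentially"
    and "bounded ((\<lambda>z. edge_matrix z a b) ` U)"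
proof -
  let ?K = "cball (0::complex) R \<times> cball (0::complex) R"
  let ?e = "\<lambda>z. complex_of_real (exp (- (cmod (z (a div 2)))\<^sup>2 - (cmod (z (b div 2)))\<^sup>2))"
  have conv: "(\<lambda>N. case_prod (scaled_kernel N \<sigma>) (xs N)) \<longlonglongrightarrow> case_prod edge_kernel x" if "xs \<longlonglongrightarrow> x" for x xs
    using scaled_kernel_tendsto[OF \<sigma> tendsto_fst[OF that] tendsto_snd[OF that]] by (simp add: case_prod_unfold)
  have K: "compact ?K" by (intro compact_Times compact_cball)
  have ul: "uniform_limit ?K (\<lambda>N. case_prod (scaled_kernel N \<sigma>)) (case_prod edge_kernel) sequentially"
    by (rule continuous_convergence_imp_uniform_limit[OF conv K])
  have il: "cmod (interleave z a) \<le> R" if "z \<in> U" "a < 2 * k" for z a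
  proof -
    have "a div 2 < k" using that by simp
    then show ?thesis using U[OF that(1)] by (simp add: interleave_def)
  qed
  have "uniform_limit U (\<lambda>N z. case_prod (scaled_kernel N \<sigma>) (interleave z a, interleave z b))
      (\<lambda>z. case_prod edge_kernel (interleave z a, interleave z b)) sequentially"
    by (rule uniform_limit_compose'[OF ul]) (use il a b in auto)
  then have 1: "uniform_limit U (\<lambda>N z. scaled_kernel N \<sigma> (interleave z a) (interleave z b))
      (\<lambda>z. edge_kernel (interleave z a) (interleave z b)) sequentially" by simp
  have "bounded (case_prod edge_kernel ` ?K)"
    by (intro compact_imp_bounded compact_continuous_image K
        continuous_on_subset[OF continuous_convergence_imp_continuous[OF conv]]) auto
  then obtain B where "\<And>p. p \<in> ?K \<Longrightarrow> cmod (case_prod edge_kernel p) \<le> B" by (auto simp: bounded_iff)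
  then have B: "cmod (edge_kernel (interleave z a) (interleave z b)) \<le> B" if "z \<in> U" for z
    using il[OF that] a b by force
  then have 2: "bounded ((\<lambda>z. edge_kernel (interleave z a) (interleave z b)) ` U)" by (auto simp: bounded_iff)
  have e: "cmod (?e z) \<le> 1" for z by (simp add: diff_le_eq add_nonneg_nonneg)
  then have 3: "bounded (?e ` U)" unfolding bounded_iff by blast
  show "uniform_limit U (\<lambda>N z. ?e z * scaled_kernel N \<sigma> (interleave z a) (interleave z b)) (\<lambda>z. edge_matrix z a b) sequentially"
    unfolding edge_matrix_eq by (rule uniform_lim_mult[OF uniform_limit_const 1 3 2])
  have "cmod (edge_matrix z a b) \<le> 1 * B" if "z \<in> U" for z
    unfolding edge_matrix_eq norm_mult using e[of z] B[OF that] by (intro mult_mono) auto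
  then show "bounded ((\<lambda>z. edge_matrix z a b) ` U)" by (auto simp: bounded_iff)
qed

theorem theorem2p3:
  fixes \<sigma> p :: complex and k :: nat
  assumes "\<sigma> \<in> {1, -1}"
    and "p = \<sigma> * complex_of_real (sqrt 2)"
    and "k \<ge> 1"
  shows "locally_uniform_limit (left_half_plane_power k)
           (\<lambda>N z. complex_of_real (rescaled_correlation p \<sigma> N hard_edge_potential k z))
           (limit_correlation k) sequentially"
  unfolding locally_uniform_limit_def
proof
  fix z0 assume "z0 \<in> topspace (left_half_plane_power k)"
  then have z0: "z0 \<in> {..<k} \<rightarrow>\<^sub>E left_half_plane"
    by (simp add: left_half_plane_power_def)
  \<comment> \<open>Half the smallest distance of the points to the imaginary axis: on balls of this
    radius the real parts stay at most \<open>- \<rho>\<close>, while \<open>R\<close> bounds the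
    moduli.\<close>
  define \<rho> where "\<rho> = Min ((\<lambda>j. - Re (z0 j) / 2) ` {..<k})"
  define R where "R = Max ((\<lambda>j. cmod (z0 j)) ` {..<k}) + \<rho>"
  have ne: "(\<lambda>j. h j) ` {..<k} \<noteq> {}" for h :: "nat \<Rightarrow> real" using assms(3) by (simp add: lessThan_empty_iff)
  have \<rho>: "\<rho> > 0"
    unfolding \<rho>_def using ne z0 by (subst Min_gr_iff) (auto simp: left_half_plane_def PiE_iff)
  have \<rho>_le: "Re (z0 j) \<le> - 2 * \<rho>" if "j < k" for j
  proof -
    have "\<rho> \<le> - Re (z0 j) / 2" unfolding \<rho>_def using that by (intro Min_le) auto
    then show ?thesis by simp
  qed
  have R_ge: "cmod (z0 j) + \<rho> \<le> R" if "j < k" for j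
    unfolding R_def using that by (intro add_right_mono Max_ge) auto
  define V where "V = PiE {..<k} (\<lambda>j. ball (z0 j) \<rho>)"
  have V: "Re (z j) \<le> - \<rho>" "cmod (z j) \<le> R" if z: "z \<in> V" and j: "j < k" for z j
  proof -
    have d: "cmod (z0 j - z j) < \<rho>" using z j by (auto simp: V_def PiE_iff dist_norm)
    have "\<bar>Re (z0 j - z j)\<bar> \<le> cmod (z0 j - z j)" by (rule abs_Re_le_cmod)
    then show "Re (z j) \<le> - \<rho>" using d \<rho>_le[OF j] by simp
    have "cmod (z j) \<le> cmod (z0 j) + cmod (z0 j - z j)" by (metis norm_minus_commute norm_triangle_sub)
    then show "cmod (z j) \<le> R" using d R_ge[OF j] by linarith
  qed
  have "openin (left_half_plane_power k) V"
    unfolding left_half_plane_power_def V_def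
  proof (rule openin_PiE_gen[THEN iffD2], intro disjI2 conjI ballI)
    show "openin (top_of_set left_half_plane) (ball (z0 j) \<rho>)" if "j \<in> {..<k}" for j
    proof -
      have "ball (z0 j) \<rho> \<subseteq> left_half_plane"
      proof
        fix x assume "x \<in> ball (z0 j) \<rho>"
        then have "cmod (z0 j - x) < \<rho>" by (simp add: dist_norm)
        then show "x \<in> left_half_plane"
          using abs_Re_le_cmod[of "z0 j - x"] \<rho>_le[of j] \<rho> that by (simp add: left_half_plane_def)
      qed
      then show ?thesis by (simp add: open_subset)
    qed
  qed simp
  moreover have "z0 \<in> V" using z0 \<rho> by (auto simp: V_def PiE_iff)
  moreover have "uniform_limit V (\<lambda>N z. complex_of_real (rescaled_correlation p \<sigma> N hard_edge_potential k z)) (limit_correlation k) sequentially"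
  proof (rule uniform_limit_cong[THEN iffD2])
    let ?T = "\<lambda>N z a b. complex_of_real (exp (- (cmod (z (a div 2)))\<^sup>2 - (cmod (z (b div 2)))\<^sup>2)) *
      scaled_kernel N \<sigma> (interleave z a) (interleave z b)"
    \<comment> \<open>On \<open>V\<close> the term \<open>4 * sqrt N * Re z\<close> is at most
      \<open>- 4 * sqrt N * \<rho>\<close> and the quadratic one at most \<open>2 * R^2\<close>, so
      this threshold puts all points into the disk.\<close>
    have "eventually (\<lambda>N. R\<^sup>2 \<le> 2 * sqrt (real N) * \<rho>) sequentially"
    proof -
      have "filterlim (\<lambda>N. 2 * \<rho> * sqrt (real N)) at_top sequentially"
        using \<rho> by (intro filterlim_tendsto_pos_mult_at_top[OF tendsto_const] filterlim_compose[OF sqrt_at_top] filterlim_real_sequentially) simp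
      then have "eventually (\<lambda>N. R\<^sup>2 \<le> 2 * \<rho> * sqrt (real N)) sequentially" by (simp add: filterlim_at_top)
      then show ?thesis by (simp add: mult_ac)
    qed
    then show "\<forall>\<^sub>F N in sequentially. \<forall>z\<in>V. complex_of_real (rescaled_correlation p \<sigma> N hard_edge_potential k z) =
        (\<Prod>j<k. cnj (z j) - z j) * pfaffian k (?T N z)"
      using eventually_ge_at_top[of k]
    proof eventually_elim
      case (elim N)
      have N: "N > 0" using elim assms(3) by simp
      show ?case
      proof
        fix z assume z: "z \<in> V"
        show "complex_of_real (rescaled_correlation p \<sigma> N hard_edge_potential k z) = (\<Prod>j<k. cnj (z j) - z j) * pfaffian k (?T N z)"
        proof (rule rescaled_correlation_eq[OF N elim(2) assms(1,2)])
          fix j assume j: "j < k"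
          have "4 * sqrt N * Re (z j) \<le> 4 * sqrt N * (- \<rho>)" by (intro mult_left_mono V(1)[OF z j]) simp
          moreover have "(cmod (z j))\<^sup>2 \<le> R\<^sup>2" by (intro power_mono V(2)[OF z j]) simp
          moreover have "4 * sqrt N * (- \<rho>) = - (2 * (2 * sqrt (real N) * \<rho>))" by simp
          ultimately have "real N * (cmod (rescale N \<sigma> (z j)))\<^sup>2 \<le> real N * 2"
            unfolding cmod_rescale_sq[OF N assms(1)] using elim(1) by linarith
          then have "(cmod (rescale N \<sigma> (z j)))\<^sup>2 \<le> 2" using N by simp
          then show "cmod (rescale N \<sigma> (z j)) \<le> sqrt 2" by (rule real_le_rsqrt)
        qed
      qed
    qed
    show "limit_correlation k z = (\<Prod>j<k. cnj (z j) - z j) * pfaffian k (edge_matrix z)" for z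
      by (simp add: limit_correlation_def)
    have "cmod (cnj (z j) - z j) \<le> R + R" if "z \<in> V" "j < k" for z j
      using norm_triangle_ineq4[of "cnj (z j)" "z j"] V(2)[OF that] by simp
    then have "bounded ((\<lambda>z. cnj (z j) - z j) ` V)" if "j < k" for j
      using that by (auto simp: bounded_iff)
    \<comment> \<open>The product lemma is applied to sequences constant in \<open>N\<close>, for
      the sake of its statement on boundedness.\<close>
    then have pr: "bounded ((\<lambda>z. \<Prod>j<k. cnj (z j) - z j) ` V)"
      using uniform_limit_prod[where J = "{..<k}" and U = V and F = sequentially and
          f = "\<lambda>j _ z. cnj (z j) - z j" and g = "\<lambda>j z. cnj (z j) - z j"]
      by (simp add: uniform_limit_const)
    have ent1: "uniform_limit V (\<lambda>N z. ?T N z a b) (\<lambda>z. edge_matrix z a b) sequentially"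
      if "a < 2 * k" "b < 2 * k" for a b
      by (rule kernel_entry_uniform_limit(1)[where k = k and R = R]) (use assms(1) V(2) that in auto)
    have ent2: "bounded ((\<lambda>z. edge_matrix z a b) ` V)" if "a < 2 * k" "b < 2 * k" for a b
      by (rule kernel_entry_uniform_limit(2)[where k = k and R = R]) (use assms(1) V(2) that in auto)
    show "uniform_limit V (\<lambda>N z. (\<Prod>j<k. cnj (z j) - z j) * pfaffian k (?T N z))
       (\<lambda>z. (\<Prod>j<k. cnj (z j) - z j) * pfaffian k (edge_matrix z)) sequentially"
      by (rule uniform_lim_mult[OF uniform_limit_const uniform_limit_pfaffian(1) pr uniform_limit_pfaffian(2)])
         (fact ent1 ent2)+
  qed
  ultimately show "\<exists>U. openin (left_half_plane_power k) U \<and> z0 \<in> U \<and>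
      uniform_limit U (\<lambda>N z. complex_of_real (rescaled_correlation p \<sigma> N hard_edge_potential k z)) (limit_correlation k) sequentially"
    by blast
qed

end
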